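(* Let $A\subset X$ be an arbitrary set. Then $\mathrm{Cap}_1(A\setminus b_1 A)=0$.
   Context: Standing assumptions: $(X,d,\mu)$ is a complete metric space with at least two points, equipped with a Borel regular outer measure $\mu$ that is doubling: there is $C_d\ge 1$ with $0<\mu(B(x,2r))\le C_d\,\mu(B(x,r))<\infty$ for every ball $B(x,r):=\{y\in X: d(y,x)<r\}$. All functions take values in $[-\infty,\infty]$. A curve is a nonconstant rectifiable continuous map from a compact interval into $X$. A nonnegative Borel function $g$ on $X$ is an upper gradient of a function $u$ on $X$ if $|u(x)-u(y)|\le\int_\gamma g\,ds$ for every curve $\gamma$ with end points $x,y$ (where $|u(x)-u(y)|:=\infty$ if at least one of $|u(x)|,|u(y)|$ is infinite). It is assumed that $X$ supports a $(1,1)$-Poincaré inequality: there are $C_P>0$, $\lambda\ge1$ such that for every ball $B(x,r)$, every $u\in L^1_{\mathrm{loc}}(X)$ and every upper gradient $g$ of $u$, $\frac{1}{\mu(B(x,r))}\int_{B(x,r)}|u-u_{B(x,r)}|\,d\mu\le C_P\, r\,\frac{1}{\mu(B(x,\lambda r))}\int_{B(x,\lambda r)}g\,d\mu$, where $u_{B(x,r)}$ is the mean value of $u$ over $B(x,r)$. Newton–Sobolev space: $\|u\|_{N^{1,1}(X)}:=\|u\|_{L^1(X)}+\inf\|g\|_{L^1(X)}$, the infimum over all $1$-weak upper gradients $g$ of $u$ (i.e. the upper gradient inequality holds for all curves outside a family of zero $1$-modulus), and $N^{1,1}(X):=\{u:\|u\|_{N^{1,1}(X)}<\infty\}$; such functions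 are defined at every point of $X$. Capacities: for $A\subset X$, $\mathrm{Cap}_1(A):=\inf\|u\|_{N^{1,1}(X)}$ over all $u\in N^{1,1}(X)$ with $u\ge1$ on $A$. For $A\subset D\subset X$, $\mathrm{cap}_1(A,D):=\inf\int_X g_u\,d\mu$ over all $u\in N^{1,1}(X)$ with $u\ge1$ on $A$ and $u=0$ on $X\setminus D$, and all upper gradients $g_u$ of $u$. A set $A\subset X$ is $1$-thin at $x\in X$ if $\lim_{r\to0} r\,\frac{\mathrm{cap}_1(A\cap B(x,r),B(x,2r))}{\mu(B(x,r))}=0$, and $1$-thick at $x$ if it is not $1$-thin at $x$. The $1$-base $b_1A$ is the set of points $x\in X$ at which $A$ is $1$-thick. *)

theory Defs
  imports "HOL-Analysis.Analysis"
begin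

section \<open>Borel regular outer measures\<close>

text \<open>The metric space is a whole type of class \<^class>\<open>complete_space\<close>.\<close>

definition borel_regular_outer_measure :: "('a::topological_space set \<Rightarrow> ennreal) \<Rightarrow> bool" where
  "borel_regular_outer_measure \<mu> \<longleftrightarrow>
     outer_measure_space (Pow UNIV) \<mu> \<and>
     sets borel \<subseteq> lambda_system UNIV (Pow UNIV) \<mu> \<and>
     (\<forall>A. \<exists>B\<in>sets borel. A \<subseteq> B \<and> \<mu> B = \<mu> A)"

text \<open>The measure obtained by restricting \<open>\<mu>\<close> to its Caratheodory measurable sets;
  all integrals with respect to \<open>\<mu>\<close> are taken with respect to it.\<close>

definition outer_meas :: "('a set \<Rightarrow> ennreal) \<Rightarrow> 'a measure" where
  "outer_meas \<mu> = measure_of UNIV (lambda_system UNIV (Pow UNIV) \<mu>) \<mu>"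

lemma
  assumes "outer_measure_space (Pow UNIV) \<mu>"
  shows space_outer_meas: "space (outer_meas \<mu>) = UNIV"
    and sets_outer_meas: "sets (outer_meas \<mu>) = lambda_system UNIV (Pow UNIV) \<mu>"
    and emeasure_outer_meas:
      "A \<in> lambda_system UNIV (Pow UNIV) \<mu> \<Longrightarrow> emeasure (outer_meas \<mu>) A = \<mu> A"
proof -
  let ?L = "lambda_system UNIV (Pow UNIV) \<mu>"
  have ms: "measure_space UNIV ?L \<mu>"
    using sigma_algebra.caratheodory_lemma[OF sigma_algebra_Pow assms] .
  then have sa: "sigma_algebra UNIV ?L"
    by (simp add: measure_space_def)
  show "space (outer_meas \<mu>) = UNIV"
    by (simp add: outer_meas_def space_measure_of_conv)
  show s: "sets (outer_meas \<mu>) = ?L"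
    unfolding outer_meas_def by (rule sigma_algebra.sets_measure_of_eq[OF sa])
  show "emeasure (outer_meas \<mu>) A = \<mu> A" if "A \<in> ?L"
    unfolding outer_meas_def
    by (rule emeasure_measure_of_sigma[OF sa _ _ that])
       (use ms in \<open>auto simp: measure_space_def\<close>)
qed

definition doubling :: "('a::metric_space set \<Rightarrow> ennreal) \<Rightarrow> bool" where
  "doubling \<mu> \<longleftrightarrow> (\<exists>C::real. C \<ge> 1 \<and> (\<forall>x. \<forall>r>0.
     0 < \<mu> (ball x (2 * r)) \<and>
     \<mu> (ball x (2 * r)) \<le> ennreal C * \<mu> (ball x r) \<and>
     ennreal C * \<mu> (ball x r) < \<infinity>))"


section \<open>Curves and line integrals\<close>

definition curve_length :: "(real \<Rightarrow> 'a::metric_space) \<Rightarrow> real \<Rightarrow> real \<Rightarrow> ennreal" where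
  "curve_length \<gamma> a b =
     (SUP ts\<in>{ts. sorted ts \<and> set ts \<subseteq> {a..b}}.
        \<Sum>i<length ts - 1. ennreal (dist (\<gamma> (ts ! i)) (\<gamma> (ts ! Suc i))))"

text \<open>A curve is encoded as a triple of a map and the end points of its compact parameter
  interval; the values of the map off that interval play no role.\<close>

type_synonym 'a curve = "(real \<Rightarrow> 'a) \<times> real \<times> real"

definition curves :: "'a::metric_space curve set" where
  "curves = {(\<gamma>, a, b). a \<le> b \<and> continuous_on {a..b} \<gamma> \<and>
     curve_length \<gamma> a b < \<infinity> \<and> \<not> \<gamma> constant_on {a..b}}"

text \<open>Arc-length parametrization. The choice of \<open>s\<close> is immaterial, since \<open>\<gamma>\<close> is constant on
  intervals on which its length function is constant.\<close>

definition arc_length_param :: "(real \<Rightarrow> 'a::metric_space) \<Rightarrow> real \<Rightarrow> real \<Rightarrow> real \<Rightarrow> 'a" where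
  "arc_length_param \<gamma> a b t = \<gamma> (SOME s. s \<in> {a..b} \<and> curve_length \<gamma> a s = ennreal t)"

fun line_integral :: "('a::metric_space \<Rightarrow> ennreal) \<Rightarrow> 'a curve \<Rightarrow> ennreal" where
  "line_integral g (\<gamma>, a, b) =
     (\<integral>\<^sup>+ t \<in> {0..enn2real (curve_length \<gamma> a b)}. g (arc_length_param \<gamma> a b t) \<partial>lborel)"


section \<open>Upper gradients\<close>

definition ext_diff :: "ereal \<Rightarrow> ereal \<Rightarrow> ennreal" where
  "ext_diff p q = (if \<bar>p\<bar> = \<infinity> \<or> \<bar>q\<bar> = \<infinity> then \<infinity> else e2ennreal \<bar>p - q\<bar>)"

fun ug_inequality ::
    "('a::metric_space \<Rightarrow> ereal) \<Rightarrow> ('a \<Rightarrow> ennreal) \<Rightarrow> 'a curve \<Rightarrow> bool" where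
  "ug_inequality u g (\<gamma>, a, b) \<longleftrightarrow> ext_diff (u (\<gamma> a)) (u (\<gamma> b)) \<le> line_integral g (\<gamma>, a, b)"

definition upper_gradient :: "('a::metric_space \<Rightarrow> ereal) \<Rightarrow> ('a \<Rightarrow> ennreal) \<Rightarrow> bool" where
  "upper_gradient u g \<longleftrightarrow> g \<in> borel_measurable borel \<and> (\<forall>c\<in>curves. ug_inequality u g c)"

definition modulus1 :: "('a::metric_space set \<Rightarrow> ennreal) \<Rightarrow> 'a curve set \<Rightarrow> ennreal" where
  "modulus1 \<mu> \<Gamma> =
     (INF \<rho>\<in>{\<rho>. \<rho> \<in> borel_measurable borel \<and> (\<forall>c\<in>\<Gamma>. 1 \<le> line_integral \<rho> c)}.
        \<integral>\<^sup>+ x. \<rho> x \<partial>outer_meas \<mu>)"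

definition weak_upper_gradient ::
    "('a::metric_space set \<Rightarrow> ennreal) \<Rightarrow> ('a \<Rightarrow> ereal) \<Rightarrow> ('a \<Rightarrow> ennreal) \<Rightarrow> bool" where
  "weak_upper_gradient \<mu> u g \<longleftrightarrow> g \<in> borel_measurable borel \<and>
     (\<exists>\<Gamma>\<subseteq>curves. modulus1 \<mu> \<Gamma> = 0 \<and> (\<forall>c\<in>curves - \<Gamma>. ug_inequality u g c))"


section \<open>The Poincare inequality\<close>

definition L1_loc :: "('a::metric_space set \<Rightarrow> ennreal) \<Rightarrow> ('a \<Rightarrow> ereal) set" where
  "L1_loc \<mu> = {u. u \<in> borel_measurable (outer_meas \<mu>) \<and>
     (\<forall>x. \<exists>r>0. (\<integral>\<^sup>+ y \<in> ball x r. e2ennreal \<bar>u y\<bar> \<partial>outer_meas \<mu>) < \<infinity>)}"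

text \<open>A locally integrable \<open>u\<close> is finite almost everywhere, so passing to \<^const>\<open>real_of_ereal\<close>
  only changes it on a null set. As a complete space with a doubling measure is proper, such a
  \<open>u\<close> is integrable on every ball.\<close>

definition mean_value ::
    "('a::metric_space set \<Rightarrow> ennreal) \<Rightarrow> ('a \<Rightarrow> ereal) \<Rightarrow> 'a \<Rightarrow> real \<Rightarrow> real" where
  "mean_value \<mu> u x r =
     (LINT y:ball x r|outer_meas \<mu>. real_of_ereal (u y)) / enn2real (\<mu> (ball x r))"

definition supports_poincare_1_1 :: "('a::metric_space set \<Rightarrow> ennreal) \<Rightarrow> bool" where
  "supports_poincare_1_1 \<mu> \<longleftrightarrow> (\<exists>(C::real) (\<Lambda>::real). C > 0 \<and> \<Lambda> \<ge> 1 \<and>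
     (\<forall>x. \<forall>r>0. \<forall>u\<in>L1_loc \<mu>. \<forall>g. upper_gradient u g \<longrightarrow>
        (\<integral>\<^sup>+ y \<in> ball x r. ext_diff (u y) (ereal (mean_value \<mu> u x r)) \<partial>outer_meas \<mu>)
          / \<mu> (ball x r)
        \<le> ennreal (C * r) *
          ((\<integral>\<^sup>+ y \<in> ball x (\<Lambda> * r). g y \<partial>outer_meas \<mu>) / \<mu> (ball x (\<Lambda> * r)))))"


section \<open>Newton-Sobolev functions, capacities and the 1-base\<close>

definition N11_norm :: "('a::metric_space set \<Rightarrow> ennreal) \<Rightarrow> ('a \<Rightarrow> ereal) \<Rightarrow> ennreal" where
  "N11_norm \<mu> u =
     (\<integral>\<^sup>+ x. e2ennreal \<bar>u x\<bar> \<partial>outer_meas \<mu>) +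
     (INF g\<in>{g. weak_upper_gradient \<mu> u g}. \<integral>\<^sup>+ x. g x \<partial>outer_meas \<mu>)"

definition N11 :: "('a::metric_space set \<Rightarrow> ennreal) \<Rightarrow> ('a \<Rightarrow> ereal) set" where
  "N11 \<mu> = {u. u \<in> borel_measurable (outer_meas \<mu>) \<and> N11_norm \<mu> u < \<infinity>}"

definition Cap1 :: "('a::metric_space set \<Rightarrow> ennreal) \<Rightarrow> 'a set \<Rightarrow> ennreal" where
  "Cap1 \<mu> A = (INF u\<in>{u\<in>N11 \<mu>. \<forall>x\<in>A. 1 \<le> u x}. N11_norm \<mu> u)"

text \<open>The variational capacity of \<open>A\<close> in \<open>D\<close>; only meaningful for \<open>A \<subseteq> D\<close>.\<close>

definition cap1 :: "('a::metric_space set \<Rightarrow> ennreal) \<Rightarrow> 'a set \<Rightarrow> 'a set \<Rightarrow> ennreal" where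
  "cap1 \<mu> A D =
     (INF (u, g)\<in>{(u, g). u \<in> N11 \<mu> \<and> (\<forall>x\<in>A. 1 \<le> u x) \<and> (\<forall>x\<in>- D. u x = 0) \<and>
          upper_gradient u g}.
        \<integral>\<^sup>+ x. g x \<partial>outer_meas \<mu>)"

definition thin1_at :: "('a::metric_space set \<Rightarrow> ennreal) \<Rightarrow> 'a set \<Rightarrow> 'a \<Rightarrow> bool" where
  "thin1_at \<mu> A x \<longleftrightarrow>
     ((\<lambda>r. ennreal r * (cap1 \<mu> (A \<inter> ball x r) (ball x (2 * r)) / \<mu> (ball x r))) \<longlongrightarrow> 0)
       (at_right 0)"

definition base1 :: "('a::metric_space set \<Rightarrow> ennreal) \<Rightarrow> 'a set \<Rightarrow> 'a set" where
  "base1 \<mu> A = {x. \<not> thin1_at \<mu> A x}"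

end

theory Submission
  imports Defs
begin

text \<open>
  Let \<open>E\<close> be the set of those points of \<open>A\<close> at which \<open>A\<close> is 1-thin. The idea is to measure \<open>E\<close> by its
  Hausdorff content of codimension one, the infimum of the sums of \<open>\<mu>(B) / radius(B)\<close> over the coverings
  of \<open>E\<close> by balls. A covering of small cost yields a function of small norm which is \<open>1\<close> on \<open>E\<close>
  (\<open>competitor_from_cover\<close>), so it suffices to show that the content of \<open>E\<close> vanishes.

  Thinness says that in every small ball \<open>B(x, r)\<close> around a point of \<open>E\<close> the capacity of \<open>E \<inter> B(x, r)\<close> is
  much smaller than \<open>\<mu>(B(x, r)) / r\<close>, uniformly on each of countably many pieces of \<open>E\<close>. By a
  boxing inequality (\<open>boxing_inequality\<close>) the content is at most a constant times the capacity. Hence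
  the part of a piece of \<open>E\<close> in a ball can be covered by balls whose total cost is a small fraction of
  the cost of that ball. Applying this to each ball of an arbitrary covering halves the cost, so the
  content of a bounded subset of the piece is at most half of itself
  (\<open>hausdorff_content_zero_if_locally_small\<close>): it is zero.

  The boxing inequality needs care because a competitor \<open>u\<close> for the capacity is only required to be at
  least \<open>1\<close> at the points of the set, while the Poincare inequality sees functions only up to null sets.
  The gap is closed by replacing \<open>u\<close> with a lower semicontinuous competitor. Majorize its upper gradient
  by a lower semicontinuous density which is the limit of an increasing sequence of Lipschitz densities,
  and let \<open>v(x)\<close> be the limit of the least Riemann sums of these densities along finer and finer discrete
  chains that lead from \<open>x\<close> out of the ball \<open>B(x, 2r)\<close>. The density is an upper gradient of \<open>v\<close>, and
  where \<open>u \<ge> 1\<close> also \<open>v \<ge> 1\<close>: by Arzela-Ascoli, chains of smaller cost would converge to a curve along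
  which \<open>u\<close> drops faster than its upper gradient permits (\<open>lower_semicontinuous_competitor\<close>). Around each
  point of the set \<open>v\<close> now exceeds a level \<open>t < 1/2\<close> on a whole neighbourhood, whereas at the scale of the
  ball it vanishes on a substantial part. So at some intermediate radius both \<open>{v > t}\<close> and \<open>{v \<le> t}\<close>
  fill a definite fraction of the ball. Applying the Poincare inequality to truncations of \<open>v\<close> just above
  a level \<open>t\<close> for which the mass of the density in thin layers is controlled, and selecting disjoint
  balls, gives the inequality.
\<close>

section \<open>Lengths of curves\<close>

fun polygon :: "(real \<Rightarrow> 'a::metric_space) \<Rightarrow> real list \<Rightarrow> real" where
  "polygon \<gamma> (x # y # zs) = dist (\<gamma> x) (\<gamma> y) + polygon \<gamma> (y # zs)"
| "polygon \<gamma> _ = 0"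

lemma polygon_nonneg: "0 \<le> polygon \<gamma> ts"
  by (induction \<gamma> ts rule: polygon.induct) auto

lemma sum_dist_eq_polygon:
  "(\<Sum>i<length ts - 1. ennreal (dist (\<gamma> (ts ! i)) (\<gamma> (ts ! Suc i)))) = ennreal (polygon \<gamma> ts)"
proof (induction \<gamma> ts rule: polygon.induct)
  case (1 \<gamma> x y zs)
  have "(\<Sum>i<length (x # y # zs) - 1. ennreal (dist (\<gamma> ((x # y # zs) ! i)) (\<gamma> ((x # y # zs) ! Suc i))))
     = ennreal (dist (\<gamma> x) (\<gamma> y)) + (\<Sum>i<length (y # zs) - 1. ennreal (dist (\<gamma> ((y # zs) ! i)) (\<gamma> ((y # zs) ! Suc i))))"
    by (simp add: sum.lessThan_Suc_shift del: sum.lessThan_Suc)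
  then show ?case
    unfolding 1 by (simp add: polygon_nonneg ennreal_plus)
qed auto

lemma curve_length_polygon:
  "curve_length \<gamma> a b = (SUP ts\<in>{ts. sorted ts \<and> set ts \<subseteq> {a..b}}. ennreal (polygon \<gamma> ts))"
  by (simp add: curve_length_def sum_dist_eq_polygon del: One_nat_def)

lemma polygon_le_curve_length:
  "sorted ts \<Longrightarrow> set ts \<subseteq> {a..b} \<Longrightarrow> ennreal (polygon \<gamma> ts) \<le> curve_length \<gamma> a b"
  unfolding curve_length_polygon by (rule SUP_upper) auto

lemma polygon_cut: "polygon \<gamma> (xs @ s # ys) = polygon \<gamma> (xs @ [s]) + polygon \<gamma> (s # ys)"
proof (induction xs)
  case (Cons x xs)
  then show ?case by (cases xs) auto
qed simp

lemma polygon_Cons_ge: "polygon \<gamma> ys \<le> polygon \<gamma> (y # ys)"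
  by (cases ys) auto

lemma polygon_insert: "polygon \<gamma> (xs @ ys) \<le> polygon \<gamma> (xs @ s # ys)"
proof (induction xs)
  case Nil
  show ?case using polygon_Cons_ge by simp
next
  case (Cons x xs)
  show ?case
  proof (cases xs)
    case Nil
    then show ?thesis
      by (cases ys) (auto intro: dist_triangle simp: add.assoc [symmetric])
  qed (use Cons in auto)
qed

lemma polygon_append: "polygon \<gamma> xs + polygon \<gamma> ys \<le> polygon \<gamma> (xs @ ys)"
proof (induction xs)
  case (Cons x xs)
  then show ?case
  proof (cases xs)
    case Nil
    then show ?thesis using polygon_Cons_ge by simp
  qed auto
qed simp

lemma sorted_split:
  fixes p q :: real
  assumes "sorted ts" "p \<le> q" "set ts \<inter> {p<..<q} = {}"
  shows "\<exists>xs ys. ts = xs @ ys \<and> sorted xs \<and> sorted ys \<and> set xs \<subseteq> {..p} \<and> set ys \<subseteq> {q..}"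
  using assms
proof (induction ts)
  case (Cons x ts)
  show ?case
  proof (cases "x \<le> p")
    case True
    from Cons obtain xs ys where h: "ts = xs @ ys" "sorted xs" "sorted ys" "set xs \<subseteq> {..p}" "set ys \<subseteq> {q..}"
      by auto
    then have "x # ts = (x # xs) @ ys \<and> sorted (x # xs) \<and> sorted ys \<and> set (x # xs) \<subseteq> {..p} \<and> set ys \<subseteq> {q..}"
      using Cons.prems True by auto
    then show ?thesis by blast
  next
    case False
    then have "x \<ge> q" using Cons.prems by auto
    then have "x # ts = [] @ (x # ts) \<and> sorted [] \<and> sorted (x # ts) \<and> set [] \<subseteq> {..p} \<and> set (x # ts) \<subseteq> {q..}"
      using Cons.prems by fastforce
    then show ?thesis by blast
  qed
qed auto

text \<open>If no vertex of \<open>ts\<close> lies strictly between \<open>p\<close> and \<open>q\<close>, then adding \<open>p\<close> and \<open>q\<close> as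
  vertices splits the polygon into one inscribed in \<open>\<gamma>\<close> up to \<open>p\<close>, the segment from \<open>p\<close>
  to \<open>q\<close>, and one inscribed in \<open>\<gamma>\<close> from \<open>q\<close> on. The case \<open>p = q\<close> gives additivity of the
  length, and the general case its continuity.\<close>

lemma polygon_le_split:
  assumes ts: "sorted ts" "set ts \<subseteq> {a..b}" and pq: "a \<le> p" "p \<le> q" "q \<le> b"
    and gap: "set ts \<inter> {p<..<q} = {}"
  shows "ennreal (polygon \<gamma> ts) \<le> curve_length \<gamma> a p + ennreal (dist (\<gamma> p) (\<gamma> q)) + curve_length \<gamma> q b"
proof -
  obtain xs ys where xy: "ts = xs @ ys" "sorted xs" "sorted ys" "set xs \<subseteq> {..p}" "set ys \<subseteq> {q..}"
    using sorted_split[OF ts(1) pq(2) gap] by blast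
  have "polygon \<gamma> ts \<le> polygon \<gamma> (xs @ p # q # ys)"
    unfolding xy(1) using polygon_insert[of \<gamma> xs ys q] polygon_insert[of \<gamma> xs "q # ys" p] by linarith
  also have "\<dots> = polygon \<gamma> (xs @ [p]) + dist (\<gamma> p) (\<gamma> q) + polygon \<gamma> (q # ys)"
    using polygon_cut[of \<gamma> xs p "q # ys"] by simp
  finally have "ennreal (polygon \<gamma> ts) \<le> ennreal (polygon \<gamma> (xs @ [p])) + ennreal (dist (\<gamma> p) (\<gamma> q)) + ennreal (polygon \<gamma> (q # ys))"
    by (simp add: polygon_nonneg flip: ennreal_plus)
  also have "\<dots> \<le> curve_length \<gamma> a p + ennreal (dist (\<gamma> p) (\<gamma> q)) + curve_length \<gamma> q b"
    using xy pq ts(2)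
    by (intro add_mono polygon_le_curve_length order_refl) (auto simp: sorted_append subset_iff)
  finally show ?thesis .
qed

lemma curve_length_add:
  assumes "a \<le> b" "b \<le> c"
  shows "curve_length \<gamma> a c = curve_length \<gamma> a b + curve_length \<gamma> b c"
proof (rule antisym)
  show "curve_length \<gamma> a c \<le> curve_length \<gamma> a b + curve_length \<gamma> b c"
    unfolding curve_length_polygon[of \<gamma> a c]
    using polygon_le_split[of _ a c b b \<gamma>] assms by (auto intro!: SUP_least)
  let ?P = "\<lambda>a b. {ts. sorted ts \<and> set ts \<subseteq> {a..b}}"
  have "curve_length \<gamma> a b + curve_length \<gamma> b c =
      (SUP ts\<in>?P a b. SUP us\<in>?P b c. ennreal (polygon \<gamma> ts) + ennreal (polygon \<gamma> us))"
  proof -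
    have ne: "?P a b \<noteq> {}" "?P b c \<noteq> {}"
      by (auto intro: exI[of _ "[]"])
    show ?thesis
      unfolding curve_length_polygon
      by (subst ennreal_SUP_add_left[OF ne(1), symmetric], subst ennreal_SUP_add_right[OF ne(2), symmetric]) simp
  qed
  also have "\<dots> \<le> curve_length \<gamma> a c"
  proof (intro SUP_least)
    fix ts us assume h: "ts \<in> ?P a b" "us \<in> ?P b c"
    have "ennreal (polygon \<gamma> ts) + ennreal (polygon \<gamma> us) \<le> ennreal (polygon \<gamma> (ts @ us))"
      using polygon_append[of \<gamma> ts us] by (simp add: polygon_nonneg flip: ennreal_plus)
    also have "\<dots> \<le> curve_length \<gamma> a c"
      using h assms by (intro polygon_le_curve_length) (auto simp: sorted_append, fastforce+)
    finally show "ennreal (polygon \<gamma> ts) + ennreal (polygon \<gamma> us) \<le> curve_length \<gamma> a c" .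
  qed
  finally show "curve_length \<gamma> a b + curve_length \<gamma> b c \<le> curve_length \<gamma> a c" .
qed

lemma dist_le_curve_length: "a \<le> b \<Longrightarrow> ennreal (dist (\<gamma> a) (\<gamma> b)) \<le> curve_length \<gamma> a b"
  using polygon_le_curve_length[of "[a, b]" a b \<gamma>] by simp

lemma curve_length_self [simp]: "curve_length \<gamma> a a = 0"
proof -
  have "polygon \<gamma> ts = 0" if "set ts \<subseteq> {a}" for ts
    using that by (induction \<gamma> ts rule: polygon.induct) auto
  then show ?thesis
    unfolding curve_length_polygon by (auto intro!: antisym SUP_least)
qed

lemma curve_length_finite_sub:
  assumes "a \<le> p" "p \<le> q" "q \<le> b" "curve_length \<gamma> a b < \<infinity>"
  shows "curve_length \<gamma> p q < \<infinity>"
proof -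
  have "curve_length \<gamma> a b = curve_length \<gamma> a p + (curve_length \<gamma> p q + curve_length \<gamma> q b)"
    using curve_length_add[of a p b \<gamma>] curve_length_add[of p q b \<gamma>] assms by simp
  then show ?thesis using assms by (auto simp: less_top[symmetric])
qed

lemma enn2real_curve_length_diff:
  assumes "a \<le> p" "p \<le> q" "q \<le> b" "curve_length \<gamma> a b < \<infinity>"
  shows "enn2real (curve_length \<gamma> a q) = enn2real (curve_length \<gamma> a p) + enn2real (curve_length \<gamma> p q)"
  using curve_length_add[of a p q \<gamma>] curve_length_finite_sub[of a a p b \<gamma>]
    curve_length_finite_sub[of a p q b \<gamma>] assms
  by (simp add: enn2real_plus less_top)

text \<open>Take a polygon whose length is within \<open>e\<close> of that of the curve. On an interval without vertices
  in its interior, the curve can be longer than the chord by at most \<open>e\<close>.\<close>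

lemma continuous_curve_length:
  assumes ab: "a \<le> b" and cont: "continuous_on {a..b} \<gamma>" and fin: "curve_length \<gamma> a b < \<infinity>"
  shows "continuous_on {a..b} (\<lambda>s. enn2real (curve_length \<gamma> a s))"
proof -
  let ?l = "\<lambda>p q. enn2real (curve_length \<gamma> p q)"
  show ?thesis
    unfolding continuous_on_iff
  proof (intro ballI allI impI)
    fix s e :: real assume s: "s \<in> {a..b}" and e: "e > 0"
    obtain ts where ts: "sorted ts" "set ts \<subseteq> {a..b}" "?l a b - e/2 < polygon \<gamma> ts"
    proof (cases "?l a b = 0")
      case True
      then show ?thesis using that[of "[]"] e by simp
    next
      case False
      then have "0 < ?l a b" using enn2real_nonneg[of "curve_length \<gamma> a b"] by linarith
      then have "ennreal (?l a b - e/2) < ennreal (?l a b)"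
        using e by (intro ennreal_lessI) auto
      then have "ennreal (?l a b - e/2) < curve_length \<gamma> a b"
        using fin by (simp add: less_top)
      then obtain ts where "sorted ts" "set ts \<subseteq> {a..b}" "ennreal (?l a b - e/2) < ennreal (polygon \<gamma> ts)"
        unfolding curve_length_polygon[of \<gamma> a b] less_SUP_iff by auto
      then show ?thesis
        using that[of ts] ennreal_leI[of "polygon \<gamma> ts" "?l a b - e/2"] by (auto simp flip: not_le)
    qed
    have small: "?l p q < dist (\<gamma> p) (\<gamma> q) + e/2"
      if "a \<le> p" "p \<le> q" "q \<le> b" "set ts \<inter> {p<..<q} = {}" for p q
    proof -
      have "ennreal (polygon \<gamma> ts) \<le> curve_length \<gamma> a p + ennreal (dist (\<gamma> p) (\<gamma> q)) + curve_length \<gamma> q b"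
        by (rule polygon_le_split) (use ts that in auto)
      also have "\<dots> = ennreal (?l a p + dist (\<gamma> p) (\<gamma> q) + ?l q b)"
        using curve_length_finite_sub[of a a p b \<gamma>] curve_length_finite_sub[of a q b b \<gamma>] fin that by (simp add: less_top)
      finally have "polygon \<gamma> ts \<le> ?l a p + dist (\<gamma> p) (\<gamma> q) + ?l q b"
        by (subst (asm) ennreal_le_iff) auto
      moreover have "?l a b = ?l a p + ?l p q + ?l q b"
        using enn2real_curve_length_diff[of a q b b \<gamma>] enn2real_curve_length_diff[of a p q b \<gamma>] that fin by simp
      ultimately show ?thesis using ts(3) by linarith
    qed
    obtain d1 where d1: "d1 > 0" "\<And>s'. s' \<in> {a..b} \<Longrightarrow> dist s' s < d1 \<Longrightarrow> dist (\<gamma> s') (\<gamma> s) < e/2"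
      using cont s e unfolding continuous_on_iff by (metis half_gt_zero)
    obtain d2 where d2: "d2 > 0" "\<forall>t\<in>set ts. t \<noteq> s \<longrightarrow> d2 \<le> dist s t"
      using finite_set_avoid[of "set ts" s] by auto
    show "\<exists>d>0. \<forall>s'\<in>{a..b}. dist s' s < d \<longrightarrow> dist (?l a s') (?l a s) < e"
    proof (intro exI[of _ "min d1 d2"] conjI ballI impI)
      fix s' assume s': "s' \<in> {a..b}" "dist s' s < min d1 d2"
      have g: "set ts \<inter> {min s s'<..<max s s'} = {}"
        using d2 s'(2) by (fastforce simp: dist_real_def)
      have "?l (min s s') (max s s') < dist (\<gamma> (min s s')) (\<gamma> (max s s')) + e/2"
        by (rule small) (use s s' g in auto)
      also have "dist (\<gamma> (min s s')) (\<gamma> (max s s')) = dist (\<gamma> s') (\<gamma> s)"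
        by (auto simp: min_def max_def dist_commute)
      also have "\<dots> < e/2" using d1 s' by auto
      finally have "?l (min s s') (max s s') < e" by simp
      moreover have "?l a (max s s') = ?l a (min s s') + ?l (min s s') (max s s')"
        using s s' fin by (intro enn2real_curve_length_diff) auto
      ultimately show "dist (?l a s') (?l a s) < e"
        by (auto simp: dist_real_def min_def max_def split: if_splits)
    qed (use d1 d2 in auto)
  qed
qed

section \<open>Upper gradients tested on Lipschitz paths\<close>

text \<open>On curves parametrized by arc length the line integral becomes an ordinary integral. Testing
  on all 1-Lipschitz paths, and not only on those, makes the condition inherited by subpaths
  for free and spares reparametrizations.\<close>

definition path_upper_gradient :: "('a::metric_space \<Rightarrow> real) \<Rightarrow> ('a \<Rightarrow> ennreal) \<Rightarrow> bool" where
  "path_upper_gradient v g \<longleftrightarrow> (\<forall>h (a::real) b. a \<le> b \<longrightarrow> 1-lipschitz_on {a..b} h \<longrightarrow>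
     ennreal \<bar>v (h a) - v (h b)\<bar> \<le> (\<integral>\<^sup>+ t \<in> {a..b}. g (h t) \<partial>lborel))"

lemma path_upper_gradient_SUP:
  fixes v :: "nat \<Rightarrow> 'a::metric_space \<Rightarrow> real"
  assumes ug: "\<And>n. path_upper_gradient (v n) (g n)" and gG: "\<And>n x. g n x \<le> G x"
    and bdd: "\<And>n x. v n x \<le> 1"
  shows "path_upper_gradient (\<lambda>x. SUP n. v n x) G"
  unfolding path_upper_gradient_def
proof (intro allI impI)
  fix h :: "real \<Rightarrow> 'a" and a b :: real
  assume ab: "a \<le> b" and h: "1-lipschitz_on {a..b} h"
  let ?I = "\<integral>\<^sup>+ t \<in> {a..b}. G (h t) \<partial>lborel"
  have up: "v n x \<le> (SUP n. v n x)" for n x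
    using bdd by (intro cSUP_upper) (auto intro!: bdd_aboveI[of _ 1])
  show "ennreal \<bar>(SUP n. v n (h a)) - (SUP n. v n (h b))\<bar> \<le> ?I"
  proof (cases ?I rule: ennreal_cases)
    case (real i)
    have vi: "\<bar>v n (h a) - v n (h b)\<bar> \<le> i" for n
    proof -
      have "ennreal \<bar>v n (h a) - v n (h b)\<bar> \<le> (\<integral>\<^sup>+ t \<in> {a..b}. g n (h t) \<partial>lborel)"
        by (rule ug[unfolded path_upper_gradient_def, rule_format, OF ab h])
      also have "\<dots> \<le> ?I" by (intro nn_integral_mono mult_right_mono gG) auto
      finally show ?thesis using real by simp
    qed
    have "(SUP n. v n (h a)) \<le> (SUP n. v n (h b)) + i"
    proof (rule cSUP_least)
      show "v n (h a) \<le> (SUP n. v n (h b)) + i" for n using vi[of n] up[of n "h b"] by linarith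
    qed simp
    moreover have "(SUP n. v n (h b)) \<le> (SUP n. v n (h a)) + i"
    proof (rule cSUP_least)
      show "v n (h b) \<le> (SUP n. v n (h a)) + i" for n using vi[of n] up[of n "h a"] by linarith
    qed simp
    ultimately show ?thesis unfolding real(2) by (intro ennreal_leI) auto
  qed simp
qed

lemma dist_le_curve_length_diff:
  assumes "s \<in> {a..b}" "s' \<in> {a..b}" "curve_length \<gamma> a b < \<infinity>"
  shows "dist (\<gamma> s) (\<gamma> s') \<le> \<bar>enn2real (curve_length \<gamma> a s) - enn2real (curve_length \<gamma> a s')\<bar>"
  using assms
proof (induction s s' rule: linorder_wlog)
  case (le p q)
  then have "ennreal (dist (\<gamma> p) (\<gamma> q)) \<le> curve_length \<gamma> p q"
    by (intro dist_le_curve_length) auto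
  then have "dist (\<gamma> p) (\<gamma> q) \<le> enn2real (curve_length \<gamma> p q)"
    using curve_length_finite_sub[of a p q b \<gamma>] le enn2real_mono[of "ennreal (dist (\<gamma> p) (\<gamma> q))" "curve_length \<gamma> p q"]
    by auto
  then show ?case
    using enn2real_curve_length_diff[of a p q b \<gamma>] le by auto
next
  case (sym p q)
  then show ?case by (simp add: dist_commute abs_minus_commute)
qed

text \<open>Two parameters with the same arc length have the same image, so the parametrization by arc length
  factors \<open>\<gamma>\<close> through its length function; the chord being shorter than the arc makes it
  1-Lipschitz.\<close>

lemma
  assumes c: "(\<gamma>, a, b) \<in> curves"
  shows arc_length_param_curve_length:
      "s \<in> {a..b} \<Longrightarrow> arc_length_param \<gamma> a b (enn2real (curve_length \<gamma> a s)) = \<gamma> s"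
    and curve_length_onto:
      "t \<in> {0..enn2real (curve_length \<gamma> a b)} \<Longrightarrow> \<exists>s\<in>{a..b}. enn2real (curve_length \<gamma> a s) = t"
    and arc_length_param_lipschitz:
      "1-lipschitz_on {0..enn2real (curve_length \<gamma> a b)} (arc_length_param \<gamma> a b)"
proof -
  have c': "a \<le> b" "continuous_on {a..b} \<gamma>" "curve_length \<gamma> a b < \<infinity>"
    using c by (auto simp: curves_def)
  let ?l = "\<lambda>s. enn2real (curve_length \<gamma> a s)"
  show arc: "arc_length_param \<gamma> a b (?l s) = \<gamma> s" if s: "s \<in> {a..b}" for s
  proof -
    have "curve_length \<gamma> a s < \<infinity>"
      using curve_length_finite_sub[of a a s b \<gamma>] s c' by simp
    then have "\<exists>s'. s' \<in> {a..b} \<and> curve_length \<gamma> a s' = ennreal (?l s)"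
      using s by (auto intro!: exI[of _ s] simp: less_top)
    from someI_ex[OF this] obtain s' where s': "arc_length_param \<gamma> a b (?l s) = \<gamma> s'" "s' \<in> {a..b}"
        "curve_length \<gamma> a s' = ennreal (?l s)"
      unfolding arc_length_param_def by blast
    then have "dist (\<gamma> s') (\<gamma> s) \<le> 0"
      using dist_le_curve_length_diff[of s' a b s \<gamma>] s c' by simp
    then show ?thesis using s' by simp
  qed
  show onto: "\<exists>s\<in>{a..b}. ?l s = t" if "t \<in> {0..?l b}" for t
    using IVT'[of ?l a t b] continuous_curve_length[OF c'] that c' by auto
  show "1-lipschitz_on {0..?l b} (arc_length_param \<gamma> a b)"
  proof (rule lipschitz_onI)
    fix t t' assume "t \<in> {0..?l b}" "t' \<in> {0..?l b}"
    then obtain s s' where "s \<in> {a..b}" "?l s = t" "s' \<in> {a..b}" "?l s' = t'"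
      using onto by metis
    then show "dist (arc_length_param \<gamma> a b t) (arc_length_param \<gamma> a b t') \<le> 1 * dist t t'"
      using dist_le_curve_length_diff[of s a b s' \<gamma>] c' arc by (auto simp: dist_real_def)
  qed simp
qed

lemma ext_diff_ereal [simp]: "ext_diff (ereal p) (ereal q) = ennreal \<bar>p - q\<bar>"
  by (simp add: ext_diff_def)

lemma upper_gradient_if_path_upper_gradient:
  assumes g: "g \<in> borel_measurable borel" and ug: "path_upper_gradient v g"
  shows "upper_gradient (\<lambda>x. ereal (v x)) g"
  unfolding upper_gradient_def
proof (intro conjI ballI g)
  fix c :: "'a curve" assume c: "c \<in> curves"
  obtain \<gamma> a b where ceq: "c = (\<gamma>, a, b)" by (cases c) auto
  have c': "(\<gamma>, a, b) \<in> curves" "a \<le> b" using c by (auto simp: curves_def ceq)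
  let ?L = "enn2real (curve_length \<gamma> a b)" and ?h = "arc_length_param \<gamma> a b"
  have le: "ennreal \<bar>v (?h 0) - v (?h ?L)\<bar> \<le> (\<integral>\<^sup>+ t \<in> {0..?L}. g (?h t) \<partial>lborel)"
    by (rule ug[unfolded path_upper_gradient_def, rule_format, OF enn2real_nonneg
        arc_length_param_lipschitz[OF c'(1)]])
  have ends: "?h 0 = \<gamma> a" "?h ?L = \<gamma> b"
    using arc_length_param_curve_length[OF c'(1), of a] arc_length_param_curve_length[OF c'(1), of b] c'(2)
    by simp_all
  show "ug_inequality (\<lambda>x. ereal (v x)) g c"
    unfolding ceq ug_inequality.simps ext_diff_ereal line_integral.simps
    by (rule le[unfolded ends])
qed

text \<open>A function whose decrease over short intervals is at most quadratic in their length is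
  nondecreasing: cut the interval into many equal pieces.\<close>

lemma nondecreasing_if_quadratic_decrease:
  fixes \<Psi> :: "real \<Rightarrow> real"
  assumes ab: "a \<le> b" and d: "d > 0" and K: "K \<ge> 0"
    and dec: "\<And>s t. a \<le> s \<Longrightarrow> s \<le> t \<Longrightarrow> t \<le> b \<Longrightarrow> t - s < d \<Longrightarrow> \<Psi> s - \<Psi> t \<le> K * (t - s)^2"
  shows "\<Psi> a \<le> \<Psi> b"
proof -
  have key: "\<Psi> a - \<Psi> b \<le> K * (b - a)^2 / real N" if N: "N > 0" "(b - a) / N < d" for N :: nat
  proof -
    define st where "st = (b - a) / N"
    define p where "p i = a + real i * st" for i
    have st: "0 \<le> st" "st < d" "real N * st = b - a"
      using N ab by (auto simp: st_def)
    have p: "a \<le> p i" "p i \<le> p (Suc i)" "p (Suc i) - p i = st" for i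
      using st by (auto simp: p_def algebra_simps)
    have pb: "p (Suc i) \<le> b" if "i < N" for i
    proof -
      have "real (Suc i) * st \<le> real N * st" using that st by (intro mult_right_mono) auto
      then show ?thesis using st by (simp add: p_def)
    qed
    have "\<Psi> a - \<Psi> b = - (\<Psi> (p N) - \<Psi> (p 0))"
      using st by (simp add: p_def)
    also have "\<dots> = (\<Sum>i<N. \<Psi> (p i) - \<Psi> (p (Suc i)))"
      using sum_lessThan_telescope'[of "\<lambda>i. \<Psi> (p i)" N] by simp
    also have "\<dots> \<le> (\<Sum>i<N. K * st^2)"
      using dec[OF p(1) p(2) pb] st by (intro sum_mono) (simp add: p(3))
    also have "\<dots> = K * (b - a)^2 / real N"
      using N by (simp add: st_def power2_eq_square field_simps)
    finally show ?thesis .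
  qed
  have "\<Psi> a - \<Psi> b \<le> e" if e: "e > 0" for e
  proof -
    obtain N :: nat where N: "real N > max ((b - a) / d) (max 0 (K * (b - a)^2 / e))"
      using reals_Archimedean2 by blast
    then have N0: "N > 0" by auto
    have "(b - a) / N < d" "K * (b - a)^2 / N < e"
      using N N0 d e by (auto simp: field_simps)
    then show ?thesis using key[OF N0] by linarith
  qed
  then show ?thesis using field_le_epsilon[of "\<Psi> a" "\<Psi> b"] by (simp add: algebra_simps)
qed

lemma nn_integral_interval:
  fixes F :: "real \<Rightarrow> real"
  assumes "continuous_on {a..b} F" "\<And>x. 0 \<le> F x"
  shows "(\<integral>\<^sup>+ t \<in> {a..b}. ennreal (F t) \<partial>lborel) = ennreal (integral {a..b} F)"
proof -
  have "(F has_integral integral {a..b} F) {a..b}"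
    using assms(1) integrable_continuous_interval by blast
  from nn_integral_has_integral_lebesgue'[OF assms(2) this] show ?thesis .
qed

lemma lipschitz_along_path:
  fixes f :: "'a::metric_space \<Rightarrow> real" and S :: "real set"
  assumes f: "K-lipschitz_on UNIV f" and h: "1-lipschitz_on S h" and xy: "x \<in> S" "y \<in> S"
  shows "\<bar>f (h x) - f (h y)\<bar> \<le> K * \<bar>x - y\<bar>"
proof -
  have "dist (f (h x)) (f (h y)) \<le> K * dist (h x) (h y)"
    using lipschitz_onD[OF f] by simp
  also have "\<dots> \<le> K * (1 * dist x y)"
    using lipschitz_onD[OF h xy] lipschitz_on_nonneg[OF f] by (intro mult_left_mono) auto
  finally show ?thesis by (simp add: dist_real_def)
qed

lemma curve_length_lipschitz_path:
  assumes h: "1-lipschitz_on {p..q} h" and pq: "p \<le> q"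
  shows "curve_length h p q \<le> ennreal (q - p)"
  unfolding curve_length_polygon
proof (intro SUP_least, clarify)
  fix ts assume ts: "sorted ts" "set ts \<subseteq> {p..q}"
  have "polygon h ts \<le> last ts - hd ts" if "ts \<noteq> []"
    using that ts
  proof (induction ts rule: induct_list012)
    case (3 x y zs)
    then show ?case
      using lipschitz_onD[OF h, of x y] by (auto simp: dist_real_def)
  qed auto
  moreover have "last ts - hd ts \<le> q - p" if "ts \<noteq> []"
    using that ts subsetD[OF ts(2) last_in_set[of ts]] subsetD[OF ts(2) hd_in_set[of ts]] by auto
  ultimately show "ennreal (polygon h ts) \<le> ennreal (q - p)"
    using pq by (cases "ts = []") (auto intro!: ennreal_leI)
qed

text \<open>The arc length of a 1-Lipschitz path grows at most at unit speed, so passing to the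
  arc-length parametrization can only decrease integrals.\<close>

lemma line_integral_lipschitz_path_le:
  fixes f :: "'a::metric_space \<Rightarrow> real"
  assumes h: "1-lipschitz_on {0..L} h" and L: "0 \<le> L" and nc: "\<not> h constant_on {0..L}"
    and f: "K-lipschitz_on UNIV f" and f0: "\<And>x. 0 \<le> f x"
  shows "(h, 0, L) \<in> curves"
    and "line_integral (\<lambda>x. ennreal (f x)) (h, 0, L) \<le> (\<integral>\<^sup>+ t \<in> {0..L}. ennreal (f (h t)) \<partial>lborel)"
proof -
  have K: "0 \<le> K" using f by (rule lipschitz_on_nonneg)
  have hc: "continuous_on {0..L} h"
    using lipschitz_on_continuous_on h by blast
  have len: "curve_length h p q \<le> ennreal (q - p)" if "0 \<le> p" "p \<le> q" "q \<le> L" for p q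
    using that by (intro curve_length_lipschitz_path lipschitz_on_subset[OF h]) auto
  have fin: "curve_length h 0 L < \<infinity>"
    using le_less_trans[OF len[of 0 L] ennreal_less_top] L by (simp add: infinity_ennreal_def)
  show cv: "(h, 0, L) \<in> curves"
    unfolding curves_def mem_Collect_eq prod.case by (intro conjI L hc nc fin)
  define V where "V s = enn2real (curve_length h 0 s)" for s
  define k where "k = arc_length_param h 0 L"
  have kV: "k (V s) = h s" if "s \<in> {0..L}" for s
    using arc_length_param_curve_length[OF cv that] by (simp add: k_def V_def)
  have klip: "1-lipschitz_on {0..V L} k"
    using arc_length_param_lipschitz[OF cv] by (simp add: k_def V_def)
  have V0: "V 0 = 0" by (simp add: V_def)
  have Vmono: "V s \<le> V t" and Vlip: "V t - V s \<le> t - s" if "0 \<le> s" "s \<le> t" "t \<le> L" for s t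
  proof -
    have "V t = V s + enn2real (curve_length h s t)"
      using enn2real_curve_length_diff[of 0 s t L h] that fin by (simp add: V_def)
    moreover have "enn2real (curve_length h s t) \<le> t - s"
      using len[OF that] that by (simp add: enn2real_leI)
    ultimately show "V s \<le> V t" "V t - V s \<le> t - s" by auto
  qed
  define F where "F = f \<circ> k"
  have Flip: "\<bar>F x - F y\<bar> \<le> K * \<bar>x - y\<bar>" if "x \<in> {0..V L}" "y \<in> {0..V L}" for x y
    using lipschitz_along_path[OF f klip that] by (simp add: F_def)
  note hlip = lipschitz_along_path[OF f h]
  have Fc: "continuous_on {0..V L} F"
    by (rule lipschitz_on_continuous_on[of K]) (use Flip K in \<open>auto intro!: lipschitz_onI simp: dist_real_def\<close>)
  have fhc: "continuous_on {0..L} (f \<circ> h)"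
    by (rule lipschitz_on_continuous_on[of K]) (use hlip K in \<open>auto intro!: lipschitz_onI simp: dist_real_def\<close>)
  define \<Psi> where "\<Psi> t = integral {0..t} (f \<circ> h) - integral {0..V t} F" for t
  have "\<Psi> 0 \<le> \<Psi> L"
  proof (rule nondecreasing_if_quadratic_decrease[where d = 1 and K = "2 * K" and a = 0 and b = L and \<Psi> = \<Psi>])
    fix s t :: real assume st: "0 \<le> s" "s \<le> t" "t \<le> L" "t - s < 1"
    have Vst: "0 \<le> V s" "V s \<le> V t" "V t \<le> V L" "V t - V s \<le> t - s"
      using Vmono[of 0 s] Vmono[of s t] Vmono[of t L] Vlip[of s t] st V0 by auto
    have "integral {0..s} (f \<circ> h) + integral {s..t} (f \<circ> h) = integral {0..t} (f \<circ> h)"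
      using st by (intro Henstock_Kurzweil_Integration.integral_combine integrable_continuous_interval
          continuous_on_subset[OF fhc]) auto
    moreover have "integral {0..V s} F + integral {V s..V t} F = integral {0..V t} F"
      using Vst by (intro Henstock_Kurzweil_Integration.integral_combine integrable_continuous_interval
          continuous_on_subset[OF Fc]) auto
    ultimately have eq: "\<Psi> s - \<Psi> t = integral {V s..V t} F - integral {s..t} (f \<circ> h)"
      by (simp add: \<Psi>_def)
    have "integral {V s..V t} F \<le> integral {V s..V t} (\<lambda>x. f (h s) + K * (t - s))"
    proof (rule integral_le)
      fix x assume x: "x \<in> {V s..V t}"
      then have "\<bar>F x - F (V s)\<bar> \<le> K * \<bar>x - V s\<bar>"
        using Flip[of x "V s"] Vst by auto
      also have "\<dots> \<le> K * (t - s)"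
        using x Vst K by (intro mult_left_mono) auto
      finally show "F x \<le> f (h s) + K * (t - s)"
        using kV[of s] st by (simp add: F_def)
    qed (use Vst in \<open>auto intro!: integrable_continuous_interval continuous_on_subset[OF Fc]\<close>)
    also have "\<dots> = (V t - V s) * (f (h s) + K * (t - s))"
      using Vst by simp
    also have "\<dots> \<le> (t - s) * (f (h s) + K * (t - s))"
      using Vst st K f0 by (intro mult_right_mono) auto
    finally have 1: "integral {V s..V t} F \<le> (t - s) * (f (h s) + K * (t - s))" .
    have "(t - s) * (f (h s) - K * (t - s)) = integral {s..t} (\<lambda>x. f (h s) - K * (t - s))"
      using st by simp
    also have "\<dots> \<le> integral {s..t} (f \<circ> h)"
    proof (rule integral_le)
      fix x assume x: "x \<in> {s..t}"
      then have "\<bar>f (h x) - f (h s)\<bar> \<le> K * \<bar>x - s\<bar>"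
        using hlip[of x s] st by auto
      also have "\<dots> \<le> K * (t - s)"
        using x K by (intro mult_left_mono) auto
      finally show "f (h s) - K * (t - s) \<le> (f \<circ> h) x" by simp
    qed (use st in \<open>auto intro!: integrable_continuous_interval continuous_on_subset[OF fhc]\<close>)
    finally have "(t - s) * (f (h s) - K * (t - s)) \<le> integral {s..t} (f \<circ> h)" .
    with 1 show "\<Psi> s - \<Psi> t \<le> 2 * K * (t - s)^2"
      unfolding eq by (simp add: algebra_simps power2_eq_square)
  qed (use L K in auto)
  then have le: "integral {0..V L} F \<le> integral {0..L} (f \<circ> h)"
    by (simp add: \<Psi>_def V0)
  have "line_integral (\<lambda>x. ennreal (f x)) (h, 0, L) = (\<integral>\<^sup>+ t \<in> {0..V L}. ennreal (F t) \<partial>lborel)"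
    by (simp add: F_def k_def V_def)
  also have "\<dots> = ennreal (integral {0..V L} F)"
    by (rule nn_integral_interval[OF Fc]) (simp add: F_def f0)
  also have "\<dots> \<le> ennreal (integral {0..L} (f \<circ> h))"
    using le by (rule ennreal_leI)
  also have "\<dots> = (\<integral>\<^sup>+ t \<in> {0..L}. ennreal (f (h t)) \<partial>lborel)"
    using nn_integral_interval[OF fhc] f0 by simp
  finally show "line_integral (\<lambda>x. ennreal (f x)) (h, 0, L) \<le> (\<integral>\<^sup>+ t \<in> {0..L}. ennreal (f (h t)) \<partial>lborel)" .
qed

section \<open>Chains and lower semicontinuous competitors\<close>

text \<open>\<open>chain D \<delta> g x c\<close>: a chain of steps shorter than \<open>\<delta>\<close> leads from \<open>x\<close> out of \<open>D\<close>, and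
  the Riemann sum of \<open>g\<close> along it, each step being weighted with the value of \<open>g\<close> at its
  starting point, is \<open>c\<close>.\<close>

inductive chain :: "'a::metric_space set \<Rightarrow> real \<Rightarrow> ('a \<Rightarrow> real) \<Rightarrow> 'a \<Rightarrow> real \<Rightarrow> bool"
  for D \<delta> g where
  chain_stop: "x \<notin> D \<Longrightarrow> chain D \<delta> g x 0"
| chain_step: "chain D \<delta> g y c \<Longrightarrow> dist x y < \<delta> \<Longrightarrow> chain D \<delta> g x (c + dist x y * g x)"

definition chain_value :: "'a::metric_space set \<Rightarrow> real \<Rightarrow> ('a \<Rightarrow> real) \<Rightarrow> 'a \<Rightarrow> real" where
  "chain_value D \<delta> g x = Inf (insert 1 {c. chain D \<delta> g x c})"

lemma chain_nonneg:
  assumes "\<And>x. 0 \<le> g x" "chain D \<delta> g x c"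
  shows "0 \<le> c"
  using assms(2) by induction (auto simp: assms(1))

lemma chain_mono:
  assumes "chain D \<delta>' g' x c'" "\<delta>' \<le> \<delta>" "\<And>x. g x \<le> g' x"
  shows "\<exists>c\<le>c'. chain D \<delta> g x c"
  using assms(1)
proof induction
  case (chain_stop x)
  then show ?case by (auto intro: chain.chain_stop)
next
  case (chain_step y c x)
  then obtain c0 where c0: "c0 \<le> c" "chain D \<delta> g y c0" by blast
  then have "chain D \<delta> g x (c0 + dist x y * g x)"
    using chain_step assms(2) by (intro chain.chain_step) auto
  moreover have "c0 + dist x y * g x \<le> c + dist x y * g' x"
    using c0 assms(3) by (intro add_mono mult_left_mono) auto
  ultimately show ?case by blast
qed

context
  fixes D :: "'a::metric_space set" and \<delta> :: real and g :: "'a \<Rightarrow> real"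
  assumes g0: "\<And>x. 0 \<le> g x"
begin

lemma bdd_below_chain: "bdd_below (insert 1 {c. chain D \<delta> g x c})"
  using chain_nonneg[of g] g0 by (auto intro!: bdd_belowI[of _ 0])

lemma chain_value_nonneg: "0 \<le> chain_value D \<delta> g x"
  unfolding chain_value_def using chain_nonneg[of g] g0 by (intro cInf_greatest) auto

lemma chain_value_le_1: "chain_value D \<delta> g x \<le> 1"
  unfolding chain_value_def by (intro cInf_lower bdd_below_chain) auto

lemma chain_value_le: "chain D \<delta> g x c \<Longrightarrow> chain_value D \<delta> g x \<le> c"
  unfolding chain_value_def by (intro cInf_lower bdd_below_chain) auto

lemma chain_value_outside: "x \<notin> D \<Longrightarrow> chain_value D \<delta> g x = 0"
  using chain_value_le[OF chain_stop] chain_value_nonneg by (intro antisym) auto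

lemma chain_if_chain_value_less:
  assumes "chain_value D \<delta> g x < \<kappa>" "\<kappa> \<le> 1"
  shows "\<exists>c<\<kappa>. chain D \<delta> g x c"
proof -
  obtain c where "c \<in> insert 1 {c. chain D \<delta> g x c}" "c < \<kappa>"
    using cInf_lessD[OF _ assms(1)[unfolded chain_value_def]] by auto
  then show ?thesis using assms(2) by auto
qed

lemma chain_value_step:
  assumes "dist x y < \<delta>"
  shows "chain_value D \<delta> g x \<le> chain_value D \<delta> g y + dist x y * g x"
proof -
  have "chain_value D \<delta> g x - dist x y * g x \<le> chain_value D \<delta> g y"
    unfolding chain_value_def[of D \<delta> g y]
  proof (rule cInf_greatest)
    fix c assume "c \<in> insert 1 {c. chain D \<delta> g y c}"
    then show "chain_value D \<delta> g x - dist x y * g x \<le> c"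
    proof
      assume "c = 1"
      moreover have "0 \<le> dist x y * g x" using g0 by simp
      ultimately show ?thesis using chain_value_le_1[of x] by linarith
    next
      assume "c \<in> {c. chain D \<delta> g y c}"
      then show ?thesis using chain_value_le[OF chain_step[OF _ assms]] by force
    qed
  qed simp
  then show ?thesis by simp
qed

lemma continuous_chain_value:
  assumes "0 < \<delta>" and N: "\<And>x. g x \<le> N"
  shows "continuous_on UNIV (chain_value D \<delta> g)"
  unfolding continuous_on_iff
proof (intro ballI allI impI)
  fix x :: 'a and e :: real assume e: "0 < e"
  have N0: "0 \<le> N" using g0[of x] N[of x] by simp
  show "\<exists>d>0. \<forall>y\<in>UNIV. dist y x < d \<longrightarrow> dist (chain_value D \<delta> g y) (chain_value D \<delta> g x) < e"
  proof (intro exI[of _ "min \<delta> (e / (N + 1))"] conjI ballI impI)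
    fix y assume "dist y x < min \<delta> (e / (N + 1))"
    then have d: "dist x y < \<delta>" "dist y x < \<delta>" "dist x y * (N + 1) < e"
      using N0 by (auto simp: dist_commute field_simps)
    have "dist x y * g x \<le> dist x y * (N + 1)" "dist x y * g y \<le> dist x y * (N + 1)"
      using N[of x] N[of y] by (auto intro!: mult_left_mono)
    then show "dist (chain_value D \<delta> g y) (chain_value D \<delta> g x) < e"
      using chain_value_step[OF d(1)] chain_value_step[OF d(2)] d(3)
      by (auto simp: dist_real_def dist_commute[of y x])
  qed (use assms e N0 in auto)
qed

text \<open>Along a 1-Lipschitz path, the step inequality bounds the increments of the chain value over
  short intervals by those of the integral of \<open>g\<close>, up to a quadratic error.\<close>

lemma path_upper_gradient_chain_value:
  assumes \<delta>: "0 < \<delta>" and g: "K-lipschitz_on UNIV g"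
  shows "path_upper_gradient (chain_value D \<delta> g) (\<lambda>x. ennreal (g x))"
  unfolding path_upper_gradient_def
proof (intro allI impI)
  fix h :: "real \<Rightarrow> 'a" and a b :: real
  assume ab: "a \<le> b" and h: "1-lipschitz_on {a..b} h"
  have K: "0 \<le> K" using g by (rule lipschitz_on_nonneg)
  note hlip = lipschitz_along_path[OF g h]
  have ghc: "continuous_on {a..b} (g \<circ> h)"
    by (rule lipschitz_on_continuous_on[of K]) (use hlip K in \<open>auto intro!: lipschitz_onI simp: dist_real_def\<close>)
  define G where "G t = integral {a..t} (g \<circ> h)" for t
  define \<phi> where "\<phi> t = chain_value D \<delta> g (h t)" for t
  have short: "\<bar>\<phi> s - \<phi> t\<bar> \<le> G t - G s + K * (t - s)^2"
    if st: "a \<le> s" "s \<le> t" "t \<le> b" "t - s < \<delta>" for s t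
  proof -
    have Gst: "G t - G s = integral {s..t} (g \<circ> h)"
    proof -
      have "integral {a..s} (g \<circ> h) + integral {s..t} (g \<circ> h) = integral {a..t} (g \<circ> h)"
        using st by (intro Henstock_Kurzweil_Integration.integral_combine integrable_continuous_interval
            continuous_on_subset[OF ghc]) auto
      then show ?thesis by (simp add: G_def)
    qed
    have low: "(t - s) * g (h p) \<le> G t - G s + K * (t - s)^2" if p: "p \<in> {s..t}" for p
    proof -
      have "(t - s) * (g (h p) - K * (t - s)) = integral {s..t} (\<lambda>x. g (h p) - K * (t - s))"
        using st by simp
      also have "\<dots> \<le> integral {s..t} (g \<circ> h)"
      proof (rule integral_le)
        fix x assume x: "x \<in> {s..t}"
        then have "\<bar>g (h p) - g (h x)\<bar> \<le> K * \<bar>p - x\<bar>"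
          using hlip[of p x] st p by auto
        also have "\<dots> \<le> K * (t - s)"
          using x p K by (intro mult_left_mono) auto
        finally show "g (h p) - K * (t - s) \<le> (g \<circ> h) x" by simp
      qed (use st in \<open>auto intro!: integrable_continuous_interval continuous_on_subset[OF ghc]\<close>)
      finally show ?thesis unfolding Gst by (simp add: algebra_simps power2_eq_square)
    qed
    have d: "dist (h s) (h t) \<le> t - s"
      using lipschitz_onD[OF h, of s t] st by (simp add: dist_real_def)
    have mult: "dist (h s) (h t) * g (h p) \<le> (t - s) * g (h p)" for p
      using d g0 by (rule mult_right_mono)
    have "\<phi> s - \<phi> t \<le> dist (h s) (h t) * g (h s)" "\<phi> t - \<phi> s \<le> dist (h s) (h t) * g (h t)"
      using chain_value_step[of "h s" "h t"] chain_value_step[of "h t" "h s"] d st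
      by (auto simp: \<phi>_def dist_commute)
    then show ?thesis
      using mult[of s] mult[of t] low[of s] low[of t] st by auto
  qed
  have "G a + \<phi> a \<le> G b + \<phi> b"
    by (rule nondecreasing_if_quadratic_decrease[where \<Psi> = "\<lambda>t. G t + \<phi> t", OF ab \<delta> K])
      (use short in \<open>force simp: abs_le_iff\<close>)
  moreover have "G a - \<phi> a \<le> G b - \<phi> b"
    by (rule nondecreasing_if_quadratic_decrease[where \<Psi> = "\<lambda>t. G t - \<phi> t", OF ab \<delta> K])
      (use short in \<open>force simp: abs_le_iff\<close>)
  ultimately have "\<bar>\<phi> a - \<phi> b\<bar> \<le> integral {a..b} (g \<circ> h)"
    by (auto simp: G_def)
  then show "ennreal \<bar>chain_value D \<delta> g (h a) - chain_value D \<delta> g (h b)\<bar>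
      \<le> (\<integral>\<^sup>+ t \<in> {a..b}. ennreal (g (h t)) \<partial>lborel)"
    using nn_integral_interval[OF ghc] g0 by (simp add: \<phi>_def ennreal_leI)
qed

end

lemma chain_value_mono:
  assumes "\<delta>' \<le> \<delta>" "\<And>x. g x \<le> g' x" "\<And>x. 0 \<le> g x"
  shows "chain_value D \<delta> g x \<le> chain_value D \<delta>' g' x"
  unfolding chain_value_def[of D \<delta>' g']
proof (rule cInf_greatest)
  fix c assume "c \<in> insert 1 {c. chain D \<delta>' g' x c}"
  then show "chain_value D \<delta> g x \<le> c"
  proof
    assume "c = 1"
    then show ?thesis using chain_value_le_1[of g, OF assms(3)] by simp
  next
    assume "c \<in> {c. chain D \<delta>' g' x c}"
    then obtain c0 where "c0 \<le> c" "chain D \<delta> g x c0"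
      using chain_mono[where g = g and g' = g', OF _ assms(1,2)] by blast
    then show ?thesis using chain_value_le[of g, OF assms(3)] by force
  qed
qed simp

text \<open>A chain, traversed at unit speed by waiting at each of its points for the time needed to
  reach the next one, is a path that is 1-Lipschitz up to the error \<open>\<delta>\<close>.\<close>

lemma chain_path:
  assumes "chain D \<delta> g x c" and g: "\<And>x. 0 \<le> g x" and \<delta>: "0 < \<delta>"
  shows "\<exists>L h. 0 \<le> L \<and> h 0 = x \<and> h L \<notin> D
    \<and> (\<forall>s t. 0 \<le> s \<and> s \<le> t \<longrightarrow> dist (h s) (h t) \<le> t - s + \<delta>)
    \<and> (\<forall>t\<ge>0. dist x (h t) \<le> t)
    \<and> (\<forall>f::'a::metric_space \<Rightarrow> real. (\<lambda>t. f (h t)) \<in> borel_measurable borel)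
    \<and> (\<integral>\<^sup>+ t \<in> {0..L}. ennreal (g (h t)) \<partial>lborel) \<le> ennreal c"
  using assms(1)
proof induction
  case (chain_stop x)
  then show ?case
    using \<delta> by (intro exI[of _ 0] exI[of _ "\<lambda>_. x"]) (auto simp: nn_integral_cmult)
next
  case (chain_step y c x)
  then obtain L h where L: "0 \<le> L" "h 0 = y" "h L \<notin> D"
    and h1: "\<And>s t. 0 \<le> s \<Longrightarrow> s \<le> t \<Longrightarrow> dist (h s) (h t) \<le> t - s + \<delta>"
    and h2: "\<And>t. 0 \<le> t \<Longrightarrow> dist y (h t) \<le> t"
    and m: "\<And>f::'a \<Rightarrow> real. (\<lambda>t. f (h t)) \<in> borel_measurable borel"
    and i: "(\<integral>\<^sup>+ t \<in> {0..L}. ennreal (g (h t)) \<partial>lborel) \<le> ennreal c"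
    by blast
  define l where "l = dist x y"
  have l: "0 \<le> l" "l < \<delta>" "l = 0 \<Longrightarrow> x = y" using chain_step by (auto simp: l_def)
  define k where "k t = (if t < l then x else h (t - l))" for t
  have k0: "k 0 = x" using l L by (auto simp: k_def)
  have c0: "0 \<le> c" using chain_nonneg[of g, OF g chain_step(1)] .
  have k2: "dist x (k t) \<le> t" if "0 \<le> t" for t
  proof (cases "t < l")
    case False
    then have "dist x (h (t - l)) \<le> l + (t - l)"
      unfolding l_def using h2[of "t - dist x y"] dist_triangle[of x "h (t - l)" y] by (simp add: l_def)
    then show ?thesis using False by (simp add: k_def)
  qed (use that in \<open>simp add: k_def\<close>)
  have k1: "dist (k s) (k t) \<le> t - s + \<delta>" if st: "0 \<le> s" "s \<le> t" for s t
  proof (cases "s < l")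
    case True
    then have "dist (k s) (k t) \<le> t" using k2[of t] st by (simp add: k_def)
    then show ?thesis using True l by simp
  next
    case False
    then show ?thesis using h1[of "s - l" "t - l"] st by (simp add: k_def)
  qed
  have mk: "(\<lambda>t. f (k t)) \<in> borel_measurable borel" for f :: "'a \<Rightarrow> real"
  proof -
    have [measurable]: "(\<lambda>t. f (h (t - l))) \<in> borel_measurable borel"
      using measurable_compose[OF _ m[of f], of "\<lambda>t. t - l" borel] by simp
    have "(\<lambda>t. f (k t)) = (\<lambda>t. if t < l then f x else f (h (t - l)))"
      by (auto simp: k_def)
    then show ?thesis by simp
  qed
  have "(\<integral>\<^sup>+ t \<in> {0..L + l}. ennreal (g (k t)) \<partial>lborel)
      = (\<integral>\<^sup>+ t. ennreal (g x) * indicator {0..<l} t + ennreal (g (h (t - l))) * indicator {0..L} (t - l) \<partial>lborel)"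
    using l(1) L(1) by (intro nn_integral_cong) (auto simp: k_def indicator_def)
  also have "\<dots> = ennreal (g x) * ennreal l + (\<integral>\<^sup>+ t. ennreal (g (h (t - l))) * indicator {0..L} (t - l) \<partial>lborel)"
  proof -
    have [measurable]: "(\<lambda>t. g (h (t - l))) \<in> borel_measurable borel"
      using measurable_compose[OF _ m[of g], of "\<lambda>t. t - l" borel] by simp
    show ?thesis
      using l(1) by (subst nn_integral_add) (auto simp: nn_integral_cmult_indicator)
  qed
  also have "(\<integral>\<^sup>+ t. ennreal (g (h (t - l))) * indicator {0..L} (t - l) \<partial>lborel)
      = (\<integral>\<^sup>+ t \<in> {0..L}. ennreal (g (h t)) \<partial>lborel)"
    using nn_integral_real_affine[of "\<lambda>t. ennreal (g (h t)) * indicator {0..L} t" 1 "- l"] m[of g]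
    by (simp add: add.commute)
  also have "ennreal (g x) * ennreal l + \<dots> \<le> ennreal (g x) * ennreal l + ennreal c"
    by (intro add_left_mono i)
  also have "\<dots> = ennreal (c + dist x y * g x)"
    using g[of x] l(1) c0 unfolding l_def
    by (subst ennreal_mult[symmetric]) (auto simp: ennreal_plus[symmetric] ac_simps simp del: ennreal_plus)
  finally have ik: "(\<integral>\<^sup>+ t \<in> {0..L + l}. ennreal (g (k t)) \<partial>lborel) \<le> ennreal (c + dist x y * g x)" .
  have kL: "k (L + l) \<notin> D" using L by (simp add: k_def)
  show ?case
    by (rule exI[of _ "L + l"], rule exI[of _ k]) (intro conjI allI impI k1 k2 mk ik kL k0; use L l in simp)
qed

text \<open>A diagonal argument, phrased as sequential compactness of a countable product.\<close>

lemma convergent_subsequence_on_rationals: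
  fixes z :: "nat \<Rightarrow> rat \<Rightarrow> 'a::metric_space"
  assumes "\<And>n q. z n q \<in> B q" "\<And>q. compact (B q)"
  shows "\<exists>r. strict_mono (r :: nat \<Rightarrow> nat) \<and> (\<forall>q. convergent (\<lambda>n. z (r n) q))"
proof -
  have "compactin (product_topology (\<lambda>_::rat. euclidean :: 'a topology) UNIV) (PiE UNIV B)"
    using assms(2) by (simp add: compactin_PiE)
  then have "compact (PiE UNIV B)"
    by (simp add: euclidean_product_topology)
  then have sc: "seq_compact (PiE UNIV B)"
    by (rule compact_imp_seq_compact)
  have zB: "\<forall>n. z n \<in> PiE UNIV B" using assms(1) by auto
  obtain l r where "l \<in> PiE UNIV B" and r: "strict_mono (r :: nat \<Rightarrow> nat)" "(z \<circ> r) \<longlonglongrightarrow> l"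
    by (rule seq_compactE[where f = z, OF sc zB])
  have "(\<lambda>n. z (r n) q) \<longlonglongrightarrow> l q" for q
  proof -
    have "continuous_on UNIV (\<lambda>f :: rat \<Rightarrow> 'a. f q)"
      by (rule continuous_on_product_coordinates)
    then have "isCont (\<lambda>f :: rat \<Rightarrow> 'a. f q) l"
      by (simp only: continuous_on_eq_continuous_at[OF open_UNIV] ball_UNIV)
    from isCont_tendsto_compose[OF this r(2)] show ?thesis by simp
  qed
  then show ?thesis using r(1) by (auto simp: convergent_def)
qed

text \<open>Almost 1-Lipschitz maps converge everywhere, along a subsequence, as soon as they converge
  at rational times.\<close>

lemma arzela_ascoli_almost_lipschitz:
  fixes h :: "nat \<Rightarrow> real \<Rightarrow> 'a::complete_space"
  assumes cpt: "\<And>R. compact (cball x R)"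
    and \<delta>: "\<delta> \<longlonglongrightarrow> 0"
    and h1: "\<And>n s t. 0 \<le> s \<Longrightarrow> s \<le> t \<Longrightarrow> dist (h n s) (h n t) \<le> t - s + \<delta> n"
    and h2: "\<And>n t. 0 \<le> t \<Longrightarrow> dist x (h n t) \<le> t"
  shows "\<exists>r k. strict_mono (r :: nat \<Rightarrow> nat) \<and> (\<forall>t\<ge>0. (\<lambda>n. h (r n) t) \<longlonglongrightarrow> k t)
    \<and> 1-lipschitz_on {0..} k"
proof -
  define z where "z n q = h n (max 0 (real_of_rat q))" for n q
  have "z n q \<in> cball x (max 0 (real_of_rat q))" for n q
    using h2 by (simp add: z_def)
  from convergent_subsequence_on_rationals[of z, OF this cpt]
  obtain r where r: "strict_mono (r :: nat \<Rightarrow> nat)" and conv: "\<And>q. convergent (\<lambda>n. z (r n) q)"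
    by blast
  have \<delta>r: "(\<lambda>n. \<delta> (r n)) \<longlonglongrightarrow> 0"
    using LIMSEQ_subseq_LIMSEQ[OF \<delta> r] by (simp add: o_def)
  have h1': "dist (h n s) (h n t) \<le> \<bar>t - s\<bar> + \<delta> n" if "0 \<le> s" "0 \<le> t" for n s t
    using h1[of s t n] h1[of t s n] that by (cases "s \<le> t") (auto simp: dist_commute)
  have "convergent (\<lambda>n. h (r n) t)" if t: "0 \<le> t" for t
  proof -
    have "Cauchy (\<lambda>n. h (r n) t)"
    proof (rule metric_CauchyI)
      fix e :: real assume e: "0 < e"
      obtain q where q: "t < real_of_rat q" "real_of_rat q < t + e/6"
        using of_rat_dense[of t "t + e/6"] e by auto
      have q0: "0 \<le> real_of_rat q" using q t by linarith
      then have zq: "z n q = h n (real_of_rat q)" for n unfolding z_def by (simp only: max_absorb2)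
      have "Cauchy (\<lambda>n. z (r n) q)" using conv convergent_Cauchy by blast
      then obtain M1 where M1: "\<And>m n. m \<ge> M1 \<Longrightarrow> n \<ge> M1 \<Longrightarrow> dist (z (r m) q) (z (r n) q) < e/6"
        using metric_CauchyD[of "\<lambda>n. z (r n) q" "e/6"] e by auto
      obtain M2 where M2: "\<And>n. n \<ge> M2 \<Longrightarrow> \<delta> (r n) < e/6"
        using order_tendstoD(2)[OF \<delta>r, of "e/6"] e by (auto simp: eventually_sequentially)
      have "dist (h (r m) t) (h (r n) t) < e" if mn: "m \<ge> max M1 M2" "n \<ge> max M1 M2" for m n
      proof -
        have c: "dist (h (r i) t) (z (r i) q) < e/3" if "i \<ge> max M1 M2" for i
          using h1'[OF t q0, of "r i"] M2[of i] that q unfolding zq by auto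
        have "dist (h (r m) t) (h (r n) t)
            \<le> dist (h (r m) t) (z (r m) q) + dist (z (r m) q) (z (r n) q) + dist (z (r n) q) (h (r n) t)"
          by (meson add_mono dist_triangle dist_triangle_le order_refl order_trans)
        then show ?thesis
          using c[OF mn(1)] c[OF mn(2)] M1[of m n] mn e by (simp add: dist_commute)
      qed
      then show "\<exists>M. \<forall>m\<ge>M. \<forall>n\<ge>M. dist (h (r m) t) (h (r n) t) < e" by blast
    qed
    then show ?thesis by (rule Cauchy_convergent)
  qed
  then obtain k where k: "\<And>t. 0 \<le> t \<Longrightarrow> (\<lambda>n. h (r n) t) \<longlonglongrightarrow> k t"
    unfolding convergent_def by metis
  have "1-lipschitz_on {0..} k"
  proof (rule lipschitz_onI)
    fix s t :: real assume st: "s \<in> {0..}" "t \<in> {0..}"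
    show "dist (k s) (k t) \<le> 1 * dist s t"
    proof (rule LIMSEQ_le)
      show "(\<lambda>n. dist (h (r n) s) (h (r n) t)) \<longlonglongrightarrow> dist (k s) (k t)"
        using st by (intro tendsto_dist k) auto
      show "(\<lambda>n. \<bar>t - s\<bar> + \<delta> (r n)) \<longlonglongrightarrow> 1 * dist s t"
        using tendsto_add[OF tendsto_const \<delta>r, of "\<bar>t - s\<bar>"] by (simp add: dist_real_def abs_minus_commute)
    qed (use h1' st in auto)
  qed simp
  with r k show ?thesis by blast
qed

text \<open>Chains with finer and finer steps and bounded Riemann sums subconverge to a Lipschitz path;
  by Fatou's lemma its integrals are bounded in the same way. The lower bound \<open>c0\<close> for the
  densities controls the lengths of the chains.\<close>

lemma chains_limit_path:
  fixes x :: "'a::complete_space" and g :: "nat \<Rightarrow> 'a \<Rightarrow> real"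
  assumes cpt: "\<And>R. compact (cball x R)" and D: "open D"
    and \<delta>: "\<And>n. 0 < \<delta> n" "\<delta> \<longlonglongrightarrow> 0"
    and g: "\<And>n. continuous_on UNIV (g n)" "incseq g"
    and c0: "0 < c0" "\<And>x. c0 \<le> g 0 x"
    and ch: "\<And>n. \<exists>c<\<kappa>. chain D (\<delta> n) (g n) x c"
  shows "\<exists>(L::real) h. 0 \<le> L \<and> 1-lipschitz_on {0..L} h \<and> h 0 = x \<and> h L \<notin> D
    \<and> (\<forall>m. (\<integral>\<^sup>+ t \<in> {0..L}. ennreal (g m (h t)) \<partial>lborel) \<le> ennreal \<kappa>)"
proof -
  have gm: "g m y \<le> g n y" if "m \<le> n" for m n y
    using g(2) that by (auto simp: incseq_def le_fun_def)
  have gc: "c0 \<le> g n y" for n y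
    using gm[of 0 n y] c0(2)[of y] by simp
  then have g0: "0 \<le> g n y" for n y
    using c0(1) less_imp_le order_trans by metis
  define P where "P n L h \<longleftrightarrow> 0 \<le> L \<and> h 0 = x \<and> h L \<notin> D
    \<and> (\<forall>s t. 0 \<le> s \<and> s \<le> t \<longrightarrow> dist (h s) (h t) \<le> t - s + \<delta> n)
    \<and> (\<forall>t\<ge>0. dist x (h t) \<le> t)
    \<and> (\<forall>f::'a \<Rightarrow> real. (\<lambda>t. f (h t)) \<in> borel_measurable borel)
    \<and> (\<integral>\<^sup>+ t \<in> {0..L}. ennreal (g n (h t)) \<partial>lborel) \<le> ennreal \<kappa>" for n L and h :: "real \<Rightarrow> 'a"
  have "\<exists>L h. P n L h" for n
  proof -
    obtain c where c: "c < \<kappa>" "chain D (\<delta> n) (g n) x c" using ch by blast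
    have le: "ennreal c \<le> ennreal \<kappa>" using c by (intro ennreal_leI) auto
    from chain_path[OF c(2) g0 \<delta>(1)] show ?thesis
      unfolding P_def by (elim ex_forward conj_forward) (assumption | erule order_trans[OF _ le])+
  qed
  then obtain L h where P: "\<And>n. P n (L n) (h n)"
    by metis
  have L: "0 \<le> L n" "h n 0 = x" "h n (L n) \<notin> D"
    and h1: "\<And>s t. 0 \<le> s \<Longrightarrow> s \<le> t \<Longrightarrow> dist (h n s) (h n t) \<le> t - s + \<delta> n"
    and h2: "\<And>t. 0 \<le> t \<Longrightarrow> dist x (h n t) \<le> t"
    and hm: "\<And>f::'a \<Rightarrow> real. (\<lambda>t. f (h n t)) \<in> borel_measurable borel"
    and hi: "(\<integral>\<^sup>+ t \<in> {0..L n}. ennreal (g n (h n t)) \<partial>lborel) \<le> ennreal \<kappa>" for n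
    using P[of n] by (simp_all add: P_def)
  have \<kappa>: "0 \<le> \<kappa>"
    using ch[of 0] chain_nonneg[of "g 0", OF g0] by fastforce
  have Lb: "L n \<in> {0..\<kappa> / c0}" for n
  proof -
    have "ennreal (c0 * L n) = (\<integral>\<^sup>+ t \<in> {0..L n}. ennreal c0 \<partial>lborel)"
      using c0 L(1)[of n] by (simp add: nn_integral_cmult_indicator ennreal_mult)
    also have "\<dots> \<le> (\<integral>\<^sup>+ t \<in> {0..L n}. ennreal (g n (h n t)) \<partial>lborel)"
      using gc by (intro nn_integral_mono mult_right_mono ennreal_leI) auto
    also have "\<dots> \<le> ennreal \<kappa>" by (rule hi)
    finally have "c0 * L n \<le> \<kappa>" using \<kappa> by (simp add: ennreal_le_iff)
    then show ?thesis using c0 L(1)[of n] by (simp add: field_simps)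
  qed
  obtain r1 L' where r1: "strict_mono (r1 :: nat \<Rightarrow> nat)" and L': "(L \<circ> r1) \<longlonglongrightarrow> L'" "L' \<in> {0..\<kappa> / c0}"
    using compact_Icc[of 0 "\<kappa> / c0"] Lb unfolding compact_def by metis
  have \<delta>1: "(\<lambda>n. \<delta> (r1 n)) \<longlonglongrightarrow> 0"
    using LIMSEQ_subseq_LIMSEQ[OF \<delta>(2) r1] by (simp add: o_def)
  obtain r2 k where r2: "strict_mono (r2 :: nat \<Rightarrow> nat)"
    and k: "\<And>t. 0 \<le> t \<Longrightarrow> (\<lambda>n. h (r1 (r2 n)) t) \<longlonglongrightarrow> k t" and klip: "1-lipschitz_on {0..} k"
    using arzela_ascoli_almost_lipschitz[of x "\<lambda>n. \<delta> (r1 n)" "\<lambda>n. h (r1 n)", OF cpt \<delta>1 h1 h2] by blast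
  define r where "r n = r1 (r2 n)" for n
  have r: "strict_mono r" using r1 r2 by (auto simp: r_def strict_mono_def)
  have kr: "\<And>t. 0 \<le> t \<Longrightarrow> (\<lambda>n. h (r n) t) \<longlonglongrightarrow> k t" using k by (simp add: r_def)
  have Lr: "(\<lambda>n. L (r n)) \<longlonglongrightarrow> L'"
    using LIMSEQ_subseq_LIMSEQ[OF L'(1) r2] by (simp add: o_def r_def)
  have \<delta>r: "(\<lambda>n. \<delta> (r n)) \<longlonglongrightarrow> 0"
    using LIMSEQ_subseq_LIMSEQ[OF \<delta>(2) r] by (simp add: o_def)
  have L'0: "0 \<le> L'" using L' by simp
  have k0: "k 0 = x"
    using LIMSEQ_unique[OF kr[of 0]] L(2) by simp
  have kL: "k L' \<notin> D"
  proof -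
    have "(\<lambda>n. h (r n) (L (r n))) \<longlonglongrightarrow> k L'"
    proof (rule metric_LIMSEQ_I)
      fix e :: real assume e: "0 < e"
      have "\<forall>\<^sub>F n in sequentially. dist (h (r n) L') (k L') < e/3"
        using tendstoD[OF kr[OF L'0], of "e/3"] e by simp
      moreover have "\<forall>\<^sub>F n in sequentially. \<delta> (r n) < e/3"
        using order_tendstoD(2)[OF \<delta>r, of "e/3"] e by simp
      moreover have "\<forall>\<^sub>F n in sequentially. dist (L (r n)) L' < e/3"
        using tendstoD[OF Lr, of "e/3"] e by simp
      ultimately have "\<forall>\<^sub>F n in sequentially. dist (h (r n) (L (r n))) (k L') < e"
      proof eventually_elim
        case (elim n)
        have "dist (h (r n) (L (r n))) (h (r n) L') \<le> \<bar>L (r n) - L'\<bar> + \<delta> (r n)"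
          using h1[of "L (r n)" L' "r n"] h1[of L' "L (r n)" "r n"] L(1)[of "r n"] L'0
          by (cases "L (r n) \<le> L'") (auto simp: dist_commute)
        then show ?case
          using elim dist_triangle[of "h (r n) (L (r n))" "k L'" "h (r n) L'"]
          by (simp add: dist_real_def)
      qed
      then show "\<exists>no. \<forall>n\<ge>no. dist (h (r n) (L (r n))) (k L') < e"
        by (simp add: eventually_sequentially)
    qed
    then show ?thesis
      using closed_sequentially[of "- D" "\<lambda>n. h (r n) (L (r n))" "k L'"] D L(3) by auto
  qed
  have int: "(\<integral>\<^sup>+ t \<in> {0..L'}. ennreal (g m (k t)) \<partial>lborel) \<le> ennreal \<kappa>" for m
  proof -
    let ?f = "\<lambda>n t. ennreal (g m (h (r n) t)) * indicator {0..L (r n)} t"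
    have "(\<integral>\<^sup>+ t \<in> {0..L'}. ennreal (g m (k t)) \<partial>lborel) = (\<integral>\<^sup>+ t \<in> {0..<L'}. ennreal (g m (k t)) \<partial>lborel)"
      by (intro nn_integral_cong_AE AE_I[of _ _ "{L'}"]) (auto simp: indicator_def)
    also have "\<dots> \<le> (\<integral>\<^sup>+ t. liminf (\<lambda>n. ?f n t) \<partial>lborel)"
    proof (intro nn_integral_mono)
      fix t :: real
      show "ennreal (g m (k t)) * indicator {0..<L'} t \<le> liminf (\<lambda>n. ?f n t)"
      proof (cases "t \<in> {0..<L'}")
        case True
        have "isCont (g m) (k t)" using g(1) by (simp add: continuous_on_eq_continuous_at)
        then have "(\<lambda>n. ennreal (g m (h (r n) t))) \<longlonglongrightarrow> ennreal (g m (k t))"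
          using True by (intro tendsto_ennrealI isCont_tendsto_compose[of _ "g m"] kr) auto
        moreover have "\<forall>\<^sub>F n in sequentially. ?f n t = ennreal (g m (h (r n) t))"
          using order_tendstoD(1)[OF Lr, of t] True by (auto elim!: eventually_mono simp: indicator_def)
        ultimately have "(\<lambda>n. ?f n t) \<longlonglongrightarrow> ennreal (g m (k t))"
          by (simp cong: tendsto_cong)
        then have "liminf (\<lambda>n. ?f n t) = ennreal (g m (k t))"
          by (intro lim_imp_Liminf) auto
        then show ?thesis using True by simp
      qed simp
    qed
    also have "\<dots> \<le> liminf (\<lambda>n. \<integral>\<^sup>+ t. ?f n t \<partial>lborel)"
      using hm[of "g m"] by (intro nn_integral_liminf) auto
    also have "\<dots> \<le> ennreal \<kappa>"
    proof (rule Liminf_le)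
      have "(\<integral>\<^sup>+ t. ?f n t \<partial>lborel) \<le> ennreal \<kappa>" if "m \<le> n" for n
      proof -
        have "m \<le> r n" using that seq_suble[OF r, of n] by simp
        then have "(\<integral>\<^sup>+ t. ?f n t \<partial>lborel) \<le> (\<integral>\<^sup>+ t \<in> {0..L (r n)}. ennreal (g (r n) (h (r n) t)) \<partial>lborel)"
          by (intro nn_integral_mono mult_right_mono ennreal_leI gm) auto
        also have "\<dots> \<le> ennreal \<kappa>" by (rule hi)
        finally show ?thesis .
      qed
      then show "\<forall>\<^sub>F n in sequentially. (\<integral>\<^sup>+ t. ?f n t \<partial>lborel) \<le> ennreal \<kappa>"
        unfolding eventually_sequentially by blast
    qed simp
    finally show ?thesis .
  qed
  have kl: "1-lipschitz_on {0..L'} k" by (rule lipschitz_on_subset[OF klip]) auto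
  show ?thesis
    by (rule exI[of _ L'], rule exI[of _ k]) (intro conjI allI L'0 kl k0 kL int)
qed


text \<open>The supremum \<open>v\<close> of the chain values is a distance to the complement of \<open>D\<close>, weighted with the
  density and capped at \<open>1\<close>. Unlike the given competitor \<open>u\<close>, it is lower semicontinuous, so that
  \<open>v > t\<close> holds on a whole neighbourhood of every point where \<open>u \<ge> 1\<close>. If \<open>v\<close> were less than \<open>1\<close> at such a point, then the limit of the chains
  would be a curve along which \<open>u\<close> drops too fast.\<close>

lemma lower_semicontinuous_competitor:
  fixes u :: "'a::complete_space \<Rightarrow> ereal" and g :: "nat \<Rightarrow> 'a \<Rightarrow> real"
  assumes cpt: "\<And>(x::'a) R. compact (cball x R)" and D: "open D"
    and ug: "upper_gradient u \<rho>" and u0: "\<And>x. x \<notin> D \<Longrightarrow> u x = 0"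
    and lip: "\<And>n. (K n)-lipschitz_on UNIV (g n)" and bdd: "\<And>n x. g n x \<le> N n"
    and inc: "incseq g" and c0: "0 < c0" "\<And>x. c0 \<le> g 0 x"
    and \<rho>: "\<And>x. \<rho> x \<le> (SUP n. ennreal (g n x))"
  shows "\<exists>v::'a \<Rightarrow> real. (\<forall>x. 0 \<le> v x \<and> v x \<le> 1) \<and> (\<forall>x. x \<notin> D \<longrightarrow> v x = 0)
    \<and> (\<forall>x. 1 \<le> u x \<longrightarrow> v x = 1) \<and> (\<forall>t. open {x. t < v x})
    \<and> path_upper_gradient v (\<lambda>x. SUP n. ennreal (g n x))"
proof -
  define \<delta> where "\<delta> n = inverse (real (Suc n))" for n
  define w where "w n = chain_value D (\<delta> n) (g n)" for n
  define v where "v x = (SUP n. w n x)" for x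
  let ?G = "\<lambda>x. SUP n. ennreal (g n x)"
  have \<delta>: "0 < \<delta> n" "\<delta> \<longlonglongrightarrow> 0" for n
    using LIMSEQ_inverse_real_of_nat unfolding \<delta>_def[abs_def] by simp_all
  have gm: "g m y \<le> g n y" if "m \<le> n" for m n y
    using inc that by (auto simp: incseq_def le_fun_def)
  have gpos: "0 \<le> g n y" for n y
    using gm[of 0 n y] c0(2)[of y] c0(1) by simp
  have w01: "0 \<le> w n x" "w n x \<le> 1" for n x
    using chain_value_nonneg[of "g n", OF gpos] chain_value_le_1[of "g n", OF gpos] by (auto simp: w_def)
  have wbdd: "bdd_above (range (\<lambda>n. w n x))" for x
    using w01 by (auto intro!: bdd_aboveI[of _ 1])
  have wv: "w n x \<le> v x" for n x
    unfolding v_def by (intro cSUP_upper wbdd) auto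
  have v01: "0 \<le> v x" "v x \<le> 1" for x
    using w01(1)[of 0 x] wv[of 0 x] w01(2) by (auto simp: v_def intro!: cSUP_least)
  have voff: "v x = 0" if "x \<notin> D" for x
    using that chain_value_outside[of "g _", OF gpos] by (simp add: v_def w_def)
  have open_v: "open {x. t < v x}" for t
  proof -
    have "{x. t < v x} = (\<Union>n. {x. t < w n x})"
      unfolding v_def using less_cSUP_iff[OF _ wbdd] by auto
    moreover have "open {x. t < w n x}" for n
      unfolding w_def
      by (intro open_Collect_less continuous_on_const continuous_chain_value[of "g n", OF gpos \<delta>(1) bdd])
    ultimately show ?thesis by auto
  qed
  have pug: "path_upper_gradient v ?G"
    unfolding v_def[abs_def]
  proof (rule path_upper_gradient_SUP[where g = "\<lambda>n x. ennreal (g n x)"])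
    show "path_upper_gradient (w n) (\<lambda>x. ennreal (g n x))" for n
      unfolding w_def by (rule path_upper_gradient_chain_value[of "g n", OF gpos \<delta>(1) lip])
    show "ennreal (g n x) \<le> ?G x" for n x by (rule SUP_upper) simp
  qed (rule w01(2))
  have "v x = 1" if ux: "1 \<le> u x" for x
  proof (rule ccontr)
    assume "v x \<noteq> 1"
    then obtain \<kappa> where \<kappa>: "v x < \<kappa>" "\<kappa> < 1" using v01[of x] dense[of "v x" 1] by force
    have xD: "x \<in> D"
    proof (rule ccontr)
      assume "x \<notin> D"
      with u0[of x] ux show False by simp
    qed
    have "\<And>n. \<exists>c<\<kappa>. chain D (\<delta> n) (g n) x c"
    proof (rule chain_if_chain_value_less[of "g _", OF gpos])
      show "chain_value D (\<delta> n) (g n) x < \<kappa>" for n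
        using wv[of n x] \<kappa> by (simp add: w_def)
    qed (use \<kappa> in simp)
    moreover have "\<And>n. continuous_on UNIV (g n)"
      using lip lipschitz_on_continuous_on by blast
    ultimately have "\<exists>(L::real) h. 0 \<le> L \<and> 1-lipschitz_on {0..L} h \<and> h 0 = x \<and> h L \<notin> D
        \<and> (\<forall>m. (\<integral>\<^sup>+ t \<in> {0..L}. ennreal (g m (h t)) \<partial>lborel) \<le> ennreal \<kappa>)"
      by (intro chains_limit_path[OF cpt D \<delta> _ inc c0])
    then obtain L :: real and h where Lh: "0 \<le> L \<and> 1-lipschitz_on {0..L} h \<and> h 0 = x \<and> h L \<notin> D
        \<and> (\<forall>m. (\<integral>\<^sup>+ t \<in> {0..L}. ennreal (g m (h t)) \<partial>lborel) \<le> ennreal \<kappa>)"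
      by (elim exE)
    then have L: "0 \<le> L" and h: "1-lipschitz_on {0..L} h" and h0: "h 0 = x" and hL: "h L \<notin> D"
      and le: "\<And>m. (\<integral>\<^sup>+ t \<in> {0..L}. ennreal (g m (h t)) \<partial>lborel) \<le> ennreal \<kappa>"
      by simp_all
    have nc: "\<not> h constant_on {0..L}"
      using L h0 hL xD unfolding constant_on_def by force
    note lp = line_integral_lipschitz_path_le[OF h L nc lip gpos]
    have cv: "(h, 0, L) \<in> curves" by (rule lp(1))
    let ?l = "enn2real (curve_length h 0 L)" and ?k = "arc_length_param h 0 L"
    have "ext_diff (u x) (u (h L)) \<le> line_integral \<rho> (h, 0, L)"
      using ug cv h0 unfolding upper_gradient_def by (metis ug_inequality.simps)
    also have "\<dots> \<le> (\<integral>\<^sup>+ t. (SUP n. ennreal (g n (?k t)) * indicator {0..?l} t) \<partial>lborel)"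
      unfolding line_integral.simps
      by (intro nn_integral_mono) (use \<rho> in \<open>auto simp: indicator_def\<close>)
    also have "\<dots> = (SUP n. \<integral>\<^sup>+ t. ennreal (g n (?k t)) * indicator {0..?l} t \<partial>lborel)"
    proof (rule nn_integral_monotone_convergence_SUP)
      show "incseq (\<lambda>n t. ennreal (g n (?k t)) * indicator {0..?l} t)"
        using gm by (auto simp: incseq_def le_fun_def intro!: mult_right_mono ennreal_leI)
      fix n
      have "continuous_on {0..?l} (\<lambda>t. g n (?k t))"
        using lipschitz_on_continuous_on[OF lip[of n]] lipschitz_on_continuous_on[OF arc_length_param_lipschitz[OF cv]]
        by (rule continuous_on_compose2) auto
      then have "(\<lambda>t. indicator {0..?l} t *\<^sub>R g n (?k t)) \<in> borel_measurable borel"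
        by (intro borel_measurable_continuous_on_indicator) auto
      then have "(\<lambda>t. ennreal (indicator {0..?l} t *\<^sub>R g n (?k t))) \<in> borel_measurable lborel"
        by simp
      moreover have "(\<lambda>t. ennreal (indicator {0..?l} t *\<^sub>R g n (?k t))) = (\<lambda>t. ennreal (g n (?k t)) * indicator {0..?l} t)"
        by (auto simp: indicator_def)
      ultimately show "(\<lambda>t. ennreal (g n (?k t)) * indicator {0..?l} t) \<in> borel_measurable lborel"
        by simp
    qed
    also have "\<dots> \<le> ennreal \<kappa>"
    proof (rule SUP_least)
      fix n
      show "(\<integral>\<^sup>+ t. ennreal (g n (?k t)) * indicator {0..?l} t \<partial>lborel) \<le> ennreal \<kappa>"
        using order_trans[OF lp(2) le] by simp
    qed
    also have "\<dots> < 1" using \<kappa>(2) by (metis ennreal_1 ennreal_less_one_iff)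
    finally have "ext_diff (u x) 0 < 1" using u0[OF hL] by simp
    then show False
      using ux by (cases "u x") (auto simp: ext_diff_def zero_ereal_def one_ereal_def ennreal_less_one_iff)
  qed
  with v01 voff open_v pug show ?thesis by blast
qed

section \<open>Doubling measures\<close>

locale doubling_measure =
  fixes M :: "'a::metric_space measure" and Cd :: real
  assumes sets_borel_subset: "sets borel \<subseteq> sets M"
    and space_UNIV: "space M = UNIV"
    and Cd_ge_1: "1 \<le> Cd"
    and emeasure_ball_pos: "0 < r \<Longrightarrow> 0 < emeasure M (ball x r)"
    and emeasure_ball_finite: "emeasure M (ball x r) < \<infinity>"
    and emeasure_doubling: "0 < r \<Longrightarrow> emeasure M (ball x (2 * r)) \<le> ennreal Cd * emeasure M (ball x r)"
begin

abbreviation vol :: "'a \<Rightarrow> real \<Rightarrow> real" where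
  "vol x r \<equiv> measure M (ball x r)"

lemma sets_open: "open U \<Longrightarrow> U \<in> sets M"
  using sets_borel_subset by auto

lemma sets_closed: "closed U \<Longrightarrow> U \<in> sets M"
  using sets_borel_subset by auto

lemma sets_ball [simp, measurable]: "ball x r \<in> sets M"
  by (simp add: sets_open)

lemma borel_measurable_M: "f \<in> borel_measurable borel \<Longrightarrow> f \<in> borel_measurable M"
  using sets_borel_subset by (auto simp: measurable_def space_UNIV)

lemma emeasure_ball: "emeasure M (ball x r) = ennreal (vol x r)"
  using emeasure_ball_finite[of x r] by (intro emeasure_eq_ennreal_measure) auto

lemma vol_pos: "0 < r \<Longrightarrow> 0 < vol x r"
  using emeasure_ball_pos[of r x] by (simp add: emeasure_ball)

lemma vol_mono: "ball x r \<subseteq> ball y s \<Longrightarrow> vol x r \<le> vol y s"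
  using emeasure_mono[of "ball x r" "ball y s" M] by (simp add: emeasure_ball)

lemma vol_doubling: "0 < r \<Longrightarrow> vol x (2 * r) \<le> Cd * vol x r"
  using emeasure_doubling[of r x] Cd_ge_1 by (simp add: emeasure_ball flip: ennreal_mult)

lemma vol_doubling_power: "0 < r \<Longrightarrow> vol x (2 ^ n * r) \<le> Cd ^ n * vol x r"
proof (induction n)
  case (Suc n)
  have "vol x (2 ^ Suc n * r) \<le> Cd * vol x (2 ^ n * r)"
    using vol_doubling[of "2 ^ n * r" x] Suc.prems by (simp add: mult.assoc)
  also have "\<dots> \<le> Cd * (Cd ^ n * vol x r)"
    using Suc Cd_ge_1 by (intro mult_left_mono) auto
  finally show ?case by simp
qed simp

lemma vol_compare:
  assumes "0 < s" "dist x y + r \<le> 2 ^ n * s"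
  shows "vol x r \<le> Cd ^ n * vol y s"
proof -
  have "ball x r \<subseteq> ball y (2 ^ n * s)"
  proof
    fix z assume "z \<in> ball x r"
    then show "z \<in> ball y (2 ^ n * s)"
      using dist_triangle[of y z x] assms by (simp add: dist_commute)
  qed
  then have "vol x r \<le> vol y (2 ^ n * s)" by (rule vol_mono)
  also have "\<dots> \<le> Cd ^ n * vol y s" using assms by (intro vol_doubling_power)
  finally show ?thesis .
qed

text \<open>Disjoint balls of equal radius in a bounded region have comparable volumes, so only
  finitely many fit.\<close>

lemma cball_totally_bounded:
  fixes x :: 'a
  assumes e: "0 < e"
  shows "\<exists>k. finite k \<and> cball x R \<subseteq> (\<Union>y\<in>k. ball y e)"
proof (rule ccontr)
  assume no: "\<not> ?thesis"
  have sep: "\<exists>S. finite S \<and> card S = k \<and> S \<subseteq> cball x R \<and> (\<forall>y\<in>S. \<forall>z\<in>S. y \<noteq> z \<longrightarrow> e \<le> dist y z)" for k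
  proof (induction k)
    case 0
    show ?case by (intro exI[of _ "{}"]) auto
  next
    case (Suc k)
    then obtain S where S: "finite S" "card S = k" "S \<subseteq> cball x R" "\<forall>y\<in>S. \<forall>z\<in>S. y \<noteq> z \<longrightarrow> e \<le> dist y z"
      by (elim exE conjE)
    have "\<not> cball x R \<subseteq> (\<Union>y\<in>S. ball y e)" using no S(1) by blast
    then obtain y where y: "y \<in> cball x R" "y \<notin> (\<Union>y\<in>S. ball y e)" by blast
    then have far: "e \<le> dist z y" if "z \<in> S" for z using that by (simp add: not_less)
    then have "y \<notin> S" using e by force
    moreover have "\<forall>y'\<in>insert y S. \<forall>z\<in>insert y S. y' \<noteq> z \<longrightarrow> e \<le> dist y' z"
      using S(4) far by (auto simp: dist_commute[of y])
    ultimately show ?case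
      using S(1-3) y(1) by (intro exI[of _ "insert y S"]) simp
  qed
  have R: "0 \<le> R"
    using no by (metis cball_empty finite.emptyI empty_subsetI not_le)
  obtain n :: nat where n: "R + R + e \<le> 2 ^ n * (e / 2)"
  proof -
    obtain n :: nat where "(R + R + e) / (e / 2) < 2 ^ n"
      using real_arch_pow[of 2] by auto
    then show ?thesis using that[of n] e by (simp add: field_simps)
  qed
  define V where "V = vol x (R + e)"
  have V: "0 < V" using R e by (simp add: V_def vol_pos)
  obtain k :: nat where k: "Cd ^ n < real k" using reals_Archimedean2 by blast
  obtain S where S: "finite S" "card S = k" "S \<subseteq> cball x R" "\<forall>y\<in>S. \<forall>z\<in>S. y \<noteq> z \<longrightarrow> e \<le> dist y z"
    using sep[of k] by (elim exE conjE)
  have "real k * V = (\<Sum>y\<in>S. V)" using S by simp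
  also have "\<dots> \<le> (\<Sum>y\<in>S. Cd ^ n * vol y (e / 2))"
    unfolding V_def
    using S n e by (intro sum_mono vol_compare) (auto simp: subset_iff)
  also have "\<dots> = Cd ^ n * measure M (\<Union>y\<in>S. ball y (e / 2))"
  proof -
    have "disjoint_family_on (\<lambda>y. ball y (e / 2)) S"
      unfolding disjoint_family_on_def
    proof (intro ballI impI)
      fix y z assume yz: "y \<in> S" "z \<in> S" "y \<noteq> z"
      show "ball y (e / 2) \<inter> ball z (e / 2) = {}"
        using S(4) yz by (intro disjoint_ballI) auto
    qed
    then show ?thesis
      using S(1) by (subst measure_finite_Union) (auto simp: sum_distrib_left emeasure_ball)
  qed
  also have "\<dots> \<le> Cd ^ n * V"
  proof -
    have "(\<Union>y\<in>S. ball y (e / 2)) \<subseteq> ball x (R + e)"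
    proof
      fix z assume "z \<in> (\<Union>y\<in>S. ball y (e / 2))"
      then obtain y where "y \<in> S" "dist y z < e / 2" by auto
      then show "z \<in> ball x (R + e)"
        using S(3) dist_triangle[of x z y] e by (auto simp: subset_iff)
    qed
    then have "emeasure M (\<Union>y\<in>S. ball y (e / 2)) \<le> emeasure M (ball x (R + e))"
      by (intro emeasure_mono) auto
    then have "measure M (\<Union>y\<in>S. ball y (e / 2)) \<le> V"
      using enn2real_mono[of _ "emeasure M (ball x (R + e))"] emeasure_ball_finite[of x "R + e"]
      by (simp add: measure_def V_def)
    then show ?thesis using Cd_ge_1 by (intro mult_left_mono) auto
  qed
  finally show False using k V by simp
qed

text \<open>Closed sets are approximated from outside by their metric neighbourhoods, and approximability
  from outside by open sets and from inside by closed ones passes to complements and countable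
  unions. Measures are taken inside a set \<open>W\<close> of finite measure.\<close>

lemma outer_regular_within:
  assumes W: "W \<in> sets M" "emeasure M W < \<infinity>"
    and B: "B \<in> sets borel" and e: "0 < (e::real)"
  shows "\<exists>U. open U \<and> B \<subseteq> U \<and> emeasure M (W \<inter> (U - B)) < ennreal e"
proof -
  have fin: "emeasure M (W \<inter> A) < \<infinity>" for A
    using W by (intro le_less_trans[OF emeasure_mono W(2)]) auto
  have "B \<in> sigma_sets UNIV (Collect closed)"
    using B by (simp add: borel_eq_closed)
  then have "\<forall>e>0. \<exists>U C. open U \<and> closed C \<and> C \<subseteq> B \<and> B \<subseteq> U \<and> emeasure M (W \<inter> (U - C)) < ennreal e"
  proof induction
    case (Basic C)
    show ?case
    proof (cases "C = {}")
      case True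
      then show ?thesis by (intro allI impI exI[of _ "{}"]) auto
    next
      case False
      define U where "U n = {x. infdist x C < inverse (real (Suc n))}" for n
      have U: "open (U n)" "C \<subseteq> U n" for n
        unfolding U_def by (auto intro!: open_Collect_less continuous_intros)
      have dec: "decseq (\<lambda>n. W \<inter> (U n - C))"
      proof (rule decseq_SucI)
        fix n
        have "inverse (real (Suc (Suc n))) \<le> inverse (real (Suc n))" by (intro le_imp_inverse_le) auto
        then have "U (Suc n) \<subseteq> U n"
          unfolding U_def by (intro Collect_mono impI) (erule less_le_trans)
        then show "W \<inter> (U (Suc n) - C) \<le> W \<inter> (U n - C)" by blast
      qed
      have int: "(\<Inter>n. W \<inter> (U n - C)) = {}"
      proof -
        have "x \<in> C" if "\<And>n. x \<in> U n" for x
        proof -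
          have "infdist x C \<le> 0"
            using that by (intro LIMSEQ_le_const[OF LIMSEQ_inverse_real_of_nat]) (auto simp: U_def less_imp_le intro!: exI[of _ 0])
          then have "infdist x C = 0" using infdist_nonneg[of x C] by simp
          then show ?thesis using Basic False by (simp add: in_closed_iff_infdist_zero)
        qed
        then show ?thesis by auto
      qed
      have "range (\<lambda>n. W \<inter> (U n - C)) \<subseteq> sets M"
        using Basic by (intro image_subsetI sets.Int W(1) sets.Diff sets_open[OF U(1)] sets_closed) auto
      from Lim_emeasure_decseq[OF this dec] have lim: "(\<lambda>n. emeasure M (W \<inter> (U n - C))) \<longlonglongrightarrow> 0"
        unfolding int using fin by (simp add: less_top)
      show ?thesis
      proof (intro allI impI)
        fix e :: real assume "0 < e"
        then have "\<forall>\<^sub>F n in sequentially. emeasure M (W \<inter> (U n - C)) < ennreal e"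
          using order_tendstoD(2)[OF lim, of "ennreal e"] by simp
        then obtain n where "emeasure M (W \<inter> (U n - C)) < ennreal e"
          by (auto simp: eventually_sequentially)
        then show "\<exists>U Ca. open U \<and> closed Ca \<and> Ca \<subseteq> C \<and> C \<subseteq> U \<and> emeasure M (W \<inter> (U - Ca)) < ennreal e"
          using U Basic by blast
      qed
    qed
  next
    case Empty
    show ?case by (intro allI impI exI[of _ "{}"]) auto
  next
    case (Compl a)
    show ?case
    proof (intro allI impI)
      fix e :: real assume "0 < e"
      from Compl.IH[rule_format, OF this]
      obtain U C where "open U" "closed C" "C \<subseteq> a" "a \<subseteq> U" "emeasure M (W \<inter> (U - C)) < ennreal e"
        by (elim exE conjE)
      moreover have "- C - - U = U - C" by auto
      ultimately show "\<exists>U C. open U \<and> closed C \<and> C \<subseteq> UNIV - a \<and> UNIV - a \<subseteq> U \<and> emeasure M (W \<inter> (U - C)) < ennreal e"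
        by (intro exI[of _ "- C"] exI[of _ "- U"]) auto
    qed
  next
    case (Union a)
    show ?case
    proof (intro allI impI)
      fix e :: real assume e: "0 < e"
      have "\<forall>n. \<exists>U C. open U \<and> closed C \<and> C \<subseteq> a n \<and> a n \<subseteq> U \<and> emeasure M (W \<inter> (U - C)) < ennreal (e / 2 * (1/2) ^ Suc n)"
        using Union(2) e by simp
      then obtain U C where UC: "\<And>n. open (U n)" "\<And>n. closed (C n)" "\<And>n. C n \<subseteq> a n" "\<And>n. a n \<subseteq> U n"
        "\<And>n. emeasure M (W \<inter> (U n - C n)) < ennreal (e / 2 * (1/2) ^ Suc n)"
        by metis
      define C' where "C' n = (\<Union>i<n. C i)" for n
      have C': "closed (C' n)" for n using UC by (auto simp: C'_def)
      let ?A = "\<lambda>n. W \<inter> ((\<Union>i. C i) - C' n)"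
      have Csets: "(\<Union>i. C i) \<in> sets M" using UC by (intro sets.countable_UN) (auto intro: sets_closed)
      have dec: "decseq ?A" by (intro decseq_SucI) (auto simp: C'_def)
      have int: "(\<Inter>n. ?A n) = {}" by (auto simp: C'_def)
      have "range ?A \<subseteq> sets M"
        using W C' Csets by (intro image_subsetI sets.Int sets.Diff sets_closed[OF C'])
      from Lim_emeasure_decseq[OF this dec] have lim: "(\<lambda>n. emeasure M (?A n)) \<longlonglongrightarrow> 0"
        unfolding int using fin by (simp add: less_top)
      then obtain n where n: "emeasure M (?A n) < ennreal (e / 2)"
        using order_tendstoD(2)[OF lim, of "ennreal (e / 2)"] e by (auto simp: eventually_sequentially)
      have s1: "W \<inter> (U i - C i) \<in> sets M" for i
        by (intro sets.Int W(1) sets.Diff sets_open[OF UC(1)] sets_closed[OF UC(2)])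
      then have s2: "(\<Union>i. W \<inter> (U i - C i)) \<in> sets M" by (intro sets.countable_UN) auto
      have s3: "?A n \<in> sets M"
        by (intro sets.Int W(1) sets.Diff Csets sets_closed[OF C'])
      have "emeasure M (W \<inter> ((\<Union>i. U i) - C' n)) \<le> emeasure M ((\<Union>i. W \<inter> (U i - C i)) \<union> ?A n)"
        by (rule emeasure_mono) (use s2 s3 in auto)
      also have "\<dots> \<le> emeasure M (\<Union>i. W \<inter> (U i - C i)) + emeasure M (?A n)"
        by (rule emeasure_subadditive[OF s2 s3])
      also have "emeasure M (\<Union>i. W \<inter> (U i - C i)) \<le> (\<Sum>i. emeasure M (W \<inter> (U i - C i)))"
        using s1 by (intro emeasure_subadditive_countably) auto
      also have "\<dots> \<le> (\<Sum>i. ennreal (e / 2 * (1/2) ^ Suc i))"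
        using UC(5) by (intro suminf_le) (auto intro: less_imp_le)
      also have "\<dots> = ennreal (e / 2)"
        using e sums_mult[OF power_half_series, of "e / 2"] by (intro suminf_ennreal_eq) auto
      also have "ennreal (e / 2) + emeasure M (?A n) < ennreal (e / 2) + ennreal (e / 2)"
        using n by (simp add: ennreal_add_left_cancel_less)
      also have "\<dots> = ennreal e" using e by (simp flip: ennreal_plus)
      finally have "emeasure M (W \<inter> ((\<Union>i. U i) - C' n)) < ennreal e"
        by (simp add: add_right_mono)
      moreover have "C' n \<subseteq> (\<Union>i. a i)" "(\<Union>i. a i) \<subseteq> (\<Union>i. U i)"
        using UC(3,4) unfolding C'_def by blast+
      ultimately show "\<exists>U C. open U \<and> closed C \<and> C \<subseteq> (\<Union>i. a i) \<and> (\<Union>i. a i) \<subseteq> U \<and> emeasure M (W \<inter> (U - C)) < ennreal e"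
        using UC(1) by (intro exI[of _ "\<Union>i. U i"] exI[of _ "C' n"] conjI open_UN ballI C') auto
    qed
  qed
  from this[rule_format, OF e]
  obtain U C where U: "open U" "C \<subseteq> B" "B \<subseteq> U" "closed C" "emeasure M (W \<inter> (U - C)) < ennreal e"
    by (elim exE conjE)
  moreover have "emeasure M (W \<inter> (U - B)) \<le> emeasure M (W \<inter> (U - C))"
    using U(2) by (intro emeasure_mono sets.Int W(1) sets.Diff sets_open[OF U(1)] sets_closed[OF U(4)]) auto
  ultimately show ?thesis using le_less_trans by metis
qed

end

lemma compact_cball_if_doubling:
  fixes M :: "'a::complete_space measure"
  assumes "doubling_measure M Cd"
  shows "compact (cball (x::'a) R)"
proof -
  interpret doubling_measure M Cd by fact
  show ?thesis
    using cball_totally_bounded[of _ x R] unfolding compact_eq_totally_bounded by (simp add: complete_eq_closed)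
qed

section \<open>Lower semicontinuous majorants\<close>

text \<open>Lipschitz functions that increase with \<open>n\<close> to the indicator function of an open set. The case
  \<open>U = UNIV\<close> is separate because \<^const>\<open>infdist\<close> is \<open>0\<close> for the empty set.\<close>

definition cutoff :: "'a::metric_space set \<Rightarrow> nat \<Rightarrow> 'a \<Rightarrow> real" where
  "cutoff U n x = (if U = UNIV then 1 else min 1 (real n * infdist x (- U)))"

lemma cutoff_nonneg: "0 \<le> cutoff U n x"
  by (simp add: cutoff_def infdist_nonneg)

lemma cutoff_le_indicator: "cutoff U n x \<le> indicator U x"
  by (auto simp: cutoff_def indicator_def)

lemma cutoff_mono: "m \<le> n \<Longrightarrow> cutoff U m x \<le> cutoff U n x"
  using mult_right_mono[of "real m" "real n" "infdist x (- U)"] by (auto simp: cutoff_def infdist_nonneg)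

lemma cutoff_lipschitz: "(real n)-lipschitz_on UNIV (cutoff U n)"
proof (rule lipschitz_onI)
  fix x y :: 'a
  have "\<bar>infdist x (- U) - infdist y (- U)\<bar> \<le> dist x y"
    by (rule infdist_triangle_abs)
  then have "real n * \<bar>infdist x (- U) - infdist y (- U)\<bar> \<le> real n * dist x y"
    by (rule mult_left_mono) simp
  moreover have "real n * \<bar>infdist x (- U) - infdist y (- U)\<bar> = \<bar>real n * infdist x (- U) - real n * infdist y (- U)\<bar>"
    by (simp add: abs_mult flip: right_diff_distrib)
  ultimately show "dist (cutoff U n x) (cutoff U n y) \<le> real n * dist x y"
    by (auto simp: cutoff_def dist_real_def)
qed simp

lemma cutoff_eventually_1:
  assumes "open U" "x \<in> U"
  shows "\<exists>m. \<forall>n\<ge>m. cutoff U n x = 1"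
proof (cases "U = UNIV")
  case False
  then have "0 < infdist x (- U)"
    using assms infdist_pos_not_in_closed[of "- U" x] by auto
  moreover obtain m :: nat where "1 / infdist x (- U) < real m" using reals_Archimedean2 by blast
  ultimately have "1 \<le> real n * infdist x (- U)" if "n \<ge> m" for n
    using that by (simp add: field_simps) (smt (verit) mult_right_mono of_nat_le_iff)
  then have "\<forall>n\<ge>m. cutoff U n x = 1" using False by (simp add: cutoff_def)
  then show ?thesis ..
qed (simp add: cutoff_def)

lemma dyadic_level_sum_le:
  fixes r c :: real
  assumes "0 < c"
  shows "(\<Sum>k<n. c * 2 ^ Suc k * (if c * 2 ^ k < r then 1 else 0)) \<le> 4 * max 0 r"
proof (induction n)
  case (Suc n)
  show ?case
  proof (cases "c * 2 ^ n < r")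
    case True
    have "(\<Sum>k<Suc n. c * 2 ^ Suc k * (if c * 2 ^ k < r then 1 else 0)) \<le> (\<Sum>k<Suc n. c * 2 ^ Suc k)"
      using assms by (intro sum_mono) auto
    also have "\<dots> = 2 * c * (2 ^ Suc n - 1)"
    proof -
      have "(\<Sum>k<m. c * 2 ^ Suc k) = 2 * c * (2 ^ m - 1)" for m
        by (induction m) (auto simp: algebra_simps)
      then show ?thesis .
    qed
    also have "\<dots> \<le> 4 * (c * 2 ^ n)" using assms by (simp add: algebra_simps)
    also have "\<dots> \<le> 4 * max 0 r" using True by simp
    finally show ?thesis .
  qed (use Suc in simp)
qed simp

text \<open>A version of the Vitali-Caratheodory theorem with a multiplicative constant: each dyadic
  superlevel set of \<open>\<rho>\<close> is replaced by an open set which is not much larger.\<close>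

lemma (in doubling_measure) lipschitz_majorants:
  assumes \<rho>: "\<rho> \<in> borel_measurable borel" and W: "W \<in> sets M" "emeasure M W < \<infinity>" and c: "0 < (c::real)"
  shows "\<exists>(g :: nat \<Rightarrow> 'a \<Rightarrow> real) K N. (\<forall>n. (K n)-lipschitz_on UNIV (g n)) \<and> (\<forall>n x. g n x \<le> N n)
    \<and> incseq g \<and> (\<forall>x. c \<le> g 0 x) \<and> (\<forall>x. \<rho> x \<le> (SUP n. ennreal (g n x)))
    \<and> (\<integral>\<^sup>+ x \<in> W. (SUP n. ennreal (g n x)) \<partial>M) \<le> ennreal c * (emeasure M W + 4) + 4 * (\<integral>\<^sup>+ x. \<rho> x \<partial>M)"
proof -
  define B where "B k = {x. ennreal (c * 2 ^ k) < \<rho> x}" for k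
  have B: "B k \<in> sets borel" for k
    unfolding B_def using \<rho> by simp
  have "\<exists>U. open U \<and> B k \<subseteq> U \<and> emeasure M (W \<inter> (U - B k)) < ennreal ((1/4) ^ k)" for k
    by (rule outer_regular_within[OF W B]) simp
  then obtain U where U: "\<And>k. open (U k)" "\<And>k. B k \<subseteq> U k"
      "\<And>k. emeasure M (W \<inter> (U k - B k)) < ennreal ((1/4) ^ k)"
    by metis
  define g where "g n x = c + (\<Sum>k<n. c * 2 ^ Suc k * cutoff (U k) n x)" for n x
  have 1: "(\<Sum>k<n. c * 2 ^ Suc k * real n)-lipschitz_on UNIV (g n)" for n
  proof (rule lipschitz_onI)
    fix x y :: 'a
    have "\<bar>g n x - g n y\<bar> = \<bar>\<Sum>k<n. c * 2 ^ Suc k * (cutoff (U k) n x - cutoff (U k) n y)\<bar>"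
      by (simp add: g_def sum_subtractf algebra_simps)
    also have "\<dots> \<le> (\<Sum>k<n. \<bar>c * 2 ^ Suc k * (cutoff (U k) n x - cutoff (U k) n y)\<bar>)"
      by (rule sum_abs)
    also have "\<dots> \<le> (\<Sum>k<n. c * 2 ^ Suc k * (real n * dist x y))"
    proof (rule sum_mono)
      fix k
      have "\<bar>cutoff (U k) n x - cutoff (U k) n y\<bar> \<le> real n * dist x y"
        using lipschitz_onD[OF cutoff_lipschitz[of n "U k"], of x y] by (simp add: dist_real_def)
      then have "c * 2 ^ Suc k * \<bar>cutoff (U k) n x - cutoff (U k) n y\<bar> \<le> c * 2 ^ Suc k * (real n * dist x y)"
        using c by (intro mult_left_mono) auto
      then show "\<bar>c * 2 ^ Suc k * (cutoff (U k) n x - cutoff (U k) n y)\<bar> \<le> c * 2 ^ Suc k * (real n * dist x y)"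
        using c by (simp add: abs_mult)
    qed
    also have "\<dots> = (\<Sum>k<n. c * 2 ^ Suc k * real n) * dist x y"
      by (simp add: sum_distrib_right mult.assoc)
    finally show "dist (g n x) (g n y) \<le> (\<Sum>k<n. c * 2 ^ Suc k * real n) * dist x y"
      by (simp add: dist_real_def)
  qed (use c in \<open>auto intro!: sum_nonneg\<close>)
  have 2: "g n x \<le> c + (\<Sum>k<n. c * 2 ^ Suc k * indicator (U k) x)" for n x
    unfolding g_def using c by (intro add_left_mono sum_mono mult_left_mono cutoff_le_indicator) auto
  have bnd: "g n x \<le> c + (\<Sum>k<n. c * 2 ^ Suc k)" for n x
    using c by (intro order_trans[OF 2] add_left_mono sum_mono) (auto simp: indicator_def)
  have 3: "incseq g"
  proof (rule incseq_SucI, rule le_funI)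
    fix n x
    have "g n x \<le> c + (\<Sum>k<n. c * 2 ^ Suc k * cutoff (U k) (Suc n) x)"
      unfolding g_def using c by (intro add_left_mono sum_mono mult_left_mono cutoff_mono) auto
    also have "\<dots> \<le> g (Suc n) x"
      unfolding g_def using c cutoff_nonneg[of "U n" "Suc n" x] by simp
    finally show "g n x \<le> g (Suc n) x" .
  qed
  have 4: "c \<le> g 0 x" for x by (simp add: g_def)
  have gpos: "0 \<le> g n x" for n x
    unfolding g_def using c by (intro add_nonneg_nonneg sum_nonneg mult_nonneg_nonneg cutoff_nonneg) auto
  have 5: "\<rho> x \<le> (SUP n. ennreal (g n x))" (is "_ \<le> ?G") for x
  proof (rule ccontr)
    assume "\<not> \<rho> x \<le> ?G"
    then have lt: "?G < \<rho> x" by simp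
    have all: "ennreal (c * 2 ^ k) \<le> ?G" for k
    proof (induction k)
      case 0
      show ?case using SUP_upper[of 0 UNIV "\<lambda>n. ennreal (g n x)"] by (simp add: g_def)
    next
      case (Suc k)
      have "x \<in> U k" using le_less_trans[OF Suc lt] U(2)[of k] by (auto simp: B_def)
      then obtain m where m: "\<And>n. n \<ge> m \<Longrightarrow> cutoff (U k) n x = 1"
        using cutoff_eventually_1[OF U(1)] by metis
      define n where "n = max m (Suc k)"
      have "c * 2 ^ Suc k * cutoff (U k) n x \<le> (\<Sum>k<n. c * 2 ^ Suc k * cutoff (U k) n x)"
        using c by (intro member_le_sum) (auto simp: n_def cutoff_nonneg)
      then have "c * 2 ^ Suc k \<le> g n x"
        using m[of n] c by (simp add: n_def g_def)
      then show ?case by (intro SUP_upper2[of n] ennreal_leI) auto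
    qed
    have "?G < \<infinity>" using less_le_trans[OF lt top_greatest] by simp
    then obtain G where G: "0 \<le> G" "?G = ennreal G" by (cases ?G rule: ennreal_cases) auto
    obtain k :: nat where "G / c < 2 ^ k" using real_arch_pow[of 2] by auto
    then have "G < c * 2 ^ k" using c by (simp add: field_simps)
    then show False using all[of k] G by (simp add: ennreal_le_iff)
  qed
  have 6: "(\<integral>\<^sup>+ x \<in> W. (SUP n. ennreal (g n x)) \<partial>M) \<le> ennreal c * (emeasure M W + 4) + 4 * (\<integral>\<^sup>+ x. \<rho> x \<partial>M)"
  proof -
    have UM [measurable]: "U k \<in> sets M" for k using U(1) by (rule sets_open)
    have BM [measurable]: "B k \<in> sets M" for k using B sets_borel_subset by auto
    note W(1) [measurable]
    have "(\<integral>\<^sup>+ x \<in> W. (SUP n. ennreal (g n x)) \<partial>M)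
       \<le> (\<integral>\<^sup>+ x. ennreal c * indicator W x + (\<Sum>k. ennreal (c * 2 ^ Suc k) * indicator (W \<inter> U k) x) \<partial>M)"
    proof (intro nn_integral_mono)
      fix x
      show "(SUP n. ennreal (g n x)) * indicator W x
        \<le> ennreal c * indicator W x + (\<Sum>k. ennreal (c * 2 ^ Suc k) * indicator (W \<inter> U k) x)"
      proof (cases "x \<in> W")
        case True
        have "(SUP n. ennreal (g n x)) \<le> ennreal c + (\<Sum>k. ennreal (c * 2 ^ Suc k) * indicator (U k) x)"
        proof (rule SUP_least)
          fix n
          have "ennreal (g n x) \<le> ennreal (c + (\<Sum>k<n. c * 2 ^ Suc k * indicator (U k) x))"
            using 2 by (rule ennreal_leI)
          also have "\<dots> = ennreal c + ennreal (\<Sum>k<n. c * 2 ^ Suc k * indicator (U k) x)"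
            using c by (intro ennreal_plus sum_nonneg) auto
          also have "ennreal (\<Sum>k<n. c * 2 ^ Suc k * indicator (U k) x) = (\<Sum>k<n. ennreal (c * 2 ^ Suc k * indicator (U k) x))"
            using c by (intro sum_ennreal[symmetric]) auto
          also have "\<dots> = (\<Sum>k<n. ennreal (c * 2 ^ Suc k) * indicator (U k) x)"
            by (intro sum.cong) (auto simp: indicator_def)
          also have "\<dots> \<le> (\<Sum>k. ennreal (c * 2 ^ Suc k) * indicator (U k) x)"
            by (intro sum_le_suminf) auto
          finally show "ennreal (g n x) \<le> ennreal c + (\<Sum>k. ennreal (c * 2 ^ Suc k) * indicator (U k) x)"
            by (simp add: add_left_mono)
        qed
        then show ?thesis using True by (simp add: indicator_inter_arith)
      qed simp
    qed
    also have "\<dots> = ennreal c * emeasure M W + (\<Sum>k. ennreal (c * 2 ^ Suc k) * emeasure M (W \<inter> U k))"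
      by (simp add: nn_integral_add nn_integral_suminf nn_integral_cmult_indicator)
    also have "(\<Sum>k. ennreal (c * 2 ^ Suc k) * emeasure M (W \<inter> U k))
      \<le> (\<Sum>k. ennreal (c * 2 ^ Suc k) * emeasure M (B k) + ennreal (2 * c * (1/2) ^ k))"
    proof (intro suminf_le)
      fix k
      have "emeasure M (W \<inter> U k) \<le> emeasure M (B k \<union> (W \<inter> (U k - B k)))"
        by (intro emeasure_mono) auto
      also have "\<dots> \<le> emeasure M (B k) + emeasure M (W \<inter> (U k - B k))"
        by (intro emeasure_subadditive) auto
      also have "\<dots> \<le> emeasure M (B k) + ennreal ((1/4) ^ k)"
        using U(3)[of k] by (intro add_left_mono) simp
      finally have "ennreal (c * 2 ^ Suc k) * emeasure M (W \<inter> U k)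
          \<le> ennreal (c * 2 ^ Suc k) * (emeasure M (B k) + ennreal ((1/4) ^ k))"
        by (rule mult_left_mono) simp
      also have "\<dots> = ennreal (c * 2 ^ Suc k) * emeasure M (B k) + ennreal (c * 2 ^ Suc k * (1/4) ^ k)"
        using c by (simp only: distrib_left) (simp flip: ennreal_mult)
      also have "c * 2 ^ Suc k * (1/4) ^ k = 2 * c * (1/2) ^ k"
        by (simp add: power_divide field_simps flip: power_mult_distrib)
      finally show "ennreal (c * 2 ^ Suc k) * emeasure M (W \<inter> U k)
          \<le> ennreal (c * 2 ^ Suc k) * emeasure M (B k) + ennreal (2 * c * (1/2) ^ k)" .
    qed auto
    also have "\<dots> = (\<Sum>k. ennreal (c * 2 ^ Suc k) * emeasure M (B k)) + (\<Sum>k. ennreal (2 * c * (1/2) ^ k))"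
      by (intro suminf_add[symmetric]) auto
    also have "(\<Sum>k. ennreal (2 * c * (1/2) ^ k)) = ennreal (4 * c)"
    proof (rule suminf_ennreal_eq)
      show "(\<lambda>k. 2 * c * (1/2) ^ k) sums (4 * c)"
        using sums_mult[OF geometric_sums[of "1/2::real"], of "2 * c"] by simp
    qed (use c in auto)
    also have "(\<Sum>k. ennreal (c * 2 ^ Suc k) * emeasure M (B k)) = (\<integral>\<^sup>+ x. (\<Sum>k. ennreal (c * 2 ^ Suc k) * indicator (B k) x) \<partial>M)"
      by (simp add: nn_integral_suminf nn_integral_cmult_indicator)
    also have "\<dots> \<le> (\<integral>\<^sup>+ x. 4 * \<rho> x \<partial>M)"
    proof (intro nn_integral_mono suminf_le_const)
      fix x n
      show "(\<Sum>k<n. ennreal (c * 2 ^ Suc k) * indicator (B k) x) \<le> 4 * \<rho> x"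
      proof (cases "\<rho> x" rule: ennreal_cases)
        case (real r)
        have "(\<Sum>k<n. ennreal (c * 2 ^ Suc k) * indicator (B k) x)
          = (\<Sum>k<n. ennreal (c * 2 ^ Suc k * (if c * 2 ^ k < r then 1 else 0)))"
          using real c by (intro sum.cong) (auto simp: B_def indicator_def ennreal_less_iff)
        also have "\<dots> = ennreal (\<Sum>k<n. c * 2 ^ Suc k * (if c * 2 ^ k < r then 1 else 0))"
          using c by (intro sum_ennreal) auto
        also have "\<dots> \<le> ennreal (4 * max 0 r)"
          by (intro ennreal_leI dyadic_level_sum_le c)
        also have "\<dots> = 4 * \<rho> x" using real by (simp add: ennreal_mult')
        finally show ?thesis .
      qed simp
    qed auto
    also have "\<dots> = 4 * (\<integral>\<^sup>+ x. \<rho> x \<partial>M)"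
      using borel_measurable_M[OF \<rho>] by (rule nn_integral_cmult)
    finally have "(\<integral>\<^sup>+ x \<in> W. (SUP n. ennreal (g n x)) \<partial>M)
      \<le> ennreal c * emeasure M W + (4 * (\<integral>\<^sup>+ x. \<rho> x \<partial>M) + ennreal (4 * c))"
      by (simp add: add_mono)
    also have "\<dots> = ennreal c * (emeasure M W + 4) + 4 * (\<integral>\<^sup>+ x. \<rho> x \<partial>M)"
      using c by (simp add: distrib_left ennreal_mult' ac_simps)
    finally show ?thesis .
  qed
  show ?thesis
    by (rule exI[of _ g], rule exI[of _ "\<lambda>n. \<Sum>k<n. c * 2 ^ Suc k * real n"],
        rule exI[of _ "\<lambda>n. c + (\<Sum>k<n. c * 2 ^ Suc k)"]) (intro conjI allI 1 bnd 3 4 5 6)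
qed


section \<open>A covering lemma\<close>

text \<open>Among the disjoint subfamilies with the property that a ball which meets the subfamily also
  meets a member of at least half its radius, a maximal one meets all balls: otherwise some ball
  which misses it, chosen with nearly maximal radius, could be added.\<close>

lemma vitali_covering:
  fixes S :: "'a::metric_space set"
  assumes R: "\<And>y. y \<in> S \<Longrightarrow> 0 < R y" "\<And>y. y \<in> S \<Longrightarrow> R y \<le> B"
  shows "\<exists>A\<subseteq>S. disjoint_family_on (\<lambda>y. ball y (R y)) A \<and> S \<subseteq> (\<Union>y\<in>A. ball y (5 * R y))"
proof -
  define meets where "meets y z \<longleftrightarrow> ball y (R y) \<inter> ball z (R z) \<noteq> {}" for y z
  have sym: "meets y z \<longleftrightarrow> meets z y" for y z by (auto simp: meets_def)
  define \<C> where "\<C> = {A. A \<subseteq> S \<and> (\<forall>y\<in>A. \<forall>z\<in>A. y \<noteq> z \<longrightarrow> \<not> meets y z) \<and>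
      (\<forall>y\<in>S. (\<exists>z\<in>A. meets y z) \<longrightarrow> (\<exists>z\<in>A. meets y z \<and> R y \<le> 2 * R z))}"
  have "\<exists>A\<in>\<C>. \<forall>X\<in>\<C>. A \<subseteq> X \<longrightarrow> X = A"
  proof (rule subset_Zorn_nonempty)
    have "{} \<in> \<C>" by (simp add: \<C>_def)
    then show "\<C> \<noteq> {}" by blast
    fix K assume K: "K \<noteq> {}" "subset.chain \<C> K"
    have sub: "\<And>A. A \<in> K \<Longrightarrow> A \<in> \<C>" and ch: "\<And>A B. A \<in> K \<Longrightarrow> B \<in> K \<Longrightarrow> A \<subseteq> B \<or> B \<subseteq> A"
      using K(2) by (auto simp: subset_chain_def)
    show "\<Union>K \<in> \<C>"
      unfolding \<C>_def
    proof (intro CollectI conjI ballI impI)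
      show "\<Union>K \<subseteq> S" using sub unfolding \<C>_def by blast
      fix y z assume yz: "y \<in> \<Union>K" "z \<in> \<Union>K" "y \<noteq> z"
      then obtain A where "A \<in> K" "y \<in> A" "z \<in> A" using ch by blast
      then show "\<not> meets y z" using sub[of A] yz(3) by (auto simp: \<C>_def)
    next
      fix y assume y: "y \<in> S" "\<exists>z\<in>\<Union>K. meets y z"
      then obtain A z where A: "A \<in> K" "z \<in> A" "meets y z" by blast
      then have "\<exists>z\<in>A. meets y z \<and> R y \<le> 2 * R z" using sub[of A] y(1) unfolding \<C>_def by blast
      then show "\<exists>z\<in>\<Union>K. meets y z \<and> R y \<le> 2 * R z" using A(1) by blast
    qed
  qed
  then obtain A where A: "A \<in> \<C>" and max: "\<And>X. X \<in> \<C> \<Longrightarrow> A \<subseteq> X \<Longrightarrow> X = A" by blast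
  have AS: "A \<subseteq> S" and Adisj: "\<And>y z. y \<in> A \<Longrightarrow> z \<in> A \<Longrightarrow> y \<noteq> z \<Longrightarrow> \<not> meets y z"
    and Ahalf: "\<And>y. y \<in> S \<Longrightarrow> \<exists>z\<in>A. meets y z \<Longrightarrow> \<exists>z\<in>A. meets y z \<and> R y \<le> 2 * R z"
    using A unfolding \<C>_def by blast+
  have self: "meets y y" if "y \<in> S" for y
    using R(1)[OF that] by (auto simp: meets_def)
  define T where "T = {y \<in> S. \<forall>z\<in>A. \<not> meets y z}"
  have "T = {}"
  proof (rule ccontr)
    assume ne: "T \<noteq> {}"
    have bdd: "bdd_above (R ` T)" using R(2) by (auto simp: T_def intro!: bdd_aboveI[of _ B])
    define s where "s = Sup (R ` T)"
    have s: "R y \<le> s" if "y \<in> T" for y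
      unfolding s_def using that bdd by (intro cSUP_upper)
    have "0 < s" using ne s R(1) by (force simp: T_def)
    then have "s / 2 < Sup (R ` T)" by (simp add: s_def)
    then obtain y where y: "y \<in> T" "s / 2 < R y"
      using less_cSUP_iff[OF ne bdd] by auto
    have "insert y A \<in> \<C>"
      unfolding \<C>_def
    proof (intro CollectI conjI ballI impI)
      show "insert y A \<subseteq> S" using AS y by (auto simp: T_def)
      fix a b assume "a \<in> insert y A" "b \<in> insert y A" "a \<noteq> b"
      then show "\<not> meets a b" using Adisj y(1) sym by (auto simp: T_def)
    next
      fix w assume w: "w \<in> S" "\<exists>z\<in>insert y A. meets w z"
      show "\<exists>z\<in>insert y A. meets w z \<and> R w \<le> 2 * R z"
      proof (cases "\<exists>z\<in>A. meets w z")
        case True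
        then show ?thesis using Ahalf[OF w(1)] by blast
      next
        case False
        then have "w \<in> T" "meets w y" using w by (auto simp: T_def)
        then show ?thesis using s[of w] y(2) by auto
      qed
    qed
    then have "y \<in> A" using max[of "insert y A"] by blast
    then show False using y self by (auto simp: T_def)
  qed
  have "S \<subseteq> (\<Union>y\<in>A. ball y (5 * R y))"
  proof
    fix y assume y: "y \<in> S"
    then have "\<exists>z\<in>A. meets y z" using \<open>T = {}\<close> by (auto simp: T_def)
    then obtain z where z: "z \<in> A" "meets y z" "R y \<le> 2 * R z" using Ahalf[OF y] by blast
    then obtain p where "dist y p < R y" "dist z p < R z" by (auto simp: meets_def)
    moreover have "0 < R z" using R(1) AS z(1) by blast
    ultimately have "dist z y < 5 * R z"
      using dist_triangle[of z y p] z(3) by (simp add: dist_commute)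
    then show "y \<in> (\<Union>y\<in>A. ball y (5 * R y))" using z(1) by auto
  qed
  moreover have "disjoint_family_on (\<lambda>y. ball y (R y)) A"
    using Adisj unfolding disjoint_family_on_def meets_def by blast
  ultimately show ?thesis using AS by blast
qed

section \<open>Truncation\<close>

definition clamp_between :: "real \<Rightarrow> real \<Rightarrow> real \<Rightarrow> real" where
  "clamp_between l u x = max l (min u x)"

lemma clamp_between_uminus: "l \<le> u \<Longrightarrow> clamp_between (- u) (- l) (- x) = - clamp_between l u x"
  by (auto simp: clamp_between_def min_def max_def)

lemma continuous_on_if_increments_bounded_by_integral:
  fixes \<phi> :: "real \<Rightarrow> real" and G :: "real \<Rightarrow> ennreal"
  assumes inc: "\<And>s t. a \<le> s \<Longrightarrow> s \<le> t \<Longrightarrow> t \<le> b \<Longrightarrow> ennreal \<bar>\<phi> s - \<phi> t\<bar> \<le> (\<integral>\<^sup>+ r \<in> {s..t}. G r \<partial>lborel)"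
    and meas: "(\<lambda>r. G r * indicator {a..b} r) \<in> borel_measurable lborel"
    and fin: "(\<integral>\<^sup>+ r \<in> {a..b}. G r \<partial>lborel) < \<infinity>"
  shows "continuous_on {a..b} \<phi>"
  unfolding continuous_on_sequentially
proof (intro allI ballI impI)
  fix x :: "nat \<Rightarrow> real" and s assume s: "s \<in> {a..b}" and x: "(\<forall>n. x n \<in> {a..b}) \<and> x \<longlonglongrightarrow> s"
  define I where "I n = {min s (x n)..max s (x n)}" for n
  have Isub: "I n \<subseteq> {a..b}" for n using s x by (auto simp: I_def)
  let ?F = "\<lambda>n r. G r * indicator {a..b} r * indicator (I n) r"
  have "(\<lambda>n. \<integral>\<^sup>+ r. ?F n r \<partial>lborel) \<longlonglongrightarrow> (\<integral>\<^sup>+ r. 0 \<partial>(lborel :: real measure))"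
  proof (rule nn_integral_dominated_convergence[where w = "\<lambda>r. G r * indicator {a..b} r"])
    show "?F n \<in> borel_measurable lborel" for n
      by (rule borel_measurable_times_ennreal[OF meas]) (simp add: I_def)
    show "AE r in lborel. ?F n r \<le> G r * indicator {a..b} r" for n
      by (auto simp: indicator_def)
    have "AE r in lborel. r \<noteq> s"
      by (rule AE_lborel_singleton)
    then show "AE r in lborel. (\<lambda>n. ?F n r) \<longlonglongrightarrow> 0"
    proof eventually_elim
      case (elim r)
      have "\<forall>\<^sub>F n in sequentially. dist (x n) s < dist r s"
        using x elim tendstoD[of x s sequentially "dist r s"] by auto
      then have "\<forall>\<^sub>F n in sequentially. ?F n r = 0"
        by eventually_elim (auto simp: I_def indicator_def dist_real_def min_def max_def split: if_splits)
      then show ?case by (rule tendsto_eventually)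
    qed
  qed (use meas fin in auto)
  then have lim: "(\<lambda>n. enn2real (\<integral>\<^sup>+ r. ?F n r \<partial>lborel)) \<longlonglongrightarrow> 0"
    by (intro tendsto_enn2real) simp_all
  have "dist (\<phi> (x n)) (\<phi> s) \<le> enn2real (\<integral>\<^sup>+ r. ?F n r \<partial>lborel)" for n
  proof -
    have "ennreal \<bar>\<phi> (min s (x n)) - \<phi> (max s (x n))\<bar> \<le> (\<integral>\<^sup>+ r \<in> I n. G r \<partial>lborel)"
      unfolding I_def using s x by (intro inc) (auto simp: min_def max_def)
    also have "\<dots> = (\<integral>\<^sup>+ r. ?F n r \<partial>lborel)"
      using Isub[of n] by (intro nn_integral_cong) (auto simp: indicator_def)
    finally have le: "ennreal \<bar>\<phi> (min s (x n)) - \<phi> (max s (x n))\<bar> \<le> (\<integral>\<^sup>+ r. ?F n r \<partial>lborel)" .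
    have "(\<integral>\<^sup>+ r. ?F n r \<partial>lborel) \<le> (\<integral>\<^sup>+ r \<in> {a..b}. G r \<partial>lborel)"
      by (intro nn_integral_mono) (auto simp: indicator_def)
    then have "(\<integral>\<^sup>+ r. ?F n r \<partial>lborel) < top" using fin by (simp add: le_less_trans)
    from enn2real_mono[OF le this] show ?thesis
      by (auto simp: dist_real_def min_def max_def split: if_splits)
  qed
  then have "(\<lambda>n. dist (\<phi> (x n)) (\<phi> s)) \<longlonglongrightarrow> 0"
    by (intro tendsto_sandwich[OF _ _ tendsto_const lim]) auto
  then show "(\<phi> \<circ> x) \<longlonglongrightarrow> \<phi> s"
    by (subst tendsto_dist_iff) (simp add: o_def)
qed

text \<open>By continuity, the truncated function changes only while \<open>\<phi>\<close> is strictly between the two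
  levels: consider the last exit from the lower level before the first entry to the upper one.\<close>

lemma clamp_between_increment:
  fixes \<phi> :: "real \<Rightarrow> real" and G :: "real \<Rightarrow> ennreal"
  assumes ab: "a \<le> b"
    and inc: "\<And>s t. a \<le> s \<Longrightarrow> s \<le> t \<Longrightarrow> t \<le> b \<Longrightarrow> ennreal \<bar>\<phi> s - \<phi> t\<bar> \<le> (\<integral>\<^sup>+ r \<in> {s..t}. G r \<partial>lborel)"
    and meas: "(\<lambda>r. G r * indicator {a..b} r) \<in> borel_measurable lborel"
    and fin: "(\<integral>\<^sup>+ r \<in> {a..b}. G r \<partial>lborel) < \<infinity>"
    and lu: "l \<le> u"
  shows "ennreal (clamp_between l u (\<phi> b) - clamp_between l u (\<phi> a))
    \<le> (\<integral>\<^sup>+ r \<in> {a..b}. G r * indicator {r. l < \<phi> r \<and> \<phi> r < u} r \<partial>lborel)"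
proof -
  define \<alpha> \<beta> where "\<alpha> = max l (\<phi> a)" and "\<beta> = min u (\<phi> b)"
  have cont: "continuous_on {a..b} \<phi>"
    by (rule continuous_on_if_increments_bounded_by_integral[OF inc meas fin])
  show ?thesis
  proof (cases "\<alpha> < \<beta>")
    case False
    then have "clamp_between l u (\<phi> b) - clamp_between l u (\<phi> a) \<le> 0"
      using lu by (auto simp: clamp_between_def \<alpha>_def \<beta>_def min_def max_def split: if_splits)
    then show ?thesis by (simp add: ennreal_neg)
  next
    case True
    have cpt: "compact ({p..q} \<inter> \<phi> -` T)" if "a \<le> p" "q \<le> b" "closed T" for p q T
      using compact_Int_closed[OF compact_Icc continuous_closed_preimage[OF continuous_on_subset[OF cont] closed_atLeastAtMost that(3)],
          of p q p q] that by (simp add: Int_left_absorb)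
    let ?B = "{a..b} \<inter> \<phi> -` {\<beta>..}"
    have "compact ?B" by (rule cpt) auto
    moreover have "b \<in> ?B" using ab by (simp add: \<beta>_def)
    ultimately obtain b1 where "b1 \<in> ?B" and minb: "\<forall>t\<in>?B. b1 \<le> t"
      using compact_attains_inf[of ?B] by blast
    then have b1: "b1 \<in> {a..b}" "\<beta> \<le> \<phi> b1" "\<And>t. t \<in> {a..b} \<Longrightarrow> \<beta> \<le> \<phi> t \<Longrightarrow> b1 \<le> t"
      by auto
    let ?A = "{a..b1} \<inter> \<phi> -` {..\<alpha>}"
    have "compact ?A" by (rule cpt) (use b1 in auto)
    moreover have "a \<in> ?A" using b1 by (simp add: \<alpha>_def)
    ultimately obtain a1 where "a1 \<in> ?A" and maxa: "\<forall>t\<in>?A. t \<le> a1"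
      using compact_attains_sup[of ?A] by blast
    then have a1: "a1 \<in> {a..b1}" "\<phi> a1 \<le> \<alpha>" "\<And>t. t \<in> {a..b1} \<Longrightarrow> \<phi> t \<le> \<alpha> \<Longrightarrow> t \<le> a1"
      by auto
    have between: "l < \<phi> t \<and> \<phi> t < u" if t: "a1 < t" "t < b1" for t
      using a1(1) a1(3)[of t] b1(1) b1(3)[of t] t by (force simp: \<alpha>_def \<beta>_def)
    have "clamp_between l u (\<phi> b) - clamp_between l u (\<phi> a) = \<beta> - \<alpha>"
      using True lu unfolding clamp_between_def \<alpha>_def \<beta>_def min_def max_def
      by (simp split: if_splits)
    also have "\<dots> \<le> \<bar>\<phi> a1 - \<phi> b1\<bar>" using a1(2) b1(2) by simp
    finally have "ennreal (clamp_between l u (\<phi> b) - clamp_between l u (\<phi> a)) \<le> ennreal \<bar>\<phi> a1 - \<phi> b1\<bar>"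
      by (rule ennreal_leI)
    also have "\<dots> \<le> (\<integral>\<^sup>+ r \<in> {a1..b1}. G r \<partial>lborel)"
      using a1(1) b1(1) by (intro inc) auto
    also have "\<dots> \<le> (\<integral>\<^sup>+ r \<in> {a..b}. G r * indicator {r. l < \<phi> r \<and> \<phi> r < u} r \<partial>lborel)"
    proof (rule nn_integral_mono_AE)
      have "AE r in lborel. r \<noteq> a1" "AE r in lborel. r \<noteq> b1"
        by (rule AE_lborel_singleton)+
      then show "AE r in lborel. G r * indicator {a1..b1} r
          \<le> G r * indicator {r. l < \<phi> r \<and> \<phi> r < u} r * indicator {a..b} r"
      proof eventually_elim
        case (elim r)
        then show ?case using between[of r] a1(1) b1(1) by (auto simp: indicator_def)
      qed
    qed
    finally show ?thesis .
  qed
qed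

lemma borel_measurable_along_path:
  fixes g :: "'a::metric_space \<Rightarrow> ennreal" and a b :: real
  assumes g: "g \<in> borel_measurable borel" and h: "1-lipschitz_on {a..b} h"
  shows "(\<lambda>t. g (h t) * indicator {a..b} t) \<in> borel_measurable lborel"
proof -
  have "h \<in> borel_measurable (restrict_space borel {a..b})"
    using lipschitz_on_continuous_on[OF h] by (rule borel_measurable_continuous_on_restrict)
  then have "(\<lambda>t. g (h t)) \<in> borel_measurable (restrict_space borel {a..b})"
    using g by (rule measurable_compose)
  then show ?thesis
    by (subst (asm) borel_measurable_restrict_space_iff_ennreal) (auto simp: mult.commute)
qed

lemma clamp_between_path_increment:
  fixes v :: "'a::metric_space \<Rightarrow> real" and a b :: real
  assumes ug: "path_upper_gradient v g" and g: "g \<in> borel_measurable borel"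
    and ab: "a \<le> b" and h: "1-lipschitz_on {a..b} h"
    and fin: "(\<integral>\<^sup>+ t \<in> {a..b}. g (h t) \<partial>lborel) < \<infinity>" and lu: "l \<le> u"
  shows "ennreal \<bar>clamp_between l u (v (h a)) - clamp_between l u (v (h b))\<bar>
    \<le> (\<integral>\<^sup>+ t \<in> {a..b}. g (h t) * indicator {x. l < v x \<and> v x < u} (h t) \<partial>lborel)" (is "_ \<le> ?R")
proof -
  let ?\<phi> = "\<lambda>t. v (h t)"
  have inc: "ennreal \<bar>?\<phi> s - ?\<phi> t\<bar> \<le> (\<integral>\<^sup>+ r \<in> {s..t}. g (h r) \<partial>lborel)" if "a \<le> s" "s \<le> t" "t \<le> b" for s t
    by (rule ug[unfolded path_upper_gradient_def, rule_format, OF that(2) lipschitz_on_subset[OF h]]) (use that in auto)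
  have meas: "(\<lambda>t. g (h t) * indicator {a..b} t) \<in> borel_measurable lborel"
    by (rule borel_measurable_along_path[OF g h])
  have eq: "?R = (\<integral>\<^sup>+ t \<in> {a..b}. g (h t) * indicator {t. l < ?\<phi> t \<and> ?\<phi> t < u} t \<partial>lborel)"
    by (intro nn_integral_cong) (auto simp: indicator_def)
  have "ennreal (clamp_between l u (?\<phi> b) - clamp_between l u (?\<phi> a)) \<le> ?R"
    unfolding eq by (rule clamp_between_increment[OF ab inc meas fin lu])
  moreover have "ennreal (clamp_between l u (?\<phi> a) - clamp_between l u (?\<phi> b)) \<le> ?R"
  proof -
    have "ennreal (clamp_between (- u) (- l) (- ?\<phi> b) - clamp_between (- u) (- l) (- ?\<phi> a))
      \<le> (\<integral>\<^sup>+ t \<in> {a..b}. g (h t) * indicator {t. - u < - ?\<phi> t \<and> - ?\<phi> t < - l} t \<partial>lborel)"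
    proof (rule clamp_between_increment[OF ab _ meas fin])
      fix s t assume "a \<le> s" "s \<le> t" "t \<le> b"
      from inc[OF this] show "ennreal \<bar>- ?\<phi> s - - ?\<phi> t\<bar> \<le> (\<integral>\<^sup>+ r \<in> {s..t}. g (h r) \<partial>lborel)"
        by (simp add: abs_minus_commute)
    qed (use lu in simp)
    then show ?thesis
      unfolding eq using lu by (simp add: clamp_between_uminus conj_commute)
  qed
  ultimately show ?thesis by (auto simp: abs_if)
qed

text \<open>The extra term \<open>\<epsilon> * g\<close> takes care of the paths along which \<open>g\<close> is not integrable.\<close>

lemma path_upper_gradient_clamp_between:
  fixes v :: "'a::metric_space \<Rightarrow> real"
  assumes ug: "path_upper_gradient v g" and g: "g \<in> borel_measurable borel"
    and lu: "l \<le> u" and \<epsilon>: "0 < (\<epsilon>::real)"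
  shows "path_upper_gradient (\<lambda>x. clamp_between l u (v x))
    (\<lambda>x. g x * indicator {x. l < v x \<and> v x < u} x + ennreal \<epsilon> * g x)"
  unfolding path_upper_gradient_def
proof (intro allI impI)
  fix h :: "real \<Rightarrow> 'a" and a b :: real
  assume ab: "a \<le> b" and h: "1-lipschitz_on {a..b} h"
  let ?I = "\<integral>\<^sup>+ t \<in> {a..b}. g (h t) \<partial>lborel"
  let ?R = "\<integral>\<^sup>+ t \<in> {a..b}. (g (h t) * indicator {x. l < v x \<and> v x < u} (h t) + ennreal \<epsilon> * g (h t)) \<partial>lborel"
  show "ennreal \<bar>clamp_between l u (v (h a)) - clamp_between l u (v (h b))\<bar> \<le> ?R"
  proof (cases "?I < \<infinity>")
    case False
    then have "?I = \<infinity>" by (simp add: less_top[symmetric])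
    then have "\<infinity> = ennreal \<epsilon> * ?I" using \<epsilon> by (simp add: ennreal_mult_eq_top_iff)
    also have "ennreal \<epsilon> * ?I = (\<integral>\<^sup>+ t. ennreal \<epsilon> * (g (h t) * indicator {a..b} t) \<partial>lborel)"
      by (rule nn_integral_cmult[symmetric, OF borel_measurable_along_path[OF g h]])
    also have "\<dots> \<le> ?R" by (intro nn_integral_mono) (auto simp: indicator_def)
    finally have "?R = \<infinity>" by (simp add: top_unique)
    then show ?thesis by simp
  next
    case True
    show ?thesis
      by (rule order_trans[OF clamp_between_path_increment[OF ug g ab h True lu]])
        (auto intro!: nn_integral_mono simp: indicator_def)
  qed
qed

lemma path_upper_gradient_affine:
  assumes ug: "path_upper_gradient v g" and c: "0 \<le> c"
    and g: "g \<in> borel_measurable borel"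
  shows "path_upper_gradient (\<lambda>x. c * v x + d) (\<lambda>x. ennreal c * g x)"
  unfolding path_upper_gradient_def
proof (intro allI impI)
  fix h :: "real \<Rightarrow> 'a" and a b :: real
  assume ab: "a \<le> b" and h: "1-lipschitz_on {a..b} h"
  have "ennreal \<bar>(c * v (h a) + d) - (c * v (h b) + d)\<bar> = ennreal c * ennreal \<bar>v (h a) - v (h b)\<bar>"
    using c by (simp add: abs_mult ennreal_mult flip: right_diff_distrib)
  also have "\<dots> \<le> ennreal c * (\<integral>\<^sup>+ t \<in> {a..b}. g (h t) \<partial>lborel)"
    by (intro mult_left_mono ug[unfolded path_upper_gradient_def, rule_format, OF ab h]) simp
  also have "\<dots> \<le> (\<integral>\<^sup>+ t \<in> {a..b}. ennreal c * g (h t) \<partial>lborel)"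
    using nn_integral_cmult[OF borel_measurable_along_path[OF g h], of "ennreal c"] by (simp add: mult.assoc)
  finally show "ennreal \<bar>(c * v (h a) + d) - (c * v (h b) + d)\<bar> \<le> (\<integral>\<^sup>+ t \<in> {a..b}. ennreal c * g (h t) \<partial>lborel)" .
qed

section \<open>The boxing inequality\<close>

text \<open>The mean value of \<open>w\<close> serves only as some constant from which \<open>w\<close> deviates little, and the
  averages over the two balls can be replaced by integrals because the ball on the left is the smaller
  one.\<close>

locale poincare_space = doubling_measure M Cd
  for M :: "'a::complete_space measure" and Cd +
  fixes Cp \<Lambda> :: real
  assumes Cp_pos: "0 < Cp" and \<Lambda>_ge_1: "1 \<le> \<Lambda>"
    and poincare: "\<And>x r w G. \<lbrakk>0 < r; w \<in> borel_measurable borel; \<And>y. 0 \<le> w y \<and> w y \<le> 1;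
        G \<in> borel_measurable borel; path_upper_gradient w G\<rbrakk>
      \<Longrightarrow> \<exists>m::real. (\<integral>\<^sup>+ y \<in> ball x r. ennreal \<bar>w y - m\<bar> \<partial>M)
        \<le> ennreal (Cp * r) * (\<integral>\<^sup>+ y \<in> ball x (\<Lambda> * r). G y \<partial>M)"
begin

text \<open>Any constant differs by at least \<open>1/2\<close> from one of the two values \<open>0\<close> and \<open>1\<close>.\<close>

lemma poincare_levels:
  assumes r: "0 < r" and w: "w \<in> borel_measurable borel" "\<And>y. 0 \<le> w y \<and> w y \<le> 1"
    and G: "G \<in> borel_measurable borel" and ug: "path_upper_gradient w G"
    and low: "\<theta> \<le> measure M (ball x r \<inter> {y. w y = 0})"
    and up: "\<theta> \<le> measure M (ball x r \<inter> {y. w y = 1})"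
  shows "ennreal \<theta> \<le> ennreal (2 * Cp * r) * (\<integral>\<^sup>+ y \<in> ball x (\<Lambda> * r). G y \<partial>M)"
proof -
  obtain m where m: "(\<integral>\<^sup>+ y \<in> ball x r. ennreal \<bar>w y - m\<bar> \<partial>M)
        \<le> ennreal (Cp * r) * (\<integral>\<^sup>+ y \<in> ball x (\<Lambda> * r). G y \<partial>M)"
    using poincare[OF r w G ug, of x] by (elim exE)
  define a :: real where "a = (if 1/2 \<le> m then 0 else 1)"
  have wM: "{y. w y = a} \<in> sets M"
  proof -
    note borel_measurable_M[OF w(1), measurable]
    have "{y \<in> space M. w y = a} \<in> sets M" by measurable
    then show ?thesis by (simp add: space_UNIV)
  qed
  have "emeasure M (ball x r \<inter> {y. w y = a}) \<le> emeasure M (ball x r)"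
    using wM by (intro emeasure_mono) auto
  then have "emeasure M (ball x r \<inter> {y. w y = a}) < \<infinity>"
    using emeasure_ball_finite le_less_trans by blast
  then have em: "emeasure M (ball x r \<inter> {y. w y = a}) = ennreal (measure M (ball x r \<inter> {y. w y = a}))"
    by (intro emeasure_eq_ennreal_measure) auto
  have "ennreal (1/2) * ennreal \<theta> \<le> ennreal (1/2) * emeasure M (ball x r \<inter> {y. w y = a})"
    unfolding em using low up by (intro mult_left_mono ennreal_leI) (auto simp: a_def)
  also have "\<dots> = (\<integral>\<^sup>+ y. ennreal (1/2) * indicator (ball x r \<inter> {y. w y = a}) y \<partial>M)"
    using wM by (subst nn_integral_cmult_indicator) auto
  also have "\<dots> \<le> (\<integral>\<^sup>+ y \<in> ball x r. ennreal \<bar>w y - m\<bar> \<partial>M)"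
  proof (intro nn_integral_mono)
    fix y
    have "1/2 \<le> \<bar>w y - m\<bar>" if "w y = a" using that by (auto simp: a_def split: if_splits)
    then show "ennreal (1/2) * indicator (ball x r \<inter> {y. w y = a}) y \<le> ennreal \<bar>w y - m\<bar> * indicator (ball x r) y"
      by (auto simp: indicator_def intro!: ennreal_leI simp del: ennreal_half)
  qed
  also note m
  finally have "ennreal 2 * (ennreal (1/2) * ennreal \<theta>) \<le> ennreal 2 * (ennreal (Cp * r) * (\<integral>\<^sup>+ y \<in> ball x (\<Lambda> * r). G y \<partial>M))"
    by (rule mult_left_mono) simp
  moreover have "ennreal 2 * (ennreal (1/2) * ennreal \<theta>) = ennreal \<theta>"
    by (simp add: mult.assoc[symmetric] ennreal_mult[symmetric] del: ennreal_half ennreal_numeral)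
  moreover have "ennreal 2 * (ennreal (Cp * r) * (\<integral>\<^sup>+ y \<in> ball x (\<Lambda> * r). G y \<partial>M))
      = ennreal (2 * Cp * r) * (\<integral>\<^sup>+ y \<in> ball x (\<Lambda> * r). G y \<partial>M)"
    using Cp_pos r by (simp add: mult.assoc[symmetric] ennreal_mult[symmetric] del: ennreal_numeral)
  ultimately show ?thesis by simp
qed

text \<open>If the annulus were empty, then no curve could leave the inner ball, so that its indicator
  function would have the upper gradient \<open>0\<close>, in contradiction to the Poincare inequality.\<close>

lemma annulus_nonempty:
  fixes x p :: 'a
  assumes r: "0 < r" and p: "7/2 * r < dist x p"
  shows "\<exists>z. 5/2 * r \<le> dist x z \<and> dist x z \<le> 7/2 * r"
proof (rule ccontr)
  assume "\<not> ?thesis"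
  then have gap: "dist x z < 5/2 * r \<or> 7/2 * r < dist x z" for z
    by (auto simp: not_le)
  define w :: "'a \<Rightarrow> real" where "w = indicator (ball x (5/2 * r))"
  define R where "R = dist x p + r"
  have R: "0 < R" using p r by (simp add: R_def add_nonneg_pos)
  define \<theta> where "\<theta> = min (vol x r) (vol p (r/2))"
  have wb: "w \<in> borel_measurable borel"
    unfolding w_def by (intro borel_measurable_indicator) auto
  have w01: "0 \<le> w y \<and> w y \<le> 1" for y by (simp add: w_def)
  have ug: "path_upper_gradient w (\<lambda>_. 0)"
    unfolding path_upper_gradient_def
  proof (intro allI impI)
    fix h :: "real \<Rightarrow> 'a" and a b :: real
    assume ab: "a \<le> b" and h: "1-lipschitz_on {a..b} h"
    have "continuous_on {a..b} (\<lambda>t. dist x (h t))"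
      using lipschitz_on_continuous_on[OF h] by (intro continuous_intros)
    then have conn: "connected ((\<lambda>t. dist x (h t)) ` {a..b})"
      by (rule connected_continuous_image) simp
    have no: False if c: "c \<in> {a..b}" "d \<in> {a..b}" "dist x (h c) < 5/2 * r" "7/2 * r < dist x (h d)" for c d
    proof -
      have "3 * r \<in> (\<lambda>t. dist x (h t)) ` {a..b}"
        by (rule connectedD_interval[OF conn imageI[OF c(1)] imageI[OF c(2)]]) (use c r in linarith)+
      then obtain t where "3 * r = dist x (h t)" by blast
      then show False using gap[of "h t"] r by linarith
    qed
    have "w (h a) = w (h b)"
      using gap[of "h a"] gap[of "h b"] no[of a b] no[of b a] ab r by (auto simp: w_def indicator_def)
    then show "ennreal \<bar>w (h a) - w (h b)\<bar> \<le> (\<integral>\<^sup>+ t \<in> {a..b}. 0 \<partial>lborel)" by simp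
  qed
  have fin: "emeasure M (ball x R \<inter> B) \<noteq> \<infinity>" for B
  proof -
    have "emeasure M (ball x R \<inter> B) \<le> emeasure M (ball x R)" by (intro emeasure_mono) auto
    then show ?thesis using emeasure_ball_finite[of x R] le_less_trans by fastforce
  qed
  have "vol x r \<le> measure M (ball x R \<inter> {y. w y = 1})"
  proof (rule measure_mono_fmeasurable)
    show "ball x R \<inter> {y. w y = 1} \<in> fmeasurable M"
    proof (rule fmeasurableI)
      have "{y. w y = 1} = ball x (5/2 * r)" by (auto simp: w_def indicator_def)
      then show "ball x R \<inter> {y. w y = 1} \<in> sets M" by simp
    qed (use fin in \<open>auto simp: less_top\<close>)
  qed (use r p in \<open>auto simp: w_def indicator_def R_def\<close>)
  moreover have "vol p (r/2) \<le> measure M (ball x R \<inter> {y. w y = 0})"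
  proof (rule measure_mono_fmeasurable)
    show "ball x R \<inter> {y. w y = 0} \<in> fmeasurable M"
    proof (rule fmeasurableI)
      have "{y. w y = 0} = - ball x (5/2 * r)" by (auto simp: w_def indicator_def)
      then show "ball x R \<inter> {y. w y = 0} \<in> sets M" using sets.compl_sets[OF sets_ball[of x "5/2 * r"]]
        by (simp add: space_UNIV Compl_eq_Diff_UNIV)
    qed (use fin in \<open>auto simp: less_top\<close>)
    show "ball p (r/2) \<subseteq> ball x R \<inter> {y. w y = 0}"
    proof
      fix y assume "y \<in> ball p (r/2)"
      then show "y \<in> ball x R \<inter> {y. w y = 0}"
        using dist_triangle[of x p y] dist_triangle[of x y p] p r
        by (auto simp: w_def indicator_def R_def dist_commute)
    qed
  qed simp
  ultimately have "ennreal \<theta> \<le> ennreal (2 * Cp * R) * (\<integral>\<^sup>+ y \<in> ball x (\<Lambda> * R). 0 \<partial>M)"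
    by (intro poincare_levels[OF R wb w01 _ ug]) (auto simp: \<theta>_def)
  then have "\<theta> \<le> 0" by (simp add: ennreal_eq_0_iff)
  moreover have "0 < \<theta>" using vol_pos[of r x] vol_pos[of "r/2" p] r by (simp add: \<theta>_def)
  ultimately show False by simp
qed

end

text \<open>Halve the radius until the set \<open>{v \<le> t}\<close> no longer fills the fraction \<open>\<theta>\<close> of the ball; one step
  earlier both \<open>{v \<le> t}\<close> and \<open>{v > t}\<close> fill a definite fraction. The latter set is exhausted
  by the sets \<open>{v \<ge> t + \<eta>}\<close>.\<close>

lemma (in doubling_measure) balanced_radius:
  fixes v :: "'a \<Rightarrow> real"
  assumes v: "v \<in> borel_measurable borel" and op: "open {x. t < v x}" and y: "t < v y"
    and R: "0 < R" and \<theta>: "0 < \<theta>" "\<theta> \<le> 1 / (2 * Cd)"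
    and top: "\<theta> * vol y R \<le> measure M (ball y R \<inter> {x. v x \<le> t})"
  shows "\<exists>\<rho>>0. \<rho> \<le> R \<and> \<theta> * vol y \<rho> \<le> measure M (ball y \<rho> \<inter> {x. v x \<le> t}) \<and>
    (\<exists>\<delta>>0. \<forall>\<eta>. 0 < \<eta> \<and> \<eta> < \<delta> \<longrightarrow> \<theta> / 2 * vol y \<rho> \<le> measure M (ball y \<rho> \<inter> {x. t + \<eta> \<le> v x}))"
proof -
  note borel_measurable_M[OF v, measurable]
  have sets [measurable]: "{x. v x \<le> s} \<in> sets M" "{x. s < v x} \<in> sets M" "{x. s \<le> v x} \<in> sets M" for s
  proof -
    have "{x\<in>space M. v x \<le> s} \<in> sets M" "{x\<in>space M. s < v x} \<in> sets M" "{x\<in>space M. s \<le> v x} \<in> sets M"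
      by measurable
    then show "{x. v x \<le> s} \<in> sets M" "{x. s < v x} \<in> sets M" "{x. s \<le> v x} \<in> sets M"
      by (simp_all add: space_UNIV)
  qed
  have fm: "ball y \<rho> \<inter> A \<in> fmeasurable M" if "A \<in> sets M" for \<rho> A
    using that emeasure_ball_finite[of y \<rho>] by (intro fmeasurable_Int_fmeasurable) (auto intro: fmeasurableI)
  define \<rho> where "\<rho> i = R / 2 ^ i" for i :: nat
  have \<rho>: "0 < \<rho> i" "\<rho> i \<le> R" "\<rho> i = 2 * \<rho> (Suc i)" for i
    using R by (auto simp: \<rho>_def field_simps)
  define small where "small i \<longleftrightarrow> measure M (ball y (\<rho> i) \<inter> {x. v x \<le> t}) < \<theta> * vol y (\<rho> i)" for i
  have ex: "\<exists>i. small i"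
  proof -
    obtain e where e: "0 < e" "ball y e \<subseteq> {x. t < v x}"
      using op y open_contains_ball by blast
    obtain i :: nat where "R / e < 2 ^ i" using real_arch_pow[of 2] by auto
    then have "\<rho> i < e" using e by (simp add: \<rho>_def field_simps)
    then have "ball y (\<rho> i) \<subseteq> {x. t < v x}" using e(2) subset_ball[of "\<rho> i" e y] by simp
    then have "ball y (\<rho> i) \<inter> {x. v x \<le> t} = {}" by fastforce
    then have "small i" using \<theta> \<rho>(1) vol_pos by (simp add: small_def)
    then show ?thesis ..
  qed
  have "\<not> small 0" using top by (simp add: small_def \<rho>_def)
  moreover have "small (LEAST i. small i)" using ex by (rule LeastI_ex)
  ultimately obtain j where Least: "(LEAST i. small i) = Suc j"
    by (cases "LEAST i. small i") auto
  then have j: "small (Suc j)" "\<not> small j"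
    using \<open>small (LEAST i. small i)\<close> not_less_Least[of j small] by simp_all
  let ?r = "\<rho> j"
  have big: "\<theta> * vol y ?r \<le> measure M (ball y ?r \<inter> {x. t < v x})"
  proof -
    have "1 / (2 * Cd) \<le> 1 / 2" using Cd_ge_1 by (simp add: field_simps)
    then have "\<theta> \<le> 1 / 2" using \<theta>(2) by linarith
    have "vol y (\<rho> (Suc j)) = measure M ((ball y (\<rho> (Suc j)) \<inter> {x. v x \<le> t}) \<union> (ball y (\<rho> (Suc j)) \<inter> {x. t < v x}))"
      by (rule arg_cong[where f = "measure M"]) auto
    also have "\<dots> = measure M (ball y (\<rho> (Suc j)) \<inter> {x. v x \<le> t}) + measure M (ball y (\<rho> (Suc j)) \<inter> {x. t < v x})"
      by (rule measure_Un_AE) (use fm sets in auto)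
    finally have "vol y (\<rho> (Suc j)) * (1 / 2) \<le> measure M (ball y (\<rho> (Suc j)) \<inter> {x. t < v x})"
      using j(1) \<open>\<theta> \<le> 1 / 2\<close> mult_right_mono[OF \<open>\<theta> \<le> 1 / 2\<close>, of "vol y (\<rho> (Suc j))"] by (simp add: small_def)
    also have "\<dots> \<le> measure M (ball y ?r \<inter> {x. t < v x})"
      using \<rho>(1)[of "Suc j"] \<rho>(3)[of j] by (intro measure_mono_fmeasurable fm sets) auto
    finally have half: "vol y (\<rho> (Suc j)) * (1 / 2) \<le> measure M (ball y ?r \<inter> {x. t < v x})" .
    have "\<theta> * vol y ?r \<le> \<theta> * (Cd * vol y (\<rho> (Suc j)))"
      using vol_doubling[OF \<rho>(1)[of "Suc j"], of y] \<rho>(3)[of j] \<theta>(1) by (intro mult_left_mono) auto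
    also have "\<dots> = (\<theta> * Cd) * vol y (\<rho> (Suc j))" by simp
    also have "\<dots> \<le> (1 / 2) * vol y (\<rho> (Suc j))"
      using \<theta>(2) Cd_ge_1 by (intro mult_right_mono) (auto simp: field_simps)
    finally show "\<theta> * vol y ?r \<le> measure M (ball y ?r \<inter> {x. t < v x})" using half by simp
  qed
  define E where "E n = ball y ?r \<inter> {x. t + inverse (real (Suc n)) \<le> v x}" for n
  have "(\<lambda>n. measure M (E n)) \<longlonglongrightarrow> measure M (\<Union>n. E n)"
  proof (rule Lim_measure_incseq)
    show "range E \<subseteq> sets M" using sets by (auto simp: E_def)
    show "incseq E"
    proof (rule incseq_SucI)
      fix n
      have le: "inverse (real (Suc (Suc n))) \<le> inverse (real (Suc n))" by (intro le_imp_inverse_le) auto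
      show "E n \<le> E (Suc n)"
        unfolding E_def by (intro Int_mono order_refl Collect_mono impI) (use le in linarith)
    qed
    have "emeasure M (\<Union>n. E n) \<le> emeasure M (ball y ?r)"
      by (intro emeasure_mono) (auto simp: E_def)
    then show "emeasure M (\<Union>n. E n) \<noteq> \<infinity>" using emeasure_ball_finite[of y ?r] le_less_trans by fastforce
  qed
  moreover have "(\<Union>n. E n) = ball y ?r \<inter> {x. t < v x}"
  proof -
    have "\<exists>n. t + inverse (real (Suc n)) \<le> v x" if less: "t < v x" for x
    proof -
      have "0 < v x - t" using less by simp
      then obtain n where "inverse (real (Suc n)) < v x - t"
        by (rule reals_Archimedean[THEN exE])
      then have "t + inverse (real (Suc n)) \<le> v x" by linarith
      then show ?thesis ..
    qed
    moreover have "t < v x" if "t + inverse (real (Suc n)) \<le> v x" for x n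
    proof -
      have "0 < inverse (real (Suc n))" by simp
      then show ?thesis using that by linarith
    qed
    ultimately show ?thesis by (auto simp: E_def)
  qed
  moreover have "\<theta> / 2 * vol y ?r < \<theta> * vol y ?r"
    using \<theta>(1) vol_pos[OF \<rho>(1)] by simp
  ultimately have "\<forall>\<^sub>F n in sequentially. \<theta> / 2 * vol y ?r < measure M (E n)"
    using big by (intro order_tendstoD(1)[of _ "measure M (\<Union>n. E n)"]) auto
  then obtain n where n: "\<theta> / 2 * vol y ?r < measure M (E n)"
    by (auto simp: eventually_sequentially)
  have "\<theta> / 2 * vol y ?r \<le> measure M (ball y ?r \<inter> {x. t + \<eta> \<le> v x})" if "\<eta> < inverse (real (Suc n))" for \<eta>
  proof -
    have "measure M (E n) \<le> measure M (ball y ?r \<inter> {x. t + \<eta> \<le> v x})"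
      unfolding E_def using that by (intro measure_mono_fmeasurable fm sets) (auto intro!: sets.Int sets)
    then show ?thesis using n by simp
  qed
  then have "\<exists>\<delta>>0. \<forall>\<eta>. 0 < \<eta> \<and> \<eta> < \<delta> \<longrightarrow> \<theta> / 2 * vol y ?r \<le> measure M (ball y ?r \<inter> {x. t + \<eta> \<le> v x})"
    by (intro exI[of _ "inverse (real (Suc n))"]) auto
  then show ?thesis
    using j(2) \<rho>(1,2)[of j] by (intro exI[of _ ?r]) (auto simp: small_def)
qed

text \<open>Otherwise fast growth, continued from point to point as far as possible, would raise \<open>F\<close> by more
  than \<open>J\<close> between \<open>0\<close> and \<open>1/2\<close>.\<close>

lemma slow_growth_point:
  fixes F :: "real \<Rightarrow> real"
  assumes mono: "\<And>s t. s \<le> t \<Longrightarrow> F s \<le> F t" and F: "0 \<le> F 0" "F (1/2) \<le> J" and J: "0 < J"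
  shows "\<exists>t\<ge>0. t < 1/2 \<and> (\<forall>\<delta>>0. \<exists>\<eta>>0. \<eta> < \<delta> \<and> F (t + \<eta>) - F t \<le> 3 * J * \<eta>)"
proof (rule ccontr)
  assume no: "\<not> ?thesis"
  define T where "T = {s. 0 \<le> s \<and> s \<le> 1/2 \<and> F 0 + 3 * J * s \<le> F s}"
  have T0: "0 \<in> T" by (simp add: T_def)
  have bdd: "bdd_above T" by (auto simp: T_def intro!: bdd_aboveI[of _ "1/2"])
  define t where "t = Sup T"
  have t0: "0 \<le> t" unfolding t_def using T0 bdd by (rule cSup_upper)
  have ne: "T \<noteq> {}" using T0 by blast
  have t1: "t \<le> 1/2" unfolding t_def by (rule cSup_least[OF ne]) (simp add: T_def)
  have le: "F 0 + 3 * J * t \<le> F t"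
  proof -
    have "s \<le> (F t - F 0) / (3 * J)" if "s \<in> T" for s
    proof -
      have "s \<le> t" unfolding t_def using that bdd by (rule cSup_upper)
      then have "F 0 + 3 * J * s \<le> F t" using that mono[of s t] by (auto simp: T_def)
      then show ?thesis using J by (simp add: field_simps)
    qed
    then have "t \<le> (F t - F 0) / (3 * J)" unfolding t_def by (rule cSup_least[OF ne])
    then show ?thesis using J by (simp add: field_simps)
  qed
  have "t < 1/2"
  proof (rule ccontr)
    assume "\<not> t < 1/2"
    then have "t = 1/2" using t1 by linarith
    with le have "F 0 + 3 * J * (1/2) \<le> F (1/2)" by (simp only:)
    then show False using F J by simp
  qed
  then obtain \<delta> where \<delta>: "0 < \<delta>" "\<And>\<eta>. 0 < \<eta> \<Longrightarrow> \<eta> < \<delta> \<Longrightarrow> 3 * J * \<eta> < F (t + \<eta>) - F t"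
    using no t0 by (metis linorder_not_le)
  define \<eta> where "\<eta> = min (\<delta> / 2) (1/2 - t)"
  have "\<eta> \<le> 1/2 - t" "\<eta> \<le> \<delta> / 2" unfolding \<eta>_def by (rule min.cobounded2, rule min.cobounded1)
  moreover have "0 < \<eta>" using \<delta>(1) \<open>t < 1/2\<close> by (simp add: \<eta>_def)
  ultimately have \<eta>: "0 < \<eta>" "\<eta> < \<delta>" "t + \<eta> \<le> 1/2" using \<delta>(1) by linarith+
  then have "t + \<eta> \<in> T"
    using \<delta>(2)[of \<eta>] le t0 by (auto simp: T_def algebra_simps)
  then have "t + \<eta> \<le> t" using bdd unfolding t_def by (rule cSup_upper)
  then show False using \<eta>(1) by simp
qed

context poincare_space
begin

text \<open>The last factor bounds the volume of a ball dilated by \<open>5 * \<Lambda>\<close>.\<close>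

definition boxing_const :: real where
  "boxing_const = 160 * Cp * Cd ^ 5 * Cd ^ (LEAST n. 5 * \<Lambda> \<le> 2 ^ n)"

lemma boxing_const_pos: "0 < boxing_const"
  unfolding boxing_const_def using Cp_pos Cd_ge_1 by (intro mult_pos_pos zero_less_power) auto

lemma scaled_ball_cost:
  assumes \<rho>: "0 < \<rho>"
  shows "vol y (5 * \<Lambda> * \<rho>) / (5 * \<Lambda> * \<rho>) \<le> Cd ^ (LEAST n. 5 * \<Lambda> \<le> 2 ^ n) * (vol y \<rho> / \<rho>)"
proof -
  let ?n = "LEAST n. 5 * \<Lambda> \<le> 2 ^ n"
  have "\<exists>n. 5 * \<Lambda> \<le> 2 ^ n" using real_arch_pow[of 2 "5 * \<Lambda>"] less_imp_le by auto
  then have "5 * \<Lambda> \<le> 2 ^ ?n" by (rule LeastI_ex)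
  then have "5 * \<Lambda> * \<rho> \<le> 2 ^ ?n * \<rho>" using \<rho> by simp
  then have "vol y (5 * \<Lambda> * \<rho>) \<le> Cd ^ ?n * vol y \<rho>"
    by (intro vol_compare \<rho>) simp
  moreover have "\<rho> \<le> 5 * \<Lambda> * \<rho>" using \<Lambda>_ge_1 \<rho> by simp
  ultimately have "vol y (5 * \<Lambda> * \<rho>) / (5 * \<Lambda> * \<rho>) \<le> (Cd ^ ?n * vol y \<rho>) / \<rho>"
    using \<rho> Cd_ge_1 by (intro frac_le mult_nonneg_nonneg zero_le_power) auto
  then show ?thesis by simp
qed

text \<open>The point \<open>z\<close> of the annulus provides a ball of radius \<open>r / 2\<close> on which \<open>v\<close> vanishes.\<close>

lemma zero_set_fraction:
  assumes r: "0 < r" and y: "y \<in> ball x r" and z: "5/2 * r \<le> dist x z" "dist x z \<le> 7/2 * r"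
    and v: "v \<in> borel_measurable borel" "\<And>p. p \<notin> ball x (2 * r) \<Longrightarrow> v p = (0::real)" and t: "0 \<le> t"
  shows "vol y (8 * r) \<le> Cd ^ 5 * measure M (ball y (8 * r) \<inter> {p. v p \<le> t})"
proof -
  have yz: "dist y z < 9/2 * r" using dist_triangle[of y z x] y z r by (simp add: dist_commute)
  then have "vol y (8 * r) \<le> Cd ^ 5 * vol z (r / 2)"
    using r by (intro vol_compare) auto
  also have "vol z (r / 2) \<le> measure M (ball y (8 * r) \<inter> {p. v p \<le> t})"
  proof (rule measure_mono_fmeasurable)
    note borel_measurable_M[OF v(1), measurable]
    have "{p \<in> space M. v p \<le> t} \<in> sets M" by measurable
    then have "{p. v p \<le> t} \<in> sets M" by (simp add: space_UNIV)
    then show "ball y (8 * r) \<inter> {p. v p \<le> t} \<in> fmeasurable M"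
      using emeasure_ball_finite[of y "8 * r"] by (intro fmeasurable_Int_fmeasurable) (auto intro: fmeasurableI)
    show "ball z (r / 2) \<subseteq> ball y (8 * r) \<inter> {p. v p \<le> t}"
    proof
      fix p assume "p \<in> ball z (r / 2)"
      then have p: "dist z p < r / 2" by simp
      have "p \<notin> ball x (2 * r)" using dist_triangle[of x z p] p z by (simp add: dist_commute)
      then have "v p = 0" by (rule v(2))
      then show "p \<in> ball y (8 * r) \<inter> {p. v p \<le> t}"
        using dist_triangle[of y p z] p yz r t by simp
    qed
  qed simp
  finally show ?thesis using Cd_ge_1 by (simp add: mult_left_mono)
qed

abbreviation layer_density :: "('a \<Rightarrow> real) \<Rightarrow> ('a \<Rightarrow> ennreal) \<Rightarrow> real \<Rightarrow> real \<Rightarrow> 'a \<Rightarrow> ennreal" where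
  "layer_density v G t \<eta> x \<equiv>
    ennreal (1 / \<eta>) * (G x * indicator {x. t < v x \<and> v x < t + \<eta>} x + ennreal \<eta> * G x)"

text \<open>The Poincare inequality for the truncation of \<open>v\<close> between the levels \<open>t\<close> and \<open>t + \<eta>\<close>.\<close>

lemma balanced_ball_estimate:
  assumes \<rho>: "0 < \<rho>" and v: "v \<in> borel_measurable borel" and G: "G \<in> borel_measurable borel"
    and ug: "path_upper_gradient v G" and \<eta>: "0 < (\<eta>::real)" and \<theta>: "0 < \<theta>"
    and low: "\<theta> * vol y \<rho> \<le> measure M (ball y \<rho> \<inter> {x. v x \<le> t})"
    and up: "\<theta> * vol y \<rho> \<le> measure M (ball y \<rho> \<inter> {x. t + \<eta> \<le> v x})"
  shows "ennreal (vol y \<rho> / \<rho>) \<le> ennreal (2 * Cp / \<theta>) *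
    (\<integral>\<^sup>+ x \<in> ball y (\<Lambda> * \<rho>). layer_density v G t \<eta> x \<partial>M)"
proof -
  define w where "w x = 1 / \<eta> * clamp_between t (t + \<eta>) (v x) + (- t / \<eta>)" for x
  let ?H = "\<lambda>x. layer_density v G t \<eta> x"
  have cl: "w x = clamp_between 0 1 ((v x - t) / \<eta>)" for x
    using \<eta> by (auto simp: w_def clamp_between_def min_def max_def field_simps)
  have w01: "0 \<le> w x \<and> w x \<le> 1" for x
    by (auto simp: cl clamp_between_def)
  have wb: "w \<in> borel_measurable borel"
    using v unfolding w_def clamp_between_def by measurable
  have "{x. t < v x \<and> v x < t + \<eta>} = {x \<in> space borel. t < v x \<and> v x < t + \<eta>}" by simp
  also have "\<dots> \<in> sets borel" using v by measurable
  finally have Kb: "(\<lambda>x. G x * indicator {x. t < v x \<and> v x < t + \<eta>} x + ennreal \<eta> * G x) \<in> borel_measurable borel"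
    using G by (intro borel_measurable_add borel_measurable_times_ennreal borel_measurable_indicator) auto
  then have Hb: "?H \<in> borel_measurable borel" by (intro borel_measurable_times_ennreal) auto
  have wug: "path_upper_gradient w ?H"
    unfolding w_def
    by (intro path_upper_gradient_affine path_upper_gradient_clamp_between ug G Kb) (use \<eta> in auto)
  have w0: "{x. w x = 0} = {x. v x \<le> t}" and w1: "{x. w x = 1} = {x. t + \<eta> \<le> v x}"
    using \<eta> by (auto simp: cl clamp_between_def min_def max_def field_simps split: if_splits)
  have "ennreal (\<theta> * vol y \<rho>) \<le> ennreal (2 * Cp * \<rho>) * (\<integral>\<^sup>+ x \<in> ball y (\<Lambda> * \<rho>). ?H x \<partial>M)"
    by (rule poincare_levels[OF \<rho> wb w01 Hb wug]) (use low up in \<open>simp_all add: w0 w1\<close>)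
  then have "ennreal (1 / (\<theta> * \<rho>)) * ennreal (\<theta> * vol y \<rho>) \<le> ennreal (1 / (\<theta> * \<rho>)) * (ennreal (2 * Cp * \<rho>) * (\<integral>\<^sup>+ x \<in> ball y (\<Lambda> * \<rho>). ?H x \<partial>M))"
    by (rule mult_left_mono) simp
  moreover have "ennreal (1 / (\<theta> * \<rho>)) * ennreal (\<theta> * vol y \<rho>) = ennreal (vol y \<rho> / \<rho>)"
    using \<theta> \<rho> by (subst ennreal_mult[symmetric]) auto
  moreover have "ennreal (1 / (\<theta> * \<rho>)) * (ennreal (2 * Cp * \<rho>) * (\<integral>\<^sup>+ x \<in> ball y (\<Lambda> * \<rho>). ?H x \<partial>M))
      = ennreal (2 * Cp / \<theta>) * (\<integral>\<^sup>+ x \<in> ball y (\<Lambda> * \<rho>). ?H x \<partial>M)"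
    unfolding mult.assoc[symmetric]
    using \<theta> \<rho> Cp_pos by (subst ennreal_mult[symmetric]) (auto simp: field_simps)
  ultimately show ?thesis by simp
qed

text \<open>By the choice of the level \<open>t\<close>, the mean of \<open>G\<close> over thin layers above \<open>t\<close> is controlled by
  its total mass: this replaces the coarea formula.\<close>

lemma good_level:
  assumes v: "v \<in> borel_measurable borel" "\<And>x. 0 \<le> v x" and G: "G \<in> borel_measurable borel"
    and W: "W \<in> sets M" and J: "(\<integral>\<^sup>+ x \<in> W. G x \<partial>M) \<le> ennreal J" "0 < J"
  shows "\<exists>t\<ge>0. t < 1/2 \<and> (\<forall>\<delta>>0. \<exists>\<eta>>0. \<eta> < \<delta> \<and>
    (\<integral>\<^sup>+ x \<in> W. layer_density v G t \<eta> x \<partial>M) \<le> ennreal (4 * J))"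
proof -
  define F where "F t = enn2real (\<integral>\<^sup>+ x \<in> W. G x * indicator {x. v x \<le> t} x \<partial>M)" for t
  note borel_measurable_M[OF v(1), measurable] borel_measurable_M[OF G, measurable] W [measurable]
  have [measurable]: "{x. v x \<le> t} \<in> sets M" "{x. t < v x \<and> v x < s} \<in> sets M" for t s
  proof -
    have "{x \<in> space M. v x \<le> t} \<in> sets M" "{x \<in> space M. t < v x \<and> v x < s} \<in> sets M" by measurable
    then show "{x. v x \<le> t} \<in> sets M" "{x. t < v x \<and> v x < s} \<in> sets M" by (simp_all add: space_UNIV)
  qed
  have le: "(\<integral>\<^sup>+ x \<in> W. G x * indicator {x. v x \<le> t} x \<partial>M) \<le> ennreal J" for t
    by (rule order_trans[OF _ J(1)]) (auto intro!: nn_integral_mono simp: indicator_def)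
  then have fin: "(\<integral>\<^sup>+ x \<in> W. G x * indicator {x. v x \<le> t} x \<partial>M) = ennreal (F t)" for t
    using le_less_trans[OF le ennreal_less_top] by (simp add: F_def)
  have "F s \<le> F t" if "s \<le> t" for s t
  proof -
    have "ennreal (F s) \<le> ennreal (F t)"
      unfolding fin[symmetric] using that by (intro nn_integral_mono) (auto simp: indicator_def)
    then show ?thesis by (simp add: F_def)
  qed
  moreover have "F (1/2) \<le> J"
  proof -
    have "ennreal (F (1/2)) \<le> ennreal J" using le[of "1/2"] unfolding fin .
    then show ?thesis using J(2) by (simp add: ennreal_le_iff)
  qed
  moreover have "0 \<le> F 0" by (simp add: F_def)
  ultimately obtain t where t: "0 \<le> t" "t < 1/2" "\<And>\<delta>. 0 < \<delta> \<Longrightarrow> \<exists>\<eta>>0. \<eta> < \<delta> \<and> F (t + \<eta>) - F t \<le> 3 * J * \<eta>"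
    using slow_growth_point[of F J] J(2) by metis
  have "(\<integral>\<^sup>+ x \<in> W. layer_density v G t \<eta> x \<partial>M) \<le> ennreal (4 * J)"
    if \<eta>: "0 < \<eta>" "F (t + \<eta>) - F t \<le> 3 * J * \<eta>" for \<eta>
  proof -
    let ?L = "\<integral>\<^sup>+ x \<in> W. G x * indicator {x. t < v x \<and> v x < t + \<eta>} x \<partial>M"
    have "ennreal (F t) + ?L \<le> ennreal (F (t + \<eta>))"
      unfolding fin[symmetric] using \<eta>
      by (subst nn_integral_add[symmetric]) (auto intro!: nn_integral_mono simp: indicator_def)
    then have "ennreal (F t) + ?L \<le> ennreal (F t) + ennreal (3 * J * \<eta>)"
      using \<eta> J(2) by (elim order_trans) (simp add: F_def ennreal_leI flip: ennreal_plus)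
    then have L: "?L \<le> ennreal (3 * J * \<eta>)" by (simp add: ennreal_add_left_cancel_le)
    have "(\<integral>\<^sup>+ x \<in> W. layer_density v G t \<eta> x \<partial>M)
      = (\<integral>\<^sup>+ x. ennreal (1 / \<eta>) * (G x * indicator {x. t < v x \<and> v x < t + \<eta>} x * indicator W x + ennreal \<eta> * (G x * indicator W x)) \<partial>M)"
      by (intro nn_integral_cong) (auto simp: indicator_def)
    also have "\<dots> = ennreal (1 / \<eta>) * (?L + ennreal \<eta> * (\<integral>\<^sup>+ x \<in> W. G x \<partial>M))"
      by (subst nn_integral_cmult, measurable) (subst nn_integral_add, measurable, subst nn_integral_cmult, measurable)
    also have "\<dots> \<le> ennreal (1 / \<eta>) * (ennreal (3 * J * \<eta>) + ennreal \<eta> * ennreal J)"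
      by (intro mult_left_mono add_mono L J(1)) auto
    also have "\<dots> = ennreal (4 * J)"
      using \<eta>(1) J(2) by (simp add: field_simps flip: ennreal_mult ennreal_plus)
    finally show ?thesis .
  qed
  note layer = this
  show ?thesis
  proof (rule exI[of _ t], intro conjI t(1,2) allI impI)
    fix \<delta> :: real assume "0 < \<delta>"
    from t(3)[OF this] obtain \<eta> where \<eta>: "0 < \<eta>" "\<eta> < \<delta>" "F (t + \<eta>) - F t \<le> 3 * J * \<eta>"
      by (elim exE conjE)
    show "\<exists>\<eta>>0. \<eta> < \<delta> \<and>
      (\<integral>\<^sup>+ x \<in> W. layer_density v G t \<eta> x \<partial>M) \<le> ennreal (4 * J)"
      by (rule exI[of _ \<eta>], intro conjI \<eta>(1,2) layer \<eta>(3))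
  qed
qed


text \<open>Replace \<open>u\<close> by the lower semicontinuous competitor \<open>v\<close>, choose a good level \<open>t\<close>, and
  stop around each point \<open>y\<close> of \<open>S\<close> at a radius \<open>\<sigma> y\<close> at which neither \<open>{v \<le> t}\<close> nor \<open>{v > t}\<close> is
  negligible. The Poincare inequality then bounds the cost of the ball by the mass of the density in
  a thin layer above \<open>t\<close>, and these bounds add up over a disjoint subfamily. The thickness \<open>\<eta>\<close> of the
  layer depends on the ball, so that only finitely many balls can be treated at a time.\<close>

theorem boxing_inequality:
  fixes x p :: 'a
  assumes r: "0 < r" and p: "4 * r \<le> dist x p" and S: "S \<subseteq> ball x r"
    and ug: "upper_gradient u \<rho>" and u1: "\<And>y. y \<in> S \<Longrightarrow> 1 \<le> u y"
    and u0: "\<And>y. y \<notin> ball x (2 * r) \<Longrightarrow> u y = 0"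
    and I: "(\<integral>\<^sup>+ y. \<rho> y \<partial>M) \<le> ennreal I" "0 < I"
  shows "\<exists>A\<subseteq>S. \<exists>R. (\<forall>y\<in>A. 0 < R y \<and> R y \<le> 40 * \<Lambda> * r) \<and> S \<subseteq> (\<Union>y\<in>A. ball y (R y)) \<and>
    (\<forall>F. finite F \<and> F \<subseteq> A \<longrightarrow> (\<Sum>y\<in>F. vol y (R y) / R y) \<le> boxing_const * I)"
proof -
  have cpt: "\<And>(y::'a) R. compact (cball y R)"
    by (rule compact_cball_if_doubling[OF doubling_measure_axioms])
  \<comment> \<open>\<open>W\<close> contains the dilated balls below, which have centres in \<open>ball x r\<close> and radii at most \<open>8 * \<Lambda> * r\<close>;
    \<open>c\<close> makes the error of the majorant at most \<open>I\<close>.\<close>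
  define W where "W = ball x (9 * \<Lambda> * r)"
  define c where "c = I / (vol x (9 * \<Lambda> * r) + 4)"
  have c: "0 < c" using I(2) by (simp add: c_def add_nonneg_pos)
  have Wfin: "emeasure M W < \<infinity>" unfolding W_def by (rule emeasure_ball_finite)
  have \<rho>b: "\<rho> \<in> borel_measurable borel" using ug by (simp add: upper_gradient_def)
  have "W \<in> sets M" by (simp add: W_def)
  from lipschitz_majorants[OF \<rho>b this Wfin c]
  obtain g :: "nat \<Rightarrow> 'a \<Rightarrow> real" and K N where "\<forall>n. (K n)-lipschitz_on UNIV (g n)" and "\<forall>n x. g n x \<le> N n"
    and ginc: "incseq g" and "\<forall>x. c \<le> g 0 x" and "\<forall>x. \<rho> x \<le> (SUP n. ennreal (g n x))"
    and gint: "(\<integral>\<^sup>+ x \<in> W. (SUP n. ennreal (g n x)) \<partial>M) \<le> ennreal c * (emeasure M W + 4) + 4 * (\<integral>\<^sup>+ x. \<rho> x \<partial>M)"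
    by (elim exE conjE)
  then have glip: "(K n)-lipschitz_on UNIV (g n)" and gN: "g n x \<le> N n" and gc: "c \<le> g 0 x"
    and g\<rho>: "\<rho> x \<le> (SUP n. ennreal (g n x))" for n x
    by simp_all
  define G where "G x = (SUP n. ennreal (g n x))" for x
  have Gb: "G \<in> borel_measurable borel"
  proof -
    have "g n \<in> borel_measurable borel" for n
      using lipschitz_on_continuous_on[OF glip[of n]] by (rule borel_measurable_continuous_onI)
    then show ?thesis unfolding G_def[abs_def] by measurable
  qed
  have J: "(\<integral>\<^sup>+ x \<in> W. G x \<partial>M) \<le> ennreal (5 * I)"
  proof -
    have "ennreal c * (emeasure M W + 4) = ennreal (c * (vol x (9 * \<Lambda> * r) + 4))"
      using c by (simp add: W_def emeasure_ball ennreal_mult)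
    also have "c * (vol x (9 * \<Lambda> * r) + 4) = I"
    proof -
      have "vol x (9 * \<Lambda> * r) + 4 \<noteq> 0"
        using measure_nonneg[of M "ball x (9 * \<Lambda> * r)"] by linarith
      then show ?thesis by (simp add: c_def)
    qed
    finally have "(\<integral>\<^sup>+ x \<in> W. G x \<partial>M) \<le> ennreal I + 4 * ennreal I"
      using gint I(1) unfolding G_def[symmetric] by (auto elim!: order_trans intro!: add_mono mult_left_mono)
    also have "\<dots> = ennreal (5 * I)"
    proof -
      have "4 * ennreal I = ennreal (4 * I)" using I(2) by (simp add: ennreal_mult')
      then show ?thesis using I(2) by (simp add: ennreal_plus[symmetric] del: ennreal_plus)
    qed
    finally show ?thesis .
  qed
  have "\<exists>v::'a \<Rightarrow> real. (\<forall>x. 0 \<le> v x \<and> v x \<le> 1) \<and> (\<forall>y. y \<notin> ball x (2 * r) \<longrightarrow> v y = 0)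
    \<and> (\<forall>x. 1 \<le> u x \<longrightarrow> v x = 1) \<and> (\<forall>t. open {x. t < v x})
    \<and> path_upper_gradient v (\<lambda>x. SUP n. ennreal (g n x))"
    by (rule lower_semicontinuous_competitor[OF cpt open_ball ug _ glip gN ginc c gc g\<rho>]) (rule u0)
  then obtain v :: "'a \<Rightarrow> real" where v01: "\<forall>x. 0 \<le> v x \<and> v x \<le> 1" and v0: "\<forall>y. y \<notin> ball x (2 * r) \<longrightarrow> v y = 0"
    and v1: "\<forall>x. 1 \<le> u x \<longrightarrow> v x = 1" and vopen: "\<forall>t. open {x. t < v x}"
    and vug: "path_upper_gradient v (\<lambda>x. SUP n. ennreal (g n x))"
    by (elim exE conjE)
  have vG: "path_upper_gradient v G" using vug by (simp add: G_def[abs_def])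
  have vb: "v \<in> borel_measurable borel"
    using vopen by (intro borel_measurableI_greater) simp
  obtain t where t: "0 \<le> t" "t < 1/2" and level: "\<And>\<delta>. 0 < \<delta> \<Longrightarrow> \<exists>\<eta>>0. \<eta> < \<delta> \<and>
    (\<integral>\<^sup>+ x \<in> W. layer_density v G t \<eta> x \<partial>M) \<le> ennreal (4 * (5 * I))"
    using good_level[OF vb _ Gb _ J] v01 I(2) unfolding W_def by auto
  \<comment> \<open>At the radius \<open>8 * r\<close> the set \<open>{v \<le> t}\<close> fills the fraction \<open>1 / Cd ^ 5\<close> of the ball; halving it
    meets the bound \<open>1 / (2 * Cd)\<close> required for stopping.\<close>
  define \<theta> where "\<theta> = 1 / (2 * Cd ^ 5)"
  have \<theta>: "0 < \<theta>" "\<theta> \<le> 1 / (2 * Cd)"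
    using Cd_ge_1 self_le_power[of Cd 5] by (auto simp: \<theta>_def intro!: divide_left_mono mult_pos_pos)
  obtain z where z: "5/2 * r \<le> dist x z" "dist x z \<le> 7/2 * r"
    using annulus_nonempty[OF r, of x p] p r by auto
  define good where "good y \<sigma> \<delta> \<longleftrightarrow> 0 < \<sigma> \<and> \<sigma> \<le> 8 * r \<and> 0 < \<delta> \<and> \<theta> / 2 * vol y \<sigma> \<le> measure M (ball y \<sigma> \<inter> {x. v x \<le> t}) \<and>
    (\<forall>\<eta>. 0 < \<eta> \<and> \<eta> < \<delta> \<longrightarrow> \<theta> / 2 * vol y \<sigma> \<le> measure M (ball y \<sigma> \<inter> {x. t + \<eta> \<le> v x}))" for y \<sigma> \<delta>
  have "\<exists>\<sigma> \<delta>. good y \<sigma> \<delta>" if y: "y \<in> S" for y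
  proof -
    have yx: "y \<in> ball x r" using S y by blast
    have "t < v y" using v1 u1[OF y] t by simp
    moreover have "\<theta> * vol y (8 * r) \<le> measure M (ball y (8 * r) \<inter> {x. v x \<le> t})"
    proof -
      have "\<theta> * vol y (8 * r) \<le> \<theta> * (Cd ^ 5 * measure M (ball y (8 * r) \<inter> {x. v x \<le> t}))"
        using zero_set_fraction[OF r yx z vb _ t(1)] v0 \<theta>(1) by (intro mult_left_mono) auto
      also have "\<dots> = 1/2 * measure M (ball y (8 * r) \<inter> {x. v x \<le> t})"
        using Cd_ge_1 by (simp add: \<theta>_def)
      also have "\<dots> \<le> measure M (ball y (8 * r) \<inter> {x. v x \<le> t})" by simp
      finally show ?thesis .
    qed
    ultimately obtain \<sigma> \<delta> where h: "0 < \<sigma>" "\<sigma> \<le> 8 * r" "\<theta> * vol y \<sigma> \<le> measure M (ball y \<sigma> \<inter> {x. v x \<le> t})"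
        "0 < \<delta>" "\<forall>\<eta>. 0 < \<eta> \<and> \<eta> < \<delta> \<longrightarrow> \<theta> / 2 * vol y \<sigma> \<le> measure M (ball y \<sigma> \<inter> {x. t + \<eta> \<le> v x})"
      using balanced_radius[OF vb vopen[rule_format] _ _ \<theta>, of t y "8 * r"] r by auto
    have "\<theta> / 2 * vol y \<sigma> \<le> \<theta> * vol y \<sigma>" using \<theta>(1) by (intro mult_right_mono) auto
    with h have "good y \<sigma> \<delta>" by (simp add: good_def)
    then show ?thesis by blast
  qed
  then obtain \<sigma> \<delta> where good: "\<And>y. y \<in> S \<Longrightarrow> good y (\<sigma> y) (\<delta> y)" by metis
  have \<sigma>: "0 < \<sigma> y" "\<sigma> y \<le> 8 * r" "0 < \<delta> y" if "y \<in> S" for y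
    using good[OF that] by (auto simp: good_def)
  obtain A where A: "A \<subseteq> S" "disjoint_family_on (\<lambda>y. ball y (\<Lambda> * \<sigma> y)) A" "S \<subseteq> (\<Union>y\<in>A. ball y (5 * (\<Lambda> * \<sigma> y)))"
    using vitali_covering[of S "\<lambda>y. \<Lambda> * \<sigma> y" "\<Lambda> * (8 * r)"] \<sigma> \<Lambda>_ge_1 by auto
  have AW: "ball y (\<Lambda> * \<sigma> y) \<subseteq> W" if "y \<in> A" for y
  proof
    fix q assume q: "q \<in> ball y (\<Lambda> * \<sigma> y)"
    have "\<Lambda> * \<sigma> y \<le> \<Lambda> * (8 * r)" using \<sigma>(2)[of y] A(1) that \<Lambda>_ge_1 by (intro mult_left_mono) auto
    moreover have "r \<le> \<Lambda> * r" using \<Lambda>_ge_1 r by simp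
    moreover have "dist x y < r" using S A(1) that by auto
    ultimately show "q \<in> W" using q dist_triangle[of x q y] by (simp add: W_def)
  qed
  have fin: "(\<Sum>y\<in>F. vol y (5 * \<Lambda> * \<sigma> y) / (5 * \<Lambda> * \<sigma> y)) \<le> boxing_const * I" if F: "finite F" "F \<subseteq> A" for F
  proof -
    have FS: "F \<subseteq> S" using F A by blast
    define \<delta>0 where "\<delta>0 = Min (insert 1 (\<delta> ` F))"
    have "0 < \<delta>0" using F \<sigma>(3) FS by (auto simp: \<delta>0_def Min_gr_iff)
    from level[OF this] obtain \<eta> where \<eta>: "0 < \<eta>" "\<eta> < \<delta>0"
      and lev: "(\<integral>\<^sup>+ x \<in> W. layer_density v G t \<eta> x \<partial>M) \<le> ennreal (4 * (5 * I))"
      by (elim exE conjE)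
    have \<eta>\<delta>: "\<eta> < \<delta> y" if "y \<in> F" for y
      using \<eta>(2) F(1) that by (auto simp: \<delta>0_def)
    define H where "H x = layer_density v G t \<eta> x" for x
    have HM: "H \<in> borel_measurable M"
    proof -
      have "{x \<in> space borel. t < v x \<and> v x < t + \<eta>} \<in> sets borel" using vb by measurable
      then have "H \<in> borel_measurable borel"
        unfolding H_def[abs_def]
        using Gb by (intro borel_measurable_add borel_measurable_times_ennreal borel_measurable_indicator) auto
      then show ?thesis by (rule borel_measurable_M)
    qed
    have "ennreal (\<Sum>y\<in>F. vol y (\<sigma> y) / \<sigma> y) = (\<Sum>y\<in>F. ennreal (vol y (\<sigma> y) / \<sigma> y))"
      using \<sigma>(1) FS by (intro sum_ennreal[symmetric]) (auto simp: subset_iff less_imp_le)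
    also have "\<dots> \<le> (\<Sum>y\<in>F. ennreal (2 * Cp / (\<theta> / 2)) * (\<integral>\<^sup>+ x \<in> ball y (\<Lambda> * \<sigma> y). H x \<partial>M))"
    proof (rule sum_mono)
      fix y assume y: "y \<in> F"
      then have "good y (\<sigma> y) (\<delta> y)" using good FS by blast
      then show "ennreal (vol y (\<sigma> y) / \<sigma> y) \<le> ennreal (2 * Cp / (\<theta> / 2)) * (\<integral>\<^sup>+ x \<in> ball y (\<Lambda> * \<sigma> y). H x \<partial>M)"
        unfolding H_def good_def using \<eta>\<delta>[OF y] \<eta>(1) \<theta>(1)
        by (intro balanced_ball_estimate[OF _ vb Gb vG]) auto
    qed
    also have "\<dots> = ennreal (2 * Cp / (\<theta> / 2)) * (\<integral>\<^sup>+ x. (\<Sum>y\<in>F. H x * indicator (ball y (\<Lambda> * \<sigma> y)) x) \<partial>M)"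
      using HM by (subst nn_integral_sum) (auto simp: sum_distrib_left)
    also have "\<dots> \<le> ennreal (2 * Cp / (\<theta> / 2)) * (\<integral>\<^sup>+ x \<in> W. H x \<partial>M)"
    proof (intro mult_left_mono nn_integral_mono)
      fix q
      have "(\<Sum>y\<in>F. H q * indicator (ball y (\<Lambda> * \<sigma> y)) q) = H q * indicator (\<Union>y\<in>F. ball y (\<Lambda> * \<sigma> y)) q"
        unfolding indicator_UN_disjoint[OF F(1) disjoint_family_on_mono[OF F(2) A(2)]] by (rule sum_distrib_left[symmetric])
      also have "\<dots> \<le> H q * indicator W q"
      proof (intro mult_left_mono)
        have "(\<Union>y\<in>F. ball y (\<Lambda> * \<sigma> y)) \<subseteq> W" using AW F(2) by blast
        then show "indicator (\<Union>y\<in>F. ball y (\<Lambda> * \<sigma> y)) q \<le> (indicator W q :: ennreal)"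
          by (rule indicator_leI[OF subsetD])
      qed simp
      finally show "(\<Sum>y\<in>F. H q * indicator (ball y (\<Lambda> * \<sigma> y)) q) \<le> H q * indicator W q" .
    qed simp
    also have "\<dots> \<le> ennreal (2 * Cp / (\<theta> / 2)) * ennreal (4 * (5 * I))"
      using lev unfolding H_def by (rule mult_left_mono) simp
    also have "\<dots> = ennreal (160 * Cp * Cd ^ 5 * I)"
      using Cp_pos I(2) Cd_ge_1 by (subst ennreal_mult[symmetric]) (auto simp: \<theta>_def)
    finally have sum: "(\<Sum>y\<in>F. vol y (\<sigma> y) / \<sigma> y) \<le> 160 * Cp * Cd ^ 5 * I"
      using Cp_pos I(2) Cd_ge_1 by (simp add: ennreal_le_iff)
    have "(\<Sum>y\<in>F. vol y (5 * \<Lambda> * \<sigma> y) / (5 * \<Lambda> * \<sigma> y)) \<le> (\<Sum>y\<in>F. Cd ^ (LEAST n. 5 * \<Lambda> \<le> 2 ^ n) * (vol y (\<sigma> y) / \<sigma> y))"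
      using FS \<sigma>(1) by (intro sum_mono scaled_ball_cost) auto
    also have "\<dots> \<le> Cd ^ (LEAST n. 5 * \<Lambda> \<le> 2 ^ n) * (160 * Cp * Cd ^ 5 * I)"
      unfolding sum_distrib_left[symmetric] using sum Cd_ge_1 by (intro mult_left_mono) auto
    also have "\<dots> = boxing_const * I" by (simp add: boxing_const_def)
    finally show ?thesis .
  qed
  have rad: "0 < 5 * \<Lambda> * \<sigma> y \<and> 5 * \<Lambda> * \<sigma> y \<le> 40 * \<Lambda> * r" if "y \<in> A" for y
    using \<sigma>(1,2)[of y] that A(1) \<Lambda>_ge_1 by auto
  show ?thesis
    by (rule exI[of _ A], intro conjI A(1), rule exI[of _ "\<lambda>y. 5 * \<Lambda> * \<sigma> y"])
      (use rad A(3) fin in \<open>simp add: mult.assoc\<close>)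
qed

end

section \<open>Hausdorff content of codimension one\<close>

context doubling_measure
begin

text \<open>Coverings are sequences of balls. Balls of radius \<open>0\<close> are empty and cost \<open>0 / 0 = 0\<close>, so
  finite coverings are included.\<close>

definition covers :: "real \<Rightarrow> 'a set \<Rightarrow> (nat \<Rightarrow> 'a) \<Rightarrow> (nat \<Rightarrow> real) \<Rightarrow> bool" where
  "covers R E c \<rho> \<longleftrightarrow> (\<forall>j. 0 \<le> \<rho> j \<and> \<rho> j \<le> R) \<and> E \<subseteq> (\<Union>j. ball (c j) (\<rho> j))"

abbreviation cost :: "(nat \<Rightarrow> 'a) \<Rightarrow> (nat \<Rightarrow> real) \<Rightarrow> ennreal" where
  "cost c \<rho> \<equiv> (\<Sum>j. ennreal (vol (c j) (\<rho> j) / \<rho> j))"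

definition hausdorff_content :: "real \<Rightarrow> 'a set \<Rightarrow> ennreal" where
  "hausdorff_content R E = (INF (c, \<rho>) \<in> {(c, \<rho>). covers R E c \<rho>}. cost c \<rho>)"

lemma hausdorff_content_le: "covers R E c \<rho> \<Longrightarrow> hausdorff_content R E \<le> cost c \<rho>"
  unfolding hausdorff_content_def by (rule INF_lower2[of "(c, \<rho>)"]) auto

lemma hausdorff_content_lessD:
  assumes "hausdorff_content R E < a"
  shows "\<exists>c \<rho>. covers R E c \<rho> \<and> cost c \<rho> < a"
  using assms unfolding hausdorff_content_def INF_less_iff by auto

lemma hausdorff_content_mono:
  assumes "E \<subseteq> E'" "R' \<le> R"
  shows "hausdorff_content R E \<le> hausdorff_content R' E'"
  unfolding hausdorff_content_def[of R' E']
proof (rule INF_greatest, clarify)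
  fix c \<rho> assume "covers R' E' c \<rho>"
  then have "covers R E c \<rho>" using assms unfolding covers_def by (meson order_trans)
  then show "hausdorff_content R E \<le> cost c \<rho>" by (rule hausdorff_content_le)
qed

lemma hausdorff_content_UN_le:
  fixes E :: "nat \<Rightarrow> 'a set"
  shows "hausdorff_content R (\<Union>i. E i) \<le> (\<Sum>i. hausdorff_content R (E i))"
proof (cases "(\<Sum>i. hausdorff_content R (E i)) = \<infinity>")
  case False
  have fin: "hausdorff_content R (E i) \<noteq> \<infinity>" for i
    using False ennreal_suminf_lessD[of "\<lambda>i. hausdorff_content R (E i)" \<infinity> i] by (auto simp: less_top)
  show ?thesis
  proof (rule ennreal_le_epsilon)
    fix e :: real assume e: "0 < e"
    define near where "near i c \<rho> \<longleftrightarrow> covers R (E i) c \<rho> \<and>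
      cost c \<rho> < hausdorff_content R (E i) + ennreal (e * (1/2) ^ Suc i)" for i c \<rho>
    have "\<exists>c \<rho>. near i c \<rho>" for i
      unfolding near_def
    proof (rule hausdorff_content_lessD)
      obtain a where a: "0 \<le> a" "hausdorff_content R (E i) = ennreal a"
        using fin[of i] by (cases "hausdorff_content R (E i)" rule: ennreal_cases) auto
      have "ennreal a < ennreal (a + e * (1/2) ^ Suc i)" using a(1) e by (intro ennreal_lessI add_nonneg_pos) auto
      then show "hausdorff_content R (E i) < hausdorff_content R (E i) + ennreal (e * (1/2) ^ Suc i)"
        using a e by (simp add: ennreal_plus)
    qed
    then obtain c \<rho> where "\<And>i. near i (c i) (\<rho> i)"
      by metis
    then have c: "covers R (E i) (c i) (\<rho> i)"
      and le: "cost (c i) (\<rho> i) < hausdorff_content R (E i) + ennreal (e * (1/2) ^ Suc i)" for i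
      by (simp_all add: near_def)
    define c' \<rho>' where "c' k = c (fst (prod_decode k)) (snd (prod_decode k))" and "\<rho>' k = \<rho> (fst (prod_decode k)) (snd (prod_decode k))" for k
    have "covers R (\<Union>i. E i) c' \<rho>'"
      unfolding covers_def
    proof (intro conjI allI subsetI)
      show "0 \<le> \<rho>' k" "\<rho>' k \<le> R" for k
        using c[of "fst (prod_decode k)"] by (auto simp: covers_def \<rho>'_def)
      fix x assume "x \<in> (\<Union>i. E i)"
      then obtain i j where "x \<in> ball (c i j) (\<rho> i j)" using c unfolding covers_def by blast
      then have "x \<in> ball (c' (prod_encode (i, j))) (\<rho>' (prod_encode (i, j)))"
        by (simp add: c'_def \<rho>'_def)
      then show "x \<in> (\<Union>k. ball (c' k) (\<rho>' k))" by blast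
    qed
    then have "hausdorff_content R (\<Union>i. E i) \<le> cost c' \<rho>'"
      by (rule hausdorff_content_le)
    also have "\<dots> = (\<Sum>i. cost (c i) (\<rho> i))"
      using suminf_ennreal_2dimen[where f = "\<lambda>(i, j). ennreal (vol (c i j) (\<rho> i j) / \<rho> i j)", OF refl]
      by (simp add: c'_def \<rho>'_def o_def split_beta)
    also have "\<dots> \<le> (\<Sum>i. hausdorff_content R (E i) + ennreal (e * (1/2) ^ Suc i))"
      using le by (intro suminf_le) (auto intro: less_imp_le)
    also have "\<dots> = (\<Sum>i. hausdorff_content R (E i)) + (\<Sum>i. ennreal (e * (1/2) ^ Suc i))"
      by (intro suminf_add[symmetric]) auto
    also have "(\<Sum>i. ennreal (e * (1/2) ^ Suc i)) = ennreal e"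
      using e sums_mult[OF power_half_series, of e] by (intro suminf_ennreal_eq) auto
    finally show "hausdorff_content R (\<Union>i. E i) \<le> (\<Sum>i. hausdorff_content R (E i)) + ennreal e" .
  qed
qed simp

lemma hausdorff_content_UN_zero:
  fixes E :: "nat \<Rightarrow> 'a set"
  assumes "\<And>i. hausdorff_content R (E i) = 0"
  shows "hausdorff_content R (\<Union>i. E i) = 0"
  using hausdorff_content_UN_le[of R E] assms by simp

text \<open>Since the finite partial sums of the positive costs are bounded, the family is countable.\<close>

lemma hausdorff_content_le_family:
  assumes A: "\<And>y. y \<in> A \<Longrightarrow> 0 < R y \<and> R y \<le> R0" and R0: "0 \<le> R0" and cov: "E \<subseteq> (\<Union>y\<in>A. ball y (R y))"
    and bd: "\<And>F. finite F \<Longrightarrow> F \<subseteq> A \<Longrightarrow> (\<Sum>y\<in>F. vol y (R y) / R y) \<le> B"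
  shows "hausdorff_content R0 E \<le> ennreal B"
proof -
  let ?f = "\<lambda>y. vol y (R y) / R y"
  have pos: "0 < ?f y" if "y \<in> A" for y using A[OF that] vol_pos by simp
  have "?f summable_on A"
  proof (rule nonneg_bdd_above_summable_on)
    show "0 \<le> ?f y" if "y \<in> A" for y using pos[OF that] by simp
    show "bdd_above (sum ?f ` {F. F \<subseteq> A \<and> finite F})"
      by (rule bdd_aboveI[of _ B]) (use bd in blast)
  qed
  then have "countable {y \<in> A. ?f y \<noteq> 0}" by (rule summable_countable_real)
  moreover have "{y \<in> A. ?f y \<noteq> 0} = A" using pos by fastforce
  ultimately have cA: "countable A" by simp
  define J where "J = to_nat_on A ` A"
  have inj: "inj_on (to_nat_on A) A" using cA by (rule inj_on_to_nat_on)
  define c where "c = inv_into A (to_nat_on A)"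
  have c: "c (to_nat_on A y) = y" if "y \<in> A" for y
    unfolding c_def using inj that by (rule inv_into_f_f)
  define \<rho> where "\<rho> j = (if j \<in> J then R (c j) else 0)" for j
  have cJ: "c j \<in> A" if "j \<in> J" for j using that c by (auto simp: J_def)
  have cinj: "inj_on c J" using c by (auto simp: J_def inj_on_def)
  have "covers R0 E c \<rho>"
    unfolding covers_def
  proof (intro conjI allI subsetI)
    show "0 \<le> \<rho> j" "\<rho> j \<le> R0" for j
      using A[OF cJ, of j] R0 by (auto simp: \<rho>_def)
    fix x assume "x \<in> E"
    then obtain y where y: "y \<in> A" "x \<in> ball y (R y)" using cov by blast
    then have "x \<in> ball (c (to_nat_on A y)) (\<rho> (to_nat_on A y))" using c[OF y(1)] by (simp add: \<rho>_def J_def)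
    then show "x \<in> (\<Union>j. ball (c j) (\<rho> j))" by blast
  qed
  then have "hausdorff_content R0 E \<le> cost c \<rho>" by (rule hausdorff_content_le)
  also have "\<dots> \<le> ennreal B"
  proof (rule suminf_le_const)
    fix n
    have "(\<Sum>j<n. ennreal (vol (c j) (\<rho> j) / \<rho> j)) = (\<Sum>j\<in>{..<n} \<inter> J. ennreal (?f (c j)))"
      by (intro sum.mono_neutral_cong_right) (auto simp: \<rho>_def)
    also have "\<dots> = ennreal (\<Sum>j\<in>{..<n} \<inter> J. ?f (c j))"
      using pos cJ by (intro sum_ennreal) (auto intro: less_imp_le)
    also have "(\<Sum>j\<in>{..<n} \<inter> J. ?f (c j)) = (\<Sum>y\<in>c ` ({..<n} \<inter> J). ?f y)"
      by (subst sum.reindex) (auto intro: inj_on_subset[OF cinj])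
    also have "ennreal \<dots> \<le> ennreal B"
      using cJ by (intro ennreal_leI bd) auto
    finally show "(\<Sum>j<n. ennreal (vol (c j) (\<rho> j) / \<rho> j)) \<le> ennreal B" .
  qed simp
  finally show ?thesis .
qed

lemma hausdorff_content_empty: "0 \<le> R \<Longrightarrow> hausdorff_content R {} = 0"
  using hausdorff_content_le_family[of "{}" "\<lambda>_. 0" R "{}" 0] by simp

text \<open>If every piece of \<open>E\<close> in a small ball has at most a small fraction of the content of the ball,
  then each covering of \<open>S\<close> can be replaced by one of half the cost, so the content of \<open>S\<close> is
  at most half of itself.\<close>

lemma hausdorff_content_zero_if_locally_small:
  assumes small: "\<And>x r. x \<in> E \<Longrightarrow> 0 < r \<Longrightarrow> r < r0 \<Longrightarrow> hausdorff_content (r / 2) (E \<inter> ball x r) \<le> ennreal (vol x r / (Cd ^ 2 * r))"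
    and R: "0 \<le> R" "2 * R < r0" and S: "S \<subseteq> E" "hausdorff_content R S < \<infinity>"
  shows "hausdorff_content R S = 0"
proof (rule ccontr)
  assume ne: "hausdorff_content R S \<noteq> 0"
  have "hausdorff_content R S < 2 * hausdorff_content R S"
  proof -
    obtain a where "0 \<le> a" "hausdorff_content R S = ennreal a" using S(2) by (cases "hausdorff_content R S" rule: ennreal_cases) auto
    then show ?thesis using ne by (simp add: ennreal_less_iff flip: ennreal_numeral ennreal_mult)
  qed
  then obtain c \<rho> where cov: "covers R S c \<rho>" and less: "cost c \<rho> < 2 * hausdorff_content R S"
    using hausdorff_content_lessD by blast
  have \<rho>: "0 \<le> \<rho> j" "\<rho> j \<le> R" for j using cov by (auto simp: covers_def)
  have S_eq: "S = (\<Union>j. S \<inter> ball (c j) (\<rho> j))" using cov by (auto simp: covers_def)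
  have piece: "hausdorff_content R (S \<inter> ball (c j) (\<rho> j)) \<le> ennreal (1/2) * ennreal (vol (c j) (\<rho> j) / \<rho> j)" for j
  proof (cases "S \<inter> ball (c j) (\<rho> j) = {}")
    case True
    then show ?thesis using hausdorff_content_empty[OF R(1)] by simp
  next
    case False
    then obtain y where y: "y \<in> S" "dist (c j) y < \<rho> j" by auto
    then have pos: "0 < \<rho> j" using zero_le_dist[of "c j" y] by linarith
    have "ball (c j) (\<rho> j) \<subseteq> ball y (2 * \<rho> j)"
    proof
      fix q assume "q \<in> ball (c j) (\<rho> j)"
      then show "q \<in> ball y (2 * \<rho> j)" using dist_triangle[of y q "c j"] y(2) by (simp add: dist_commute)
    qed
    then have "hausdorff_content R (S \<inter> ball (c j) (\<rho> j)) \<le> hausdorff_content (2 * \<rho> j / 2) (E \<inter> ball y (2 * \<rho> j))"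
      using S(1) \<rho>(2)[of j] by (intro hausdorff_content_mono) auto
    also have "\<dots> \<le> ennreal (vol y (2 * \<rho> j) / (Cd ^ 2 * (2 * \<rho> j)))"
      using S(1) y(1) pos \<rho>(2)[of j] R by (intro small) auto
    also have "vol y (2 * \<rho> j) / (Cd ^ 2 * (2 * \<rho> j)) \<le> 1/2 * (vol (c j) (\<rho> j) / \<rho> j)"
    proof -
      have "vol y (2 * \<rho> j) \<le> Cd ^ 2 * vol (c j) (\<rho> j)"
        using y(2) pos by (intro vol_compare) (auto simp: dist_commute)
      then show ?thesis using pos Cd_ge_1 by (simp add: field_simps)
    qed
    then have "ennreal (vol y (2 * \<rho> j) / (Cd ^ 2 * (2 * \<rho> j))) \<le> ennreal (1/2 * (vol (c j) (\<rho> j) / \<rho> j))"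
      by (rule ennreal_leI)
    also have "\<dots> = ennreal (1/2) * ennreal (vol (c j) (\<rho> j) / \<rho> j)"
      using pos by (intro ennreal_mult) auto
    finally show ?thesis .
  qed
  have "hausdorff_content R S \<le> (\<Sum>j. hausdorff_content R (S \<inter> ball (c j) (\<rho> j)))"
    by (subst S_eq) (rule hausdorff_content_UN_le)
  also have "\<dots> \<le> (\<Sum>j. ennreal (1/2) * ennreal (vol (c j) (\<rho> j) / \<rho> j))"
    using piece by (intro suminf_le) auto
  also have "\<dots> = ennreal (1/2) * cost c \<rho>"
    by (rule ennreal_suminf_cmult)
  also have "\<dots> < ennreal (1/2) * (2 * hausdorff_content R S)"
    using less by (intro ennreal_mult_strict_left_mono) (simp_all add: less_top[symmetric] del: ennreal_half)
  also have "\<dots> = hausdorff_content R S"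
    by (simp add: mult.assoc[symmetric] ennreal_mult[symmetric] del: ennreal_half flip: ennreal_numeral)
  finally show False by simp
qed

lemma hausdorff_content_bounded_finite:
  assumes "0 < R"
  shows "hausdorff_content R (cball x n) < \<infinity>"
proof -
  obtain k where k: "finite k" "cball x n \<subseteq> (\<Union>y\<in>k. ball y R)"
    using cball_totally_bounded[OF assms] by blast
  have "hausdorff_content R (cball x n) \<le> ennreal (\<Sum>y\<in>k. vol y R / R)"
    using assms k by (intro hausdorff_content_le_family[of k "\<lambda>_. R"] sum_mono2) auto
  then show ?thesis by (rule le_less_trans) simp
qed

text \<open>Bounded sets are covered by finitely many balls of a fixed radius, so their content is finite and
  the previous self-improvement applies to them.\<close>

lemma hausdorff_content_zero_if_uniformly_small:
  assumes small: "\<And>x r. x \<in> E \<Longrightarrow> 0 < r \<Longrightarrow> r < r0 \<Longrightarrow> hausdorff_content (r / 2) (E \<inter> ball x r) \<le> ennreal (vol x r / (Cd ^ 2 * r))"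
    and r0: "0 < r0" and R: "0 < R"
  shows "hausdorff_content R E = 0"
proof -
  define R' where "R' = min R (r0 / 3)"
  have R': "0 < R'" "R' \<le> R" "2 * R' < r0" using r0 R by (auto simp: R'_def min_def)
  fix p :: 'a
  have "hausdorff_content R' (E \<inter> cball p (real n)) = 0" for n
  proof (rule hausdorff_content_zero_if_locally_small[OF small])
    have "hausdorff_content R' (E \<inter> cball p (real n)) \<le> hausdorff_content R' (cball p (real n))"
      by (intro hausdorff_content_mono) auto
    then show "hausdorff_content R' (E \<inter> cball p (real n)) < \<infinity>"
      using hausdorff_content_bounded_finite[OF R'(1)] by (rule le_less_trans)
  qed (use R' in auto)
  then have "hausdorff_content R' (\<Union>n. E \<inter> cball p (real n)) = 0" by (rule hausdorff_content_UN_zero)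
  moreover have "(\<Union>n. E \<inter> cball p (real n)) = E"
    using real_arch_simple by (auto simp: mem_cball)
  ultimately show ?thesis using hausdorff_content_mono[of E E R' R] R'(2) by simp
qed

end

section \<open>Capacity and content\<close>

definition bump :: "'a::metric_space \<Rightarrow> real \<Rightarrow> 'a \<Rightarrow> real" where
  "bump c \<rho> x = (if 0 < \<rho> then clamp_between 0 1 (2 - dist x c / \<rho>) else 0)"

lemma bump_bounds: "0 \<le> bump c \<rho> x \<and> bump c \<rho> x \<le> 1"
  by (auto simp: bump_def clamp_between_def)

lemma bump_eq_1: "x \<in> ball c \<rho> \<Longrightarrow> bump c \<rho> x = 1"
proof -
  assume x: "x \<in> ball c \<rho>"
  then have "0 < \<rho>" using zero_le_dist[of c x] by (simp del: zero_le_dist)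
  then show ?thesis using x by (simp add: bump_def clamp_between_def dist_commute field_simps)
qed

lemma bump_le_indicator: "bump c \<rho> x \<le> indicator (ball c (2 * \<rho>)) x"
  by (auto simp: bump_def clamp_between_def indicator_def dist_commute field_simps)

lemma borel_measurable_bump: "bump c \<rho> \<in> borel_measurable borel"
proof (cases "0 < \<rho>")
  case True
  then have "bump c \<rho> = (\<lambda>x. clamp_between 0 1 (2 - dist x c / \<rho>))" by (auto simp: bump_def)
  moreover have "continuous_on UNIV (\<lambda>x. clamp_between 0 1 (2 - dist x c / \<rho>))"
    unfolding clamp_between_def using True by (intro continuous_intros) auto
  ultimately show ?thesis by (simp add: borel_measurable_continuous_onI)
next
  case False
  then have "bump c \<rho> = (\<lambda>_. 0)" by (auto simp: bump_def)
  then show ?thesis by simp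
qed

text \<open>The bump varies only where the distance to \<open>c\<close> is between \<open>\<rho>\<close> and \<open>2 * \<rho>\<close>, which the
  truncation estimate detects.\<close>

lemma path_upper_gradient_bump:
  "path_upper_gradient (bump c \<rho>) (\<lambda>x. ennreal (1 / \<rho>) * indicator (ball c (2 * \<rho>)) x)"
proof (cases "0 < \<rho>")
  case False
  then show ?thesis by (simp add: bump_def path_upper_gradient_def)
next
  case \<rho>: True
  let ?v = "\<lambda>x. 2 - dist x c / \<rho>"
  have ug: "path_upper_gradient ?v (\<lambda>_. ennreal (1 / \<rho>))"
    unfolding path_upper_gradient_def
  proof (intro allI impI)
    fix h :: "real \<Rightarrow> 'a" and a b :: real
    assume ab: "a \<le> b" and h: "1-lipschitz_on {a..b} h"
    have "\<bar>dist (h b) c - dist (h a) c\<bar> \<le> dist (h a) (h b)"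
      using dist_triangle[of "h b" c "h a"] dist_triangle[of "h a" c "h b"] by (simp add: dist_commute)
    also have "\<dots> \<le> b - a"
      using lipschitz_onD[OF h, of a b] ab by (simp add: dist_real_def)
    finally have "\<bar>dist (h b) c - dist (h a) c\<bar> / \<rho> \<le> (b - a) / \<rho>"
      using \<rho> by (intro divide_right_mono) auto
    moreover have "\<bar>?v (h a) - ?v (h b)\<bar> = \<bar>dist (h b) c - dist (h a) c\<bar> / \<rho>"
      using \<rho> by (simp add: abs_divide flip: diff_divide_distrib)
    ultimately have "ennreal \<bar>?v (h a) - ?v (h b)\<bar> \<le> ennreal (1 / \<rho> * (b - a))"
      by (intro ennreal_leI) simp
    also have "\<dots> = (\<integral>\<^sup>+ t \<in> {a..b}. ennreal (1 / \<rho>) \<partial>lborel)"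
      using ab \<rho> by (subst ennreal_mult) (auto simp: nn_integral_cmult_indicator)
    finally show "ennreal \<bar>?v (h a) - ?v (h b)\<bar> \<le> (\<integral>\<^sup>+ t \<in> {a..b}. ennreal (1 / \<rho>) \<partial>lborel)" .
  qed
  show ?thesis
    unfolding path_upper_gradient_def
  proof (intro allI impI)
    fix h :: "real \<Rightarrow> 'a" and a b :: real
    assume ab: "a \<le> b" and h: "1-lipschitz_on {a..b} h"
    have "(\<integral>\<^sup>+ t \<in> {a..b}. ennreal (1 / \<rho>) \<partial>lborel) < \<infinity>"
      using ab by (simp add: nn_integral_cmult_indicator ennreal_mult_less_top)
    from clamp_between_path_increment[OF ug _ ab h this, of 0 1]
    have "ennreal \<bar>bump c \<rho> (h a) - bump c \<rho> (h b)\<bar>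
      \<le> (\<integral>\<^sup>+ t \<in> {a..b}. ennreal (1 / \<rho>) * indicator {x. 0 < ?v x \<and> ?v x < 1} (h t) \<partial>lborel)"
      using \<rho> by (simp add: bump_def)
    also have "\<dots> \<le> (\<integral>\<^sup>+ t \<in> {a..b}. ennreal (1 / \<rho>) * indicator (ball c (2 * \<rho>)) (h t) \<partial>lborel)"
      using \<rho> by (intro nn_integral_mono) (auto simp: indicator_def dist_commute field_simps)
    finally show "ennreal \<bar>bump c \<rho> (h a) - bump c \<rho> (h b)\<bar>
      \<le> (\<integral>\<^sup>+ t \<in> {a..b}. ennreal (1 / \<rho>) * indicator (ball c (2 * \<rho>)) (h t) \<partial>lborel)" .
  qed
qed

lemma ennreal_le_suminf: "(f j :: ennreal) \<le> (\<Sum>j. f j)"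
  using sum_le_suminf[of f "{j}"] by simp

text \<open>Take the supremum of Lipschitz bumps on the balls of the covering. As the radii are at most \<open>1\<close>,
  the mass of the bumps is dominated by that of their gradients.\<close>

lemma (in doubling_measure) competitor_from_cover:
  assumes cov: "covers 1 E c \<rho>"
  shows "\<exists>u G. u \<in> borel_measurable borel \<and> (\<forall>x. 0 \<le> u x) \<and> (\<forall>x\<in>E. u x = (1::real)) \<and> G \<in> borel_measurable borel \<and>
    path_upper_gradient u G \<and>
    (\<integral>\<^sup>+ x. ennreal (u x) \<partial>M) + (\<integral>\<^sup>+ x. G x \<partial>M) \<le> ennreal (2 * Cd) * cost c \<rho>"
proof -
  have \<rho>: "0 \<le> \<rho> j" "\<rho> j \<le> 1" for j using cov by (auto simp: covers_def)
  define u where "u x = (SUP j. bump (c j) (\<rho> j) x)" for x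
  define G where "G x = (\<Sum>j. ennreal (1 / \<rho> j) * indicator (ball (c j) (2 * \<rho> j)) x)" for x
  have bdd: "bdd_above (range (\<lambda>j. bump (c j) (\<rho> j) x))" for x
    using bump_bounds by (auto intro!: bdd_aboveI[of _ 1])
  have up: "bump (c j) (\<rho> j) x \<le> u x" for j x
    unfolding u_def using bdd by (intro cSUP_upper) auto
  have u01: "0 \<le> u x" "u x \<le> 1" for x
  proof -
    show "0 \<le> u x" using up[of 0 x] bump_bounds[of "c 0" "\<rho> 0" x] by linarith
    show "u x \<le> 1" unfolding u_def using bump_bounds by (intro cSUP_least) auto
  qed
  have ub: "u \<in> borel_measurable borel"
    unfolding u_def[abs_def] using bdd by (intro borel_measurable_cSUP borel_measurable_bump) auto
  have Gb: "G \<in> borel_measurable borel"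
    unfolding G_def[abs_def]
    by (intro borel_measurable_suminf_order borel_measurable_times_ennreal borel_measurable_const borel_measurable_indicator) simp
  have u1: "u x = 1" if "x \<in> E" for x
  proof -
    have "x \<in> (\<Union>j. ball (c j) (\<rho> j))" using that cov unfolding covers_def by blast
    then obtain j where "x \<in> ball (c j) (\<rho> j)" by blast
    then show ?thesis using up[of j x] bump_eq_1[of x "c j" "\<rho> j"] u01(2)[of x] by simp
  qed
  have ug: "path_upper_gradient u G"
    unfolding u_def[abs_def]
  proof (rule path_upper_gradient_SUP[OF path_upper_gradient_bump])
    show "ennreal (1 / \<rho> j) * indicator (ball (c j) (2 * \<rho> j)) x \<le> G x" for j x
      unfolding G_def by (rule ennreal_le_suminf)
  qed (use bump_bounds in auto)
  have "(\<integral>\<^sup>+ x. ennreal (u x) \<partial>M) \<le> (\<integral>\<^sup>+ x. (\<Sum>j. indicator (ball (c j) (2 * \<rho> j)) x) \<partial>M)"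
  proof (rule nn_integral_mono)
    fix x
    show "ennreal (u x) \<le> (\<Sum>j. indicator (ball (c j) (2 * \<rho> j)) x)"
    proof (cases "\<exists>j. x \<in> ball (c j) (2 * \<rho> j)")
      case True
      then obtain j where j: "x \<in> ball (c j) (2 * \<rho> j)" ..
      have "ennreal (u x) \<le> 1" using u01(2) by (simp add: ennreal_le_1)
      also have "\<dots> = indicator (ball (c j) (2 * \<rho> j)) x" using j by simp
      also have "\<dots> \<le> (\<Sum>j. indicator (ball (c j) (2 * \<rho> j)) x)"
        by (rule ennreal_le_suminf)
      finally show ?thesis .
    next
      case False
      have "bump (c j) (\<rho> j) x \<le> 0" for j
        using bump_le_indicator[of "c j" "\<rho> j" x] False by (simp add: indicator_def split: if_splits)
      then have "u x \<le> 0" unfolding u_def by (intro cSUP_least) auto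
      then show ?thesis by (simp add: ennreal_neg)
    qed
  qed
  also have "\<dots> = (\<Sum>j. ennreal (vol (c j) (2 * \<rho> j)))"
    by (simp add: nn_integral_suminf emeasure_ball)
  finally have iu: "(\<integral>\<^sup>+ x. ennreal (u x) \<partial>M) \<le> (\<Sum>j. ennreal (vol (c j) (2 * \<rho> j)))" .
  have iG: "(\<integral>\<^sup>+ x. G x \<partial>M) = (\<Sum>j. ennreal (1 / \<rho> j) * ennreal (vol (c j) (2 * \<rho> j)))"
    unfolding G_def by (simp add: nn_integral_suminf nn_integral_cmult_indicator emeasure_ball)
  have "(\<integral>\<^sup>+ x. ennreal (u x) \<partial>M) + (\<integral>\<^sup>+ x. G x \<partial>M)
      \<le> (\<Sum>j. ennreal (vol (c j) (2 * \<rho> j)) + ennreal (1 / \<rho> j) * ennreal (vol (c j) (2 * \<rho> j)))"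
    unfolding iG using iu by (subst suminf_add[symmetric]) (auto intro: add_right_mono)
  also have "\<dots> \<le> (\<Sum>j. ennreal (2 * Cd) * ennreal (vol (c j) (\<rho> j) / \<rho> j))"
  proof (rule suminf_le)
    fix j
    show "ennreal (vol (c j) (2 * \<rho> j)) + ennreal (1 / \<rho> j) * ennreal (vol (c j) (2 * \<rho> j))
      \<le> ennreal (2 * Cd) * ennreal (vol (c j) (\<rho> j) / \<rho> j)"
    proof (cases "\<rho> j = 0")
      case False
      then have pos: "0 < \<rho> j" using \<rho>(1)[of j] by simp
      have "ennreal (vol (c j) (2 * \<rho> j)) + ennreal (1 / \<rho> j) * ennreal (vol (c j) (2 * \<rho> j))
        = ennreal (vol (c j) (2 * \<rho> j) + 1 / \<rho> j * vol (c j) (2 * \<rho> j))"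
        using pos by (simp add: ennreal_mult[symmetric] ennreal_plus[symmetric] del: ennreal_plus)
      also have "\<dots> \<le> ennreal (2 * Cd * (vol (c j) (\<rho> j) / \<rho> j))"
      proof (rule ennreal_leI)
        have "vol (c j) (2 * \<rho> j) + 1 / \<rho> j * vol (c j) (2 * \<rho> j) = (1 + 1 / \<rho> j) * vol (c j) (2 * \<rho> j)"
          by (simp add: algebra_simps)
        also have "\<dots> \<le> (2 / \<rho> j) * (Cd * vol (c j) (\<rho> j))"
          using pos \<rho>(2)[of j] vol_doubling[OF pos] by (intro mult_mono) (auto simp: field_simps)
        finally show "vol (c j) (2 * \<rho> j) + 1 / \<rho> j * vol (c j) (2 * \<rho> j) \<le> 2 * Cd * (vol (c j) (\<rho> j) / \<rho> j)"
          by simp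
      qed
      also have "\<dots> = ennreal (2 * Cd) * ennreal (vol (c j) (\<rho> j) / \<rho> j)"
        using pos Cd_ge_1 by (intro ennreal_mult) auto
      finally show ?thesis .
    qed simp
  qed auto
  also have "\<dots> = ennreal (2 * Cd) * cost c \<rho>"
    by (rule ennreal_suminf_cmult)
  finally show ?thesis
    using ub u01(1) u1 Gb ug by blast
qed

context poincare_space
begin

text \<open>With this bound on the capacity, the total cost of a covering given by the boxing inequality is half
  of the least possible cost of a ball in it of radius more than \<open>r / 2\<close>.\<close>

definition small_const :: real where
  "small_const = 1 / (80 * \<Lambda> * Cd ^ 2 * boxing_const)"

lemma small_const_pos: "0 < small_const"
  unfolding small_const_def using \<Lambda>_ge_1 Cd_ge_1 boxing_const_pos by (intro divide_pos_pos mult_pos_pos) auto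

text \<open>If the capacity is small enough, then the covering balls given by the boxing inequality are
  automatically small, since one of comparable radius would already cost too much.\<close>

lemma content_le_if_capacity_small:
  fixes x p :: 'a
  assumes r: "0 < r" and p: "4 * r \<le> dist x p" and S: "S \<subseteq> ball x r"
    and ug: "upper_gradient u \<rho>" and u1: "\<And>y. y \<in> S \<Longrightarrow> 1 \<le> u y"
    and u0: "\<And>y. y \<notin> ball x (2 * r) \<Longrightarrow> u y = 0"
    and I: "(\<integral>\<^sup>+ y. \<rho> y \<partial>M) \<le> ennreal (small_const * vol x r / r)"
  shows "hausdorff_content (r / 2) S \<le> ennreal (vol x r / (Cd ^ 2 * r))"
proof -
  define B where "B = vol x r / (80 * \<Lambda> * Cd ^ 2 * r)"
  have vx: "0 < vol x r" using r by (rule vol_pos)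
  have "0 < small_const * vol x r / r" using small_const_pos vx r by simp
  then have "\<exists>A\<subseteq>S. \<exists>R. (\<forall>y\<in>A. 0 < R y \<and> R y \<le> 40 * \<Lambda> * r) \<and> S \<subseteq> (\<Union>y\<in>A. ball y (R y)) \<and>
    (\<forall>F. finite F \<and> F \<subseteq> A \<longrightarrow> (\<Sum>y\<in>F. vol y (R y) / R y) \<le> boxing_const * (small_const * vol x r / r))"
    using u1 u0 by (intro boxing_inequality[OF r p S ug _ _ I])
  then obtain A R where A: "A \<subseteq> S" and R: "\<forall>y\<in>A. 0 < R y \<and> R y \<le> 40 * \<Lambda> * r" and cov: "S \<subseteq> (\<Union>y\<in>A. ball y (R y))"
    and bd: "\<forall>F. finite F \<and> F \<subseteq> A \<longrightarrow> (\<Sum>y\<in>F. vol y (R y) / R y) \<le> boxing_const * (small_const * vol x r / r)"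
    by (elim exE conjE)
  have "boxing_const * (small_const * vol x r / r) = B"
    using boxing_const_pos by (simp add: small_const_def B_def)
  with bd have bdB: "(\<Sum>y\<in>F. vol y (R y) / R y) \<le> B" if "finite F" "F \<subseteq> A" for F
    using that by simp
  have "R y \<le> r / 2" if y: "y \<in> A" for y
  proof (rule ccontr)
    assume "\<not> R y \<le> r / 2"
    then have big: "r / 2 < R y" by simp
    have Ry: "0 < R y" "R y \<le> 40 * \<Lambda> * r" using R y by auto
    have "dist x y < r" using A S y by auto
    then have "vol x r \<le> Cd ^ 2 * vol y (R y)" using big Ry by (intro vol_compare) auto
    then have "vol x r / (Cd ^ 2 * (40 * \<Lambda> * r)) \<le> vol y (R y) / (40 * \<Lambda> * r)"
      using Cd_ge_1 \<Lambda>_ge_1 r by (simp add: field_simps)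
    also have "\<dots> \<le> vol y (R y) / R y" using Ry by (intro divide_left_mono) auto
    also have "\<dots> \<le> B" using bdB[of "{y}"] y by simp
    finally have "vol x r / (Cd ^ 2 * (40 * \<Lambda> * r)) \<le> B" .
    moreover have "B = 1/2 * (vol x r / (Cd ^ 2 * (40 * \<Lambda> * r)))" by (simp add: B_def)
    moreover have "0 < vol x r / (Cd ^ 2 * (40 * \<Lambda> * r))" using vx Cd_ge_1 \<Lambda>_ge_1 r by (intro divide_pos_pos mult_pos_pos) auto
    ultimately show False by linarith
  qed
  then have "hausdorff_content (r / 2) S \<le> ennreal B"
    using R r by (intro hausdorff_content_le_family[OF _ _ cov bdB]) auto
  also have "B \<le> vol x r / (Cd ^ 2 * r)"
    unfolding B_def
  proof (rule divide_left_mono)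
    have "1 * (Cd ^ 2 * r) \<le> (80 * \<Lambda>) * (Cd ^ 2 * r)"
      using \<Lambda>_ge_1 r by (intro mult_right_mono) auto
    then show "Cd ^ 2 * r \<le> 80 * \<Lambda> * Cd ^ 2 * r" by (simp add: mult.assoc)
  qed (use Cd_ge_1 \<Lambda>_ge_1 r in \<open>auto intro!: mult_pos_pos\<close>)
  finally show ?thesis by (simp add: ennreal_leI)
qed

end

section \<open>The capacity of the points of thinness\<close>

lemma emeasure_outer_meas_borel:
  assumes "borel_regular_outer_measure \<mu>" "B \<in> sets borel"
  shows "B \<in> sets (outer_meas \<mu>)" "emeasure (outer_meas \<mu>) B = \<mu> B"
proof -
  have om: "outer_measure_space (Pow UNIV) \<mu>" and B: "B \<in> lambda_system UNIV (Pow UNIV) \<mu>"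
    using assms by (auto simp: borel_regular_outer_measure_def)
  show "B \<in> sets (outer_meas \<mu>)" using B by (simp add: sets_outer_meas[OF om])
  show "emeasure (outer_meas \<mu>) B = \<mu> B" by (rule emeasure_outer_meas[OF om B])
qed

lemma doubling_measure_outer_meas:
  assumes \<mu>: "borel_regular_outer_measure \<mu>" and "doubling \<mu>"
  shows "\<exists>Cd. doubling_measure (outer_meas \<mu>) Cd"
proof -
  obtain C :: real where C: "1 \<le> C" and d: "\<forall>x. \<forall>r>0.
     0 < \<mu> (ball x (2 * r)) \<and> \<mu> (ball x (2 * r)) \<le> ennreal C * \<mu> (ball x r) \<and> ennreal C * \<mu> (ball x r) < \<infinity>"
    using assms(2) unfolding doubling_def by (elim exE conjE)
  have om: "outer_measure_space (Pow UNIV) \<mu>" using \<mu> by (simp add: borel_regular_outer_measure_def)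
  have em: "emeasure (outer_meas \<mu>) (ball x r) = \<mu> (ball x r)" for x r
    by (rule emeasure_outer_meas_borel[OF \<mu>]) simp
  have "doubling_measure (outer_meas \<mu>) C"
  proof
    show "sets borel \<subseteq> sets (outer_meas \<mu>)" using emeasure_outer_meas_borel(1)[OF \<mu>] by blast
    show "space (outer_meas \<mu>) = UNIV" by (rule space_outer_meas[OF om])
    show "1 \<le> C" by (rule C)
    show "0 < emeasure (outer_meas \<mu>) (ball x r)" if "0 < r" for x r
      using d[rule_format, of "r / 2" x] that by (simp add: em)
    show "emeasure (outer_meas \<mu>) (ball x (2 * r)) \<le> ennreal C * emeasure (outer_meas \<mu>) (ball x r)" if "0 < r" for x r
      using d[rule_format, of r x] that by (simp add: em)
    show "emeasure (outer_meas \<mu>) (ball x r) < \<infinity>" for x r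
    proof (cases "0 < r")
      case True
      have "1 * \<mu> (ball x r) \<le> ennreal C * \<mu> (ball x r)"
        using C by (intro mult_right_mono) auto
      then have "1 * \<mu> (ball x r) < \<infinity>" using d[rule_format, OF True, of x] by (auto intro: le_less_trans)
      then show ?thesis by (simp add: em)
    next
      case False
      then have "ball x r = {}" by (simp add: not_less)
      then show ?thesis by (simp only: emeasure_empty) simp
    qed
  qed
  then show ?thesis ..
qed

lemma poincare_space_outer_meas:
  fixes \<mu> :: "'a::complete_space set \<Rightarrow> ennreal"
  assumes \<mu>: "borel_regular_outer_measure \<mu>" and d: "doubling \<mu>" and p: "supports_poincare_1_1 \<mu>"
  shows "\<exists>Cd Cp \<Lambda>. poincare_space (outer_meas \<mu>) Cd Cp \<Lambda>"
proof -
  obtain Cd where "doubling_measure (outer_meas \<mu>) Cd"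
    using doubling_measure_outer_meas[OF \<mu> d] ..
  then interpret doubling_measure "outer_meas \<mu>" Cd .
  obtain C \<Lambda> :: real where C: "0 < C" "1 \<le> \<Lambda>" and P: "\<forall>x. \<forall>r>0. \<forall>u\<in>L1_loc \<mu>. \<forall>g. upper_gradient u g \<longrightarrow>
        (\<integral>\<^sup>+ y \<in> ball x r. ext_diff (u y) (ereal (mean_value \<mu> u x r)) \<partial>outer_meas \<mu>)
          / \<mu> (ball x r)
        \<le> ennreal (C * r) *
          ((\<integral>\<^sup>+ y \<in> ball x (\<Lambda> * r). g y \<partial>outer_meas \<mu>) / \<mu> (ball x (\<Lambda> * r)))"
    using p unfolding supports_poincare_1_1_def by (elim exE conjE)
  have em: "emeasure (outer_meas \<mu>) (ball x r) = \<mu> (ball x r)" for x r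
    by (rule emeasure_outer_meas_borel[OF \<mu>]) simp
  have "poincare_space (outer_meas \<mu>) Cd C \<Lambda>"
  proof
    fix x and r :: real and w :: "'a \<Rightarrow> real" and G
    assume r: "0 < r" and w: "w \<in> borel_measurable borel" and w01: "\<And>y. 0 \<le> w y \<and> w y \<le> 1"
      and G: "G \<in> borel_measurable borel" and ug: "path_upper_gradient w G"
    have L1: "(\<lambda>y. ereal (w y)) \<in> L1_loc \<mu>"
    proof -
      have "(\<integral>\<^sup>+ y \<in> ball x 1. e2ennreal \<bar>ereal (w y)\<bar> \<partial>outer_meas \<mu>) < \<infinity>" for x
      proof -
        have "(\<integral>\<^sup>+ y \<in> ball x 1. e2ennreal \<bar>ereal (w y)\<bar> \<partial>outer_meas \<mu>) \<le> (\<integral>\<^sup>+ y. indicator (ball x 1) y \<partial>outer_meas \<mu>)"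
          using w01 by (intro nn_integral_mono) (auto simp: indicator_def)
        also have "\<dots> < \<infinity>" using emeasure_ball_finite[of x 1] by simp
        finally show ?thesis .
      qed
      then show ?thesis
        using borel_measurable_M[OF w] unfolding L1_loc_def by (auto intro!: exI[of _ "1::real"])
    qed
    let ?m = "mean_value \<mu> (\<lambda>y. ereal (w y)) x r"
    let ?V = "\<mu> (ball x r)" and ?V' = "\<mu> (ball x (\<Lambda> * r))"
    let ?a = "\<integral>\<^sup>+ y \<in> ball x r. ennreal \<bar>w y - ?m\<bar> \<partial>outer_meas \<mu>"
    let ?g = "\<integral>\<^sup>+ y \<in> ball x (\<Lambda> * r). G y \<partial>outer_meas \<mu>"
    have "?a / ?V \<le> ennreal (C * r) * (?g / ?V')"
      using P[rule_format, OF r L1 upper_gradient_if_path_upper_gradient[OF G ug], of x] by simp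
    then have "?a / ?V * ?V \<le> ennreal (C * r) * (?g / ?V') * ?V" by (rule mult_right_mono) simp
    also have "?a / ?V * ?V = ?a"
      using emeasure_ball_pos[OF r, of x] emeasure_ball_finite[of x r] unfolding em
      by (simp add: ennreal_divide_times)
    also have "ennreal (C * r) * (?g / ?V') * ?V = ennreal (C * r) * (?g * (?V / ?V'))"
      by (simp only: mult.assoc ennreal_divide_times)
    also have "\<dots> \<le> ennreal (C * r) * (?g * 1)"
    proof (intro mult_left_mono)
      have "ball x r \<subseteq> ball x (\<Lambda> * r)" using C(2) r by (intro subset_ball) simp
      then have "?V \<le> ?V'" unfolding em[symmetric] by (intro emeasure_mono) auto
      then have "?V / ?V' \<le> ?V' / ?V'" by (rule divide_right_mono_ennreal)
      also have "\<dots> = 1"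
        using emeasure_ball_pos[of "\<Lambda> * r" x] emeasure_ball_finite[of x "\<Lambda> * r"] C(2) r unfolding em by simp
      finally show "?V / ?V' \<le> 1" .
    qed simp_all
    finally have "?a \<le> ennreal (C * r) * ?g" by simp
    then show "\<exists>m::real. (\<integral>\<^sup>+ y \<in> ball x r. ennreal \<bar>w y - m\<bar> \<partial>outer_meas \<mu>)
        \<le> ennreal (C * r) * (\<integral>\<^sup>+ y \<in> ball x (\<Lambda> * r). G y \<partial>outer_meas \<mu>)" ..
  qed (use C in auto)
  then show ?thesis by blast
qed

lemma weak_upper_gradient_if_upper_gradient:
  assumes "upper_gradient u g"
  shows "weak_upper_gradient \<mu> u g"
proof -
  have "modulus1 \<mu> {} \<le> (\<integral>\<^sup>+ x. 0 \<partial>outer_meas \<mu>)"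
    unfolding modulus1_def by (rule INF_lower) simp
  then have "modulus1 \<mu> {} = 0" by simp
  then show ?thesis using assms unfolding weak_upper_gradient_def upper_gradient_def by blast
qed

lemma Cap1_zero_if_content_zero:
  fixes \<mu> :: "'a::metric_space set \<Rightarrow> ennreal"
  assumes "doubling_measure (outer_meas \<mu>) Cd" and zero: "doubling_measure.hausdorff_content (outer_meas \<mu>) 1 E = 0"
  shows "Cap1 \<mu> E = 0"
proof -
  interpret doubling_measure "outer_meas \<mu>" Cd by fact
  have eps: "Cap1 \<mu> E \<le> 0 + ennreal e" if e: "0 < e" for e
  proof -
    define s where "s = e / (2 * Cd)"
    have s: "0 < s" "2 * Cd * s = e" using e Cd_ge_1 by (simp_all add: s_def)
    obtain c \<rho> where cov: "covers 1 E c \<rho>" and less: "cost c \<rho> < ennreal s"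
      using hausdorff_content_lessD[of 1 E "ennreal s"] zero s(1) by auto
    obtain u G where u: "u \<in> borel_measurable borel" "\<forall>x. 0 \<le> u x" "\<forall>x\<in>E. u x = (1::real)"
      and G: "G \<in> borel_measurable borel" and ug: "path_upper_gradient u G"
      and le: "(\<integral>\<^sup>+ x. ennreal (u x) \<partial>outer_meas \<mu>) + (\<integral>\<^sup>+ x. G x \<partial>outer_meas \<mu>)
        \<le> ennreal (2 * Cd) * cost c \<rho>"
      using competitor_from_cover[OF cov] by (elim exE conjE)
    let ?u = "\<lambda>x. ereal (u x)"
    have "N11_norm \<mu> ?u \<le> (\<integral>\<^sup>+ x. ennreal (u x) \<partial>outer_meas \<mu>) + (\<integral>\<^sup>+ x. G x \<partial>outer_meas \<mu>)"
      unfolding N11_norm_def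
    proof (intro add_mono INF_lower)
      show "(\<integral>\<^sup>+ x. e2ennreal \<bar>ereal (u x)\<bar> \<partial>outer_meas \<mu>) \<le> (\<integral>\<^sup>+ x. ennreal (u x) \<partial>outer_meas \<mu>)"
        using u(2) by simp
      show "G \<in> {g. weak_upper_gradient \<mu> ?u g}"
        using weak_upper_gradient_if_upper_gradient[OF upper_gradient_if_path_upper_gradient[OF G ug]] by simp
    qed
    also note le
    also have "ennreal (2 * Cd) * cost c \<rho> \<le> ennreal (2 * Cd) * ennreal s"
      using less by (intro mult_left_mono) auto
    also have "\<dots> = ennreal e"
      using s Cd_ge_1 by (simp add: ennreal_mult[symmetric])
    finally have norm: "N11_norm \<mu> ?u \<le> ennreal e" .
    then have "N11_norm \<mu> ?u < \<infinity>" by (rule le_less_trans) simp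
    then have "?u \<in> N11 \<mu>" using borel_measurable_M[OF u(1)] by (simp add: N11_def)
    then have "Cap1 \<mu> E \<le> N11_norm \<mu> ?u"
      unfolding Cap1_def using u(3) by (intro INF_lower) (simp add: one_ereal_def)
    with norm show ?thesis by simp
  qed
  have "Cap1 \<mu> E \<le> 0" by (rule ennreal_le_epsilon) (rule eps)
  then show ?thesis by simp
qed

text \<open>The points of \<open>A\<close> at which \<open>A\<close> is thin form a countable union of sets \<open>F k\<close> on which the capacity
  densities are small uniformly on all scales below \<open>1 / Suc k\<close>; for these, the boxing inequality
  gives the hypothesis of the self-improvement of the content.\<close>

lemma (in poincare_space) content_zero_if_thin:
  fixes \<mu> :: "'a set \<Rightarrow> ennreal" and A :: "'a set"
  assumes M: "M = outer_meas \<mu>" and \<mu>: "borel_regular_outer_measure \<mu>" and ab: "a \<noteq> (b :: 'a)"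
    and R: "0 < R"
  shows "hausdorff_content R (A - base1 \<mu> A) = 0"
proof -
  have em: "\<mu> (ball x r) = ennreal (vol x r)" for x r
    using emeasure_outer_meas_borel(2)[OF \<mu>, of "ball x r"] emeasure_ball[of x r] by (simp add: M)
  define q where "q x r = ennreal r * (cap1 \<mu> (A \<inter> ball x r) (ball x (2 * r)) / \<mu> (ball x r))" for x r
  define F where "F k = {x \<in> A. \<forall>r. 0 < r \<and> r < inverse (real (Suc k)) \<longrightarrow> q x r < ennreal small_const}" for k
  \<comment> \<open>Every point has distance at least \<open>dist a b / 2\<close> from \<open>a\<close> or from \<open>b\<close>, so balls of radius less than
    \<open>d\<close> are small compared with the space.\<close>
  define d where "d = dist a b / 8"
  have d: "0 < d" using ab by (simp add: d_def)
  have far: "\<exists>p. 4 * d \<le> dist x p" for x :: 'a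
  proof -
    have "8 * d \<le> dist x a + dist x b"
      using dist_triangle[of a b x] by (simp add: d_def dist_commute)
    then have "4 * d \<le> dist x a \<or> 4 * d \<le> dist x b" by linarith
    then show ?thesis by blast
  qed
  have "A - base1 \<mu> A \<subseteq> (\<Union>k. F k)"
  proof
    fix x assume x: "x \<in> A - base1 \<mu> A"
    then have "((\<lambda>r. q x r) \<longlongrightarrow> 0) (at_right 0)"
      by (simp add: base1_def thin1_at_def q_def)
    then have "\<forall>\<^sub>F r in at_right 0. q x r < ennreal small_const"
      using small_const_pos by (intro order_tendstoD(2)) auto
    then obtain e where e: "0 < e" "\<And>r. 0 < r \<Longrightarrow> r < e \<Longrightarrow> q x r < ennreal small_const"
      unfolding eventually_at_right_field by auto
    obtain k where "inverse (real (Suc k)) < e" using reals_Archimedean[OF e(1)] ..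
    then have "x \<in> F k" using e(2) x by (simp add: F_def)
    then show "x \<in> (\<Union>k. F k)" by blast
  qed
  moreover have "hausdorff_content R (F k) = 0" for k
  proof (rule hausdorff_content_zero_if_uniformly_small[of "F k" "min d (inverse (real (Suc k)))"])
    fix x r assume x: "x \<in> F k" and r: "0 < r" "r < min d (inverse (real (Suc k)))"
    obtain p where p: "4 * d \<le> dist x p" using far by blast
    have vr: "0 < vol x r" using r(1) by (rule vol_pos)
    have qs: "q x r < ennreal small_const" using x r by (simp add: F_def)
    have "cap1 \<mu> (A \<inter> ball x r) (ball x (2 * r)) < ennreal (small_const * vol x r / r)"
    proof (rule ccontr)
      assume "\<not> ?thesis"
      then have "ennreal (small_const * vol x r / r) \<le> cap1 \<mu> (A \<inter> ball x r) (ball x (2 * r))" by simp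
      then have "ennreal r * (ennreal (small_const * vol x r / r) / ennreal (vol x r)) \<le> q x r"
        unfolding q_def em by (intro mult_left_mono divide_right_mono_ennreal) auto
      moreover have "ennreal r * (ennreal (small_const * vol x r / r) / ennreal (vol x r)) = ennreal small_const"
        using r(1) vr small_const_pos by (simp add: divide_ennreal ennreal_mult[symmetric])
      ultimately show False using qs by simp
    qed
    then obtain u g where u: "\<forall>y\<in>A \<inter> ball x r. 1 \<le> u y" "\<forall>y\<in>- ball x (2 * r). u y = 0"
      and ug: "upper_gradient u g" and I: "(\<integral>\<^sup>+ y. g y \<partial>outer_meas \<mu>) < ennreal (small_const * vol x r / r)"
      unfolding cap1_def INF_less_iff by auto
    show "hausdorff_content (r / 2) (F k \<inter> ball x r) \<le> ennreal (vol x r / (Cd ^ 2 * r))"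
    proof (rule content_le_if_capacity_small[OF r(1) _ _ ug])
      show "4 * r \<le> dist x p" using p r by simp
      show "(\<integral>\<^sup>+ y. g y \<partial>M) \<le> ennreal (small_const * vol x r / r)" using I by (simp add: M)
      show "1 \<le> u y" if "y \<in> F k \<inter> ball x r" for y using u(1) that by (simp add: F_def)
      show "u y = 0" if "y \<notin> ball x (2 * r)" for y using u(2) that by simp
    qed simp
  qed (use d R in auto)
  then have "hausdorff_content R (\<Union>k. F k) = 0" by (rule hausdorff_content_UN_zero)
  ultimately show ?thesis
    using hausdorff_content_mono[of "A - base1 \<mu> A" "\<Union>k. F k" R R] by simp
qed

theorem corollary4p7:
  fixes \<mu> :: "'a::complete_space set \<Rightarrow> ennreal" and A :: "'a set"
  assumes "\<exists>x y::'a. x \<noteq> y"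
    and "borel_regular_outer_measure \<mu>"
    and "doubling \<mu>"
    and "supports_poincare_1_1 \<mu>"
  shows "Cap1 \<mu> (A - base1 \<mu> A) = 0"
proof -
  obtain a b :: 'a where ab: "a \<noteq> b" using assms(1) by blast
  obtain Cd Cp \<Lambda> where "poincare_space (outer_meas \<mu>) Cd Cp \<Lambda>"
    using poincare_space_outer_meas[OF assms(2-4)] by blast
  then interpret poincare_space "outer_meas \<mu>" Cd Cp \<Lambda> .
  have "hausdorff_content 1 (A - base1 \<mu> A) = 0"
    by (rule content_zero_if_thin[OF refl assms(2) ab]) simp
  then show ?thesis
    by (rule Cap1_zero_if_content_zero[OF doubling_measure_axioms])
qed

end
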